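(* Let $k$ be a field of characteristic $p>0$, let $R=k[x_1,\dots,x_n]$ with its standard grading, and let $\mathfrak{m}=(x_1,\dots,x_n)$. Let $(\mathscr{M},\theta)$ be a graded $F$-module over $R$ supported on $\mathfrak{m}$ (i.e. $\operatorname{Supp}_R\mathscr{M}\subseteq\{\mathfrak{m}\}$). Then $\mathscr{M}$, as a graded $R$-module, is isomorphic (by a degree-preserving $R$-module isomorphism) to a direct sum of a (possibly infinite) number of copies of ${}^*E(n)$.
   Context: $R=k[x_1,\dots,x_n]$ is graded with $\deg x_i=1$ and $k$ in degree $0$. A graded $R$-module is an $R$-module $M=\bigoplus_{i\in\mathbb{Z}}M_i$ with $R_iM_j\subseteq M_{i+j}$ for all $i,j$; a homomorphism $\varphi:M\to N$ of graded modules is degree preserving if $\varphi(M_i)\subseteq N_i$ for all $i\in\mathbb{Z}$. For a graded module $M$ and $t\in\mathbb{Z}$, $M(t)$ is the shifted module with $M(t)_i=M_{i+t}$. Frobenius functor: let $R'$ be a copy of $R$, regarded as an $R$-algebra via $r\mapsto r^p$. For an $R$-module $M$, $F(M)=R'\otimes_R M$ (so $r\otimes ax=ra^p\otimes x$), viewed as an $R$-module through left multiplication on $R'=R$; on maps, $F(f)=\mathrm{id}\otimes f$. If $M$ is graded, $F(M)$ is graded by $\deg(r\otimes x)=\deg r+p\cdot\deg x$ for homogeneous $r\in R$, $x\in M$. An $F$-module is an $R$-module $\mathscr{M}$ together with an $R$-module isomorphism $\theta:\mathscr{M}\to F(\mathscr{M})$ (the structure morphism). An $F$-module $(\mathscr{M},\theta)$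 is graded if $\mathscr{M}$ is a graded $R$-module and $\theta$ is degree preserving. ${}^*E={}^*E(R/\mathfrak{m})$ denotes the ${}^*$injective hull of $R/\mathfrak{m}$, i.e. the injective hull of $R/\mathfrak{m}$ (with $R/\mathfrak{m}=k$ in degree $0$) in the category of graded $R$-modules and degree-preserving maps; concretely, $({}^*E)_i=\operatorname{Hom}_k(R_{-i},k)$ for $i\in\mathbb{Z}$ with the natural $R$-action, so its socle lies in degree $0$. Thus the socle of ${}^*E(n)$ lies in degree $-n$. *)

theory Defs
  imports "HOL-Algebra.Algebra" "HOL-Library.Poly_Mapping"
begin

section \<open>The graded polynomial ring\<close>

text \<open>
  The elements of \<open>'k[x\<^sub>0, x\<^sub>1, \<dots>]\<close> are finitely supported functions from monomials to
  coefficients, a monomial being a finitely supported exponent vector.  The ring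
  \<open>mpoly_ring n\<close> is the subring in which only the variables with indices \<open>0, \<dots>, n - 1\<close> occur;
  \<open>n = 0\<close> is allowed.
\<close>

type_synonym 'k mpoly = "(nat \<Rightarrow>\<^sub>0 nat) \<Rightarrow>\<^sub>0 'k"

definition mpoly_ring :: "nat \<Rightarrow> ('k::field mpoly) ring" where
  "mpoly_ring n =
    \<lparr>carrier = {f. \<forall>m\<in>Poly_Mapping.keys f. Poly_Mapping.keys m \<subseteq> {..<n}},
     monoid.mult = (*), one = 1, ring.zero = 0, add = (+)\<rparr>"

definition mpoly_const :: "'k::field \<Rightarrow> 'k mpoly" where
  "mpoly_const c = Poly_Mapping.single 0 c"

definition mpoly_var :: "nat \<Rightarrow> 'k::field mpoly" where
  "mpoly_var i = Poly_Mapping.single (Poly_Mapping.single i 1) 1"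

definition monom_degree :: "(nat \<Rightarrow>\<^sub>0 nat) \<Rightarrow> nat" where
  "monom_degree m = (\<Sum>i\<in>Poly_Mapping.keys m. Poly_Mapping.lookup m i)"

definition mpoly_grading :: "nat \<Rightarrow> int \<Rightarrow> 'k::field mpoly set" where
  "mpoly_grading n d =
    {f \<in> carrier (mpoly_ring n). \<forall>m\<in>Poly_Mapping.keys f. int (monom_degree m) = d}"

definition irrelevant_ideal :: "nat \<Rightarrow> 'k::field mpoly set" where
  "irrelevant_ideal n = Idl\<^bsub>mpoly_ring n\<^esub> (mpoly_var ` {..<n})"


section \<open>Graded modules\<close>

text \<open>
  A grading of \<open>M\<close> is a family \<open>Mg\<close> of subsets of \<open>M\<close> indexed by the integers.  The axiom
  \<open>direct_sum\<close> says that \<open>M\<close> is the internal direct sum of the additive subgroups \<open>Mg i\<close>.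
\<close>

locale graded_module = module R M
  for R :: "('a, 'b) ring_scheme" (structure)
    and Rg :: "int \<Rightarrow> 'a set"
    and M :: "('a, 'm, 'c) module_scheme" (structure)
    and Mg :: "int \<Rightarrow> 'm set" +
  assumes grade_subgroup: "\<And>i. subgroup (Mg i) (add_monoid M)"
    and direct_sum:
      "\<And>x. x \<in> carrier M \<Longrightarrow>
        \<exists>!c. (\<forall>i. c i \<in> Mg i) \<and> finite {i. c i \<noteq> \<zero>\<^bsub>M\<^esub>} \<and>
             x = (\<Oplus>\<^bsub>M\<^esub>i\<in>{i. c i \<noteq> \<zero>\<^bsub>M\<^esub>}. c i)"
    and smult_grade:
      "\<And>i j r x. \<lbrakk>r \<in> Rg i; x \<in> Mg j\<rbrakk> \<Longrightarrow> r \<odot>\<^bsub>M\<^esub> x \<in> Mg (i + j)"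

definition shift_grading :: "(int \<Rightarrow> 'm set) \<Rightarrow> int \<Rightarrow> int \<Rightarrow> 'm set" where
  "shift_grading Mg t i = Mg (i + t)"

definition module_iso ::
    "('a, 'b) ring_scheme \<Rightarrow> ('a, 'm, 'c) module_scheme \<Rightarrow> ('a, 'n, 'd) module_scheme
      \<Rightarrow> ('m \<Rightarrow> 'n) \<Rightarrow> bool" where
  "module_iso R M N f \<longleftrightarrow>
    bij_betw f (carrier M) (carrier N) \<and>
    (\<forall>x\<in>carrier M. \<forall>y\<in>carrier M. f (x \<oplus>\<^bsub>M\<^esub> y) = f x \<oplus>\<^bsub>N\<^esub> f y) \<and>
    (\<forall>r\<in>carrier R. \<forall>x\<in>carrier M. f (r \<odot>\<^bsub>M\<^esub> x) = r \<odot>\<^bsub>N\<^esub> f x)"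

definition degree_preserving :: "(int \<Rightarrow> 'm set) \<Rightarrow> (int \<Rightarrow> 'n set) \<Rightarrow> ('m \<Rightarrow> 'n) \<Rightarrow> bool" where
  "degree_preserving Mg Ng f \<longleftrightarrow> (\<forall>i. f ` Mg i \<subseteq> Ng i)"

text \<open>The direct sum of copies of \<open>N\<close> indexed by \<open>I\<close>.  The ring multiplication and unit, which the
  record type forces on a module, carry no meaning and are left \<open>undefined\<close>, here and below.\<close>

definition copies :: "'i set \<Rightarrow> ('a, 'n, 'c) module_scheme \<Rightarrow> ('a, 'i \<Rightarrow> 'n) module" where
  "copies I N =
    \<lparr>carrier = carrier (sum_group I (\<lambda>_. add_monoid N)),
     monoid.mult = undefined, one = undefined,
     ring.zero = \<one>\<^bsub>sum_group I (\<lambda>_. add_monoid N)\<^esub>,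
     add = monoid.mult (sum_group I (\<lambda>_. add_monoid N)),
     smult = (\<lambda>r x. \<lambda>i\<in>I. r \<odot>\<^bsub>N\<^esub> x i)\<rparr>"

definition copies_grading ::
    "'i set \<Rightarrow> ('a, 'n, 'c) module_scheme \<Rightarrow> (int \<Rightarrow> 'n set) \<Rightarrow> int \<Rightarrow> ('i \<Rightarrow> 'n) set" where
  "copies_grading I N Ng d = {x \<in> carrier (copies I N). \<forall>i\<in>I. x i \<in> Ng d}"


section \<open>Support\<close>

text \<open>The localization of \<open>M\<close> at \<open>P\<close> is the set of fractions \<open>x / s\<close> with \<open>x \<in> M\<close> and
  \<open>s \<in> R - P\<close>, i.e. of equivalence classes of pairs \<open>(x, s)\<close>.\<close>

definition fraction_rel ::
    "('a, 'b) ring_scheme \<Rightarrow> ('a, 'm, 'c) module_scheme \<Rightarrow> 'a set \<Rightarrow> (('m \<times> 'a) \<times> ('m \<times> 'a)) set" where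
  "fraction_rel R M P =
    {((x, s), (y, t)) | x s y t.
      x \<in> carrier M \<and> y \<in> carrier M \<and> s \<in> carrier R - P \<and> t \<in> carrier R - P \<and>
      (\<exists>u\<in>carrier R - P. u \<odot>\<^bsub>M\<^esub> (t \<odot>\<^bsub>M\<^esub> x) = u \<odot>\<^bsub>M\<^esub> (s \<odot>\<^bsub>M\<^esub> y))}"

definition localization ::
    "('a, 'b) ring_scheme \<Rightarrow> ('a, 'm, 'c) module_scheme \<Rightarrow> 'a set \<Rightarrow> ('m \<times> 'a) set set" where
  "localization R M P = (carrier M \<times> (carrier R - P)) // fraction_rel R M P"

definition localization_zero ::
    "('a, 'b) ring_scheme \<Rightarrow> ('a, 'm, 'c) module_scheme \<Rightarrow> 'a set \<Rightarrow> ('m \<times> 'a) set" where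
  "localization_zero R M P = fraction_rel R M P `` {(\<zero>\<^bsub>M\<^esub>, \<one>\<^bsub>R\<^esub>)}"

definition module_support :: "('a, 'b) ring_scheme \<Rightarrow> ('a, 'm, 'c) module_scheme \<Rightarrow> 'a set set" where
  "module_support R M = {P. primeideal P R \<and> localization R M P \<noteq> {localization_zero R M P}}"


section \<open>The Frobenius functor\<close>

text \<open>
  For a map \<open>\<phi>\<close> from \<open>R\<close> to \<open>S\<close>, making \<open>S\<close> an \<open>R\<close>-algebra, \<open>base_change R S \<phi> M\<close> is the tensor
  product of \<open>S\<close> and \<open>M\<close> over \<open>R\<close> as an \<open>S\<close>-module: the free abelian group on the pairs \<open>(s, x)\<close>
  modulo the subgroup generated by the bilinearity relations and by
  \<open>(s \<phi>(a), x) - (s, a x)\<close>.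
\<close>

definition tensor_free ::
    "('s, 'b) ring_scheme \<Rightarrow> ('a, 'm, 'c) module_scheme \<Rightarrow> ('s \<times> 'm \<Rightarrow>\<^sub>0 int) monoid" where
  "tensor_free S M = free_Abelian_group (carrier S \<times> carrier M)"

definition tensor_relations ::
    "('a, 'b) ring_scheme \<Rightarrow> ('s, 'd) ring_scheme \<Rightarrow> ('a \<Rightarrow> 's) \<Rightarrow> ('a, 'm, 'c) module_scheme
      \<Rightarrow> ('s \<times> 'm \<Rightarrow>\<^sub>0 int) set" where
  "tensor_relations R S \<phi> M = generate (tensor_free S M)
    ({frag_of (s \<oplus>\<^bsub>S\<^esub> t, x) - frag_of (s, x) - frag_of (t, x) | s t x.
        s \<in> carrier S \<and> t \<in> carrier S \<and> x \<in> carrier M} \<union>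
     {frag_of (s, x \<oplus>\<^bsub>M\<^esub> y) - frag_of (s, x) - frag_of (s, y) | s x y.
        s \<in> carrier S \<and> x \<in> carrier M \<and> y \<in> carrier M} \<union>
     {frag_of (s \<otimes>\<^bsub>S\<^esub> \<phi> a, x) - frag_of (s, a \<odot>\<^bsub>M\<^esub> x) | s a x.
        s \<in> carrier S \<and> a \<in> carrier R \<and> x \<in> carrier M})"

definition tensor ::
    "('a, 'b) ring_scheme \<Rightarrow> ('s, 'd) ring_scheme \<Rightarrow> ('a \<Rightarrow> 's) \<Rightarrow> ('a, 'm, 'c) module_scheme
      \<Rightarrow> 's \<Rightarrow> 'm \<Rightarrow> ('s \<times> 'm \<Rightarrow>\<^sub>0 int) set" where
  "tensor R S \<phi> M s x = tensor_relations R S \<phi> M #>\<^bsub>tensor_free S M\<^esub> frag_of (s, x)"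

text \<open>Scalar multiplication by \<open>r\<close> is induced by the additive extension of
  \<open>(s, x) \<mapsto> (r s, x)\<close> to the free group; the union below is over the representatives of a class,
  and all of its members coincide.\<close>

definition base_change ::
    "('a, 'b) ring_scheme \<Rightarrow> ('s, 'd) ring_scheme \<Rightarrow> ('a \<Rightarrow> 's) \<Rightarrow> ('a, 'm, 'c) module_scheme
      \<Rightarrow> ('s, ('s \<times> 'm \<Rightarrow>\<^sub>0 int) set) module" where
  "base_change R S \<phi> M =
    \<lparr>carrier = carrier (tensor_free S M Mod tensor_relations R S \<phi> M),
     monoid.mult = undefined, one = undefined,
     ring.zero = \<one>\<^bsub>tensor_free S M Mod tensor_relations R S \<phi> M\<^esub>,
     add = monoid.mult (tensor_free S M Mod tensor_relations R S \<phi> M),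
     smult = (\<lambda>r C. \<Union>c\<in>C. (tensor_relations R S \<phi> M #>\<^bsub>tensor_free S M\<^esub>
                        (frag_extend (\<lambda>(s, x). frag_of (r \<otimes>\<^bsub>S\<^esub> s, x)) c)))\<rparr>"

definition frobenius ::
    "nat \<Rightarrow> ('a, 'b) ring_scheme \<Rightarrow> ('a, 'm, 'c) module_scheme
      \<Rightarrow> ('a, ('a \<times> 'm \<Rightarrow>\<^sub>0 int) set) module" where
  "frobenius p R M = base_change R R (\<lambda>r. r [^]\<^bsub>R\<^esub> p) M"

definition frobenius_grading ::
    "nat \<Rightarrow> ('a, 'b) ring_scheme \<Rightarrow> (int \<Rightarrow> 'a set) \<Rightarrow> ('a, 'm, 'c) module_scheme \<Rightarrow> (int \<Rightarrow> 'm set)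
      \<Rightarrow> int \<Rightarrow> ('a \<times> 'm \<Rightarrow>\<^sub>0 int) set set" where
  "frobenius_grading p R Rg M Mg d = generate (add_monoid (frobenius p R M))
    {tensor R R (\<lambda>r. r [^]\<^bsub>R\<^esub> p) M r x | r x i j. r \<in> Rg i \<and> x \<in> Mg j \<and> i + int p * j = d}"

definition F_module ::
    "nat \<Rightarrow> ('a, 'b) ring_scheme \<Rightarrow> ('a, 'm, 'c) module_scheme
      \<Rightarrow> ('m \<Rightarrow> ('a \<times> 'm \<Rightarrow>\<^sub>0 int) set) \<Rightarrow> bool" where
  "F_module p R M \<theta> \<longleftrightarrow> module R M \<and> module_iso R M (frobenius p R M) \<theta>"

definition graded_F_module ::
    "nat \<Rightarrow> ('a, 'b) ring_scheme \<Rightarrow> (int \<Rightarrow> 'a set) \<Rightarrow> ('a, 'm, 'c) module_scheme \<Rightarrow> (int \<Rightarrow> 'm set)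
      \<Rightarrow> ('m \<Rightarrow> ('a \<times> 'm \<Rightarrow>\<^sub>0 int) set) \<Rightarrow> bool" where
  "graded_F_module p R Rg M Mg \<theta> \<longleftrightarrow>
    F_module p R M \<theta> \<and> graded_module R Rg M Mg \<and>
    degree_preserving Mg (frobenius_grading p R Rg M Mg) \<theta>"


section \<open>The graded injective hull of the residue field\<close>

text \<open>
  An element of the direct sum over \<open>i\<close> of \<open>Hom\<^sub>k(R\<^sub>-\<^sub>i, k)\<close> is encoded as one \<open>k\<close>-linear functional
  on \<open>R\<close>, vanishing on all but finitely many \<open>R\<^sub>j\<close>; the summand of index \<open>i\<close> consists of the
  functionals vanishing on \<open>R\<^sub>j\<close> for all \<open>j \<noteq> -i\<close>.  Outside of the carrier of \<open>R\<close> the value is \<open>0\<close>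
  by convention.  The action of \<open>R\<close> is \<open>(r \<phi>)(s) = \<phi>(r s)\<close>.
\<close>

definition functionals :: "nat \<Rightarrow> ('k::field mpoly \<Rightarrow> 'k) set" where
  "functionals n =
    {\<phi>. (\<forall>f\<in>carrier (mpoly_ring n). \<forall>g\<in>carrier (mpoly_ring n). \<phi> (f + g) = \<phi> f + \<phi> g) \<and>
        (\<forall>c. \<forall>f\<in>carrier (mpoly_ring n). \<phi> (mpoly_const c * f) = c * \<phi> f) \<and>
        (\<forall>f. f \<notin> carrier (mpoly_ring n) \<longrightarrow> \<phi> f = 0)}"

definition star_E :: "nat \<Rightarrow> ('k::field mpoly, 'k mpoly \<Rightarrow> 'k) module" where
  "star_E n =
    \<lparr>carrier = {\<phi> \<in> functionals n. finite {j. \<exists>f\<in>mpoly_grading n j. \<phi> f \<noteq> 0}},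
     monoid.mult = undefined, one = undefined,
     ring.zero = (\<lambda>_. 0),
     add = (\<lambda>\<phi> \<psi> f. \<phi> f + \<psi> f),
     smult = (\<lambda>r \<phi> f. if f \<in> carrier (mpoly_ring n) then \<phi> (r * f) else 0)\<rparr>"

definition star_E_grading :: "nat \<Rightarrow> int \<Rightarrow> ('k::field mpoly \<Rightarrow> 'k) set" where
  "star_E_grading n i = {\<phi> \<in> functionals n. \<forall>j. j \<noteq> - i \<longrightarrow> (\<forall>f\<in>mpoly_grading n j. \<phi> f = 0)}"

end

theory Submission
  imports Defs
begin

text \<open>
  If \<open>B\<close> is a basis of \<open>k\<close> over its subfield of \<open>p\<close>-th powers, the elements \<open>b x\<^sup>a\<close> with \<open>b \<in> B\<close> and all
  exponents \<open>a\<^sub>i < p\<close> form a basis of \<open>R\<close> over itself via the Frobenius. Hence every element of \<open>F(M)\<close>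
  is uniquely a finite sum of terms \<open>b x\<^sup>a \<otimes> y\<close>, and it is annihilated by all variables iff only
  \<open>a = (p - 1, \<dots>, p - 1)\<close> occurs and each \<open>y\<close> lies in the socle of \<open>M\<close>. Through the structure
  morphism this has two consequences. A degree \<open>d\<close> in which the socle is nonzero satisfies
  \<open>d + n = p (d' + n)\<close> with \<open>d'\<close> of the same kind, so descent gives \<open>d = - n\<close>. And if every socle
  element \<open>s\<close> is \<open>(x\<^sub>1 \<cdots> x\<^sub>n)\<^sup>q y\<close> with \<open>x\<^sub>i\<^sup>q\<^sup>+\<^sup>1 y = 0\<close> for all \<open>i\<close>, the same holds for \<open>p q + p - 1\<close> in
  place of \<open>q\<close>, so it holds for arbitrarily large \<open>q\<close>.

  Composing \<open>k\<close>-linear coordinates on the socle, extended to \<open>M\<close>, with the projection to degree \<open>- n\<close>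
  gives functionals \<open>\<psi>\<^sub>i\<close>, and \<open>x \<mapsto> (f \<mapsto> \<psi>\<^sub>i (f x))\<^sub>i\<close> is the isomorphism: it is injective since \<open>M\<close> is
  torsion with socle in degree \<open>- n\<close>, and the elements \<open>y\<close> above provide preimages of the dual basis
  of the monomials.
\<close>

text \<open>The field need not be perfect, so F(M) needs coordinates for k over its p-th powers
  besides those for the exponents. A coordinate is stored with its p-th root taken: it is then
  p^(-1)-linear, and its value can act on M directly. Tensor cosets occur only while the structure
  morphism is unpacked; afterwards everything happens inside M, where coordinates are additive maps
  from M to M. The number -n comes from the degree n (p - 1) of the monomial with all exponents p -
  1: d = n (p - 1) + p d' says the same as d + n = p (d' + n), and the factor p >= 2 drives the
  descent. The conditions x_i^(q+1) y = 0 turn y into a source of dual basis vectors. After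
  multiplication by a complementary monomial, all monomials of the same degree except the intended
  one kill the result, and monomials of other degrees are silenced by the projection to degree -n.
  Large q is needed because monomials of every degree must be reached. The copies are indexed by a
  k-basis of the socle, hence by a set of elements of M.\<close>

type_synonym monomial = "nat \<Rightarrow>\<^sub>0 nat"

abbreviation lookup where "lookup \<equiv> Poly_Mapping.lookup"
abbreviation keys where "keys \<equiv> Poly_Mapping.keys"
abbreviation single where "single \<equiv> Poly_Mapping.single"

section \<open>Polynomials\<close>

lemma mpoly_ring_simps [simp]:
  "x \<otimes>\<^bsub>mpoly_ring n\<^esub> y = x * y"
  "x \<oplus>\<^bsub>mpoly_ring n\<^esub> y = x + y"
  "\<one>\<^bsub>mpoly_ring n\<^esub> = 1"
  "\<zero>\<^bsub>mpoly_ring n\<^esub> = 0"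
  by (simp_all add: mpoly_ring_def)

lemma mem_mpoly_ring:
  "f \<in> carrier (mpoly_ring n) \<longleftrightarrow> (\<forall>m\<in>keys f. keys m \<subseteq> {..<n})"
  by (simp add: mpoly_ring_def)

lemma keys_monomial_add: "keys (a + b :: monomial) = keys a \<union> keys b"
  by (auto simp: in_keys_iff lookup_add)

lemma mpoly_ring_closed [simp, intro]:
  fixes f g :: "'k::field mpoly"
  shows "0 \<in> carrier (mpoly_ring n)" "1 \<in> carrier (mpoly_ring n)"
    and "mpoly_const c \<in> carrier (mpoly_ring n)"
    and "\<lbrakk>f \<in> carrier (mpoly_ring n); g \<in> carrier (mpoly_ring n)\<rbrakk> \<Longrightarrow> f + g \<in> carrier (mpoly_ring n)"
    and "\<lbrakk>f \<in> carrier (mpoly_ring n); g \<in> carrier (mpoly_ring n)\<rbrakk> \<Longrightarrow> f * g \<in> carrier (mpoly_ring n)"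
    and "f \<in> carrier (mpoly_ring n) \<Longrightarrow> f ^ q \<in> carrier (mpoly_ring n)"
    and "keys m \<subseteq> {..<n} \<Longrightarrow> single m c \<in> carrier (mpoly_ring n)"
proof -
  show one: "1 \<in> carrier (mpoly_ring n)"
    by (simp add: mem_mpoly_ring)
  show "f + g \<in> carrier (mpoly_ring n)"
    if "f \<in> carrier (mpoly_ring n)" "g \<in> carrier (mpoly_ring n)" for f g :: "'k mpoly"
    using that keys_add[of f g] unfolding mem_mpoly_ring by blast
  show mult: "f * g \<in> carrier (mpoly_ring n)"
    if "f \<in> carrier (mpoly_ring n)" "g \<in> carrier (mpoly_ring n)" for f g :: "'k mpoly"
    using that keys_mult[of f g] unfolding mem_mpoly_ring
    by (force simp: keys_monomial_add)
  show "f ^ q \<in> carrier (mpoly_ring n)" if "f \<in> carrier (mpoly_ring n)"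
    by (induction q) (use one mult that in auto)
qed (auto simp: mem_mpoly_ring mpoly_const_def)

lemma mpoly_ring_uminus [simp, intro]:
  "f \<in> carrier (mpoly_ring n) \<Longrightarrow> - f \<in> carrier (mpoly_ring n)"
  by (simp add: mem_mpoly_ring)

lemma cring_mpoly_ring: "cring (mpoly_ring n :: 'k::field mpoly ring)"
proof (rule cringI)
  show "abelian_group (mpoly_ring n :: 'k mpoly ring)"
    by (rule abelian_groupI) (auto simp: add_ac intro: exI[of _ "- _"] bexI[of _ "- _"])
  show "Group.comm_monoid (mpoly_ring n :: 'k mpoly ring)"
    by (rule comm_monoidI) (auto simp: mult_ac)
qed (auto simp: algebra_simps)

lemma mpoly_ring_pow [simp]: "r [^]\<^bsub>mpoly_ring n\<^esub> (q::nat) = r ^ q"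
  by (induction q) (auto simp: nat_pow_def mult.commute)

text \<open>The convolution collapses to the one monomial \<open>k\<close>, and cancellation of
  monomials picks out one coefficient of \<open>r\<close>.\<close>

lemma lookup_single_mult_add [simp]:
  fixes k m :: monomial and r :: "'k::field mpoly"
  shows "lookup (single k c * r) (k + m) = c * lookup r m"
proof -
  have "lookup (single k c * r) (k + m) =
      (\<Sum>l. (c * (\<Sum>q. lookup r q when k + m = l + q)) when k = l)"
    unfolding lookup_mult by (simp add: lookup_single when_mult)
  also have "\<dots> = c * lookup r m"
    by (simp only: Sum_any_when_equal' add_left_cancel)
  finally show ?thesis .
qed

lemma lookup_single_mult_eq_0:
  fixes k m :: monomial and r :: "'k::field mpoly"
  assumes "\<And>m'. m \<noteq> k + m'"
  shows "lookup (single k c * r) m = 0"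
proof -
  have "lookup (single k c * r) m =
      (\<Sum>l. (c * (\<Sum>q. lookup r q when m = l + q)) when k = l)"
    unfolding lookup_mult by (simp add: lookup_single when_mult)
  also have "\<dots> = 0"
    by (simp only: Sum_any_when_equal') (simp add: assms)
  finally show ?thesis .
qed

lemma monomial_dvd_iff: "(\<exists>m'. m = k + m') \<longleftrightarrow> (\<forall>i. lookup (k::monomial) i \<le> lookup m i)"
proof
  assume le: "\<forall>i. lookup k i \<le> lookup m i"
  have "m = k + (m - k)"
    by (rule poly_mapping_eqI) (use le in \<open>simp add: lookup_add lookup_minus\<close>)
  thus "\<exists>m'. m = k + m'" ..
qed (auto simp: lookup_add)

text \<open>A polynomial is the sum of its terms. Membership in the ring is carried through the
  induction because the \<open>add\<close> case may assume it of both summands.\<close>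

lemma mpoly_induct [consumes 1, case_names zero single add]:
  assumes r: "r \<in> carrier (mpoly_ring n)"
    and "P 0"
    and single: "\<And>k c. keys k \<subseteq> {..<n} \<Longrightarrow> P (single k c)"
    and add: "\<And>f g. \<lbrakk>f \<in> carrier (mpoly_ring n); g \<in> carrier (mpoly_ring n); P f; P g\<rbrakk> \<Longrightarrow> P (f + g)"
  shows "P r"
proof -
  have "P (\<Sum>k\<in>A. single k (lookup r k)) \<and> (\<Sum>k\<in>A. single k (lookup r k)) \<in> carrier (mpoly_ring n)"
    if "finite A" "A \<subseteq> keys r" for A
    using that
  proof (induction A)
    case (insert k A)
    then have "keys k \<subseteq> {..<n}"
      using r by (auto simp: mem_mpoly_ring)
    with insert show ?case
      by (auto intro!: add single)
  qed (use \<open>P 0\<close> in auto)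
  from this[of "keys r"] have "P (\<Sum>k\<in>keys r. single k (lookup r k))"
    by simp
  moreover have "(\<Sum>k\<in>keys r. single k (lookup r k)) = r"
    by (rule poly_mapping_eqI)
      (auto simp: lookup_sum lookup_single when_def in_keys_iff)
  ultimately show ?thesis by simp
qed

section \<open>Degrees of monomials\<close>

lemma monom_degree_eq_sum:
  "keys m \<subseteq> A \<Longrightarrow> finite A \<Longrightarrow> monom_degree m = (\<Sum>i\<in>A. lookup m i)"
  unfolding monom_degree_def by (rule sum.mono_neutral_left) (auto simp: in_keys_iff)

lemma monom_degree_add: "monom_degree (a + b) = monom_degree a + monom_degree b"
proof -
  have "monom_degree m = (\<Sum>i\<in>keys a \<union> keys b. lookup m i)" if "m = a \<or> m = b \<or> m = a + b" for m
    by (rule monom_degree_eq_sum) (use that in \<open>auto simp: keys_monomial_add\<close>)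
  thus ?thesis by (simp add: lookup_add sum.distrib)
qed

lemma monom_degree_single [simp]: "monom_degree (single i q) = q"
  by (cases "q = 0") (auto simp: monom_degree_def)

lemma monom_degree_0 [simp]: "monom_degree 0 = 0"
  by (simp add: monom_degree_def)

lemma single_mem_mpoly_grading:
  "keys m \<subseteq> {..<n} \<Longrightarrow> single m c \<in> mpoly_grading n (int (monom_degree m))"
  by (auto simp: mpoly_grading_def mem_mpoly_ring split: if_splits)

lemma mpoly_grading_subset: "mpoly_grading n d \<subseteq> carrier (mpoly_ring n)"
  by (auto simp: mpoly_grading_def)

section \<open>Powers of terms\<close>

definition monom_scale :: "nat \<Rightarrow> monomial \<Rightarrow> monomial" where
  "monom_scale q m = Poly_Mapping.map ((*) q) m"

lemma lookup_monom_scale [simp]: "lookup (monom_scale q m) i = q * lookup m i"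
  unfolding monom_scale_def by transfer (auto simp: when_def)

lemma keys_monom_scale: "q > 0 \<Longrightarrow> keys (monom_scale q m) = keys m"
  by (auto simp: in_keys_iff)

lemma monom_scale_add: "monom_scale q (a + b) = monom_scale q a + monom_scale q b"
  by (rule poly_mapping_eqI) (simp add: lookup_add algebra_simps)

lemma monom_degree_scale: "monom_degree (monom_scale q m) = q * monom_degree m"
proof -
  have "monom_degree (monom_scale q m) = (\<Sum>i\<in>keys m. q * lookup m i)"
    by (subst monom_degree_eq_sum[of _ "keys m"]) (auto simp: in_keys_iff)
  thus ?thesis by (simp add: monom_degree_def sum_distrib_left)
qed

lemma single_power: "single (m::monomial) (c::'k::field) ^ q = single (monom_scale q m) (c ^ q)"
proof (induction q)
  case 0
  have "monom_scale 0 m = 0" by (rule poly_mapping_eqI) simp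
  then show ?case by simp
next
  case (Suc q)
  have "monom_scale (Suc q) m = m + monom_scale q m"
    by (rule poly_mapping_eqI) (simp add: lookup_add)
  with Suc show ?case by (simp add: mult_single)
qed

section \<open>The Frobenius on polynomials\<close>

lemma CHAR_mpoly: "CHAR('k::field mpoly) = CHAR('k::field)"
proof (rule CHAR_eqI)
  have of_nat: "of_nat x = (single 0 (of_nat x) :: 'k mpoly)" for x
    by (simp only: single_of_nat)
  show "of_nat CHAR('k) = (0 :: 'k mpoly)"
    unfolding of_nat by (simp del: single_of_nat)
  show "CHAR('k) dvd x" if "of_nat x = (0 :: 'k mpoly)" for x
  proof -
    from that have "lookup (single 0 (of_nat x) :: 'k mpoly) 0 = 0"
      unfolding of_nat by simp
    then show ?thesis
      by (simp add: of_nat_eq_0_iff_char_dvd del: single_of_nat)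
  qed
qed

lemma mpoly_freshmans_dream:
  fixes f g :: "'k::field mpoly"
  assumes "CHAR('k) = p" "p > 0"
  shows "(f + g) ^ p = f ^ p + g ^ p"
  by (rule freshmans_dream) (use assms in \<open>auto simp: CHAR_mpoly prime_CHAR_semidom\<close>)

text \<open>The field is viewed as a vector space over itself with the twisted action c . v = c^p v,
  so a basis over the subfield of p-th powers comes from the ordinary basis theorem without forming
  that subfield. Coordinates then have the p-th root already taken. The index \<open>b\<close> may
  range over all of \<open>k\<close>, since a coordinate outside the basis is zero.\<close>

lemma frobenius_basis_exists:
  assumes "CHAR('k::field) = p" "p > 0"
  obtains h :: "'k::field \<Rightarrow> 'k \<Rightarrow> 'k"
  where "\<And>b c d. h b (c + d) = h b c + h b d"
    and "\<And>b c d. h b (d ^ p * c) = d * h b c"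
    and "\<And>c. finite {b. h b c \<noteq> 0}"
    and "\<And>c. c = (\<Sum>b | h b c \<noteq> 0. h b c ^ p * b)"
proof -
  have dream: "(x + y) ^ p = x ^ p + y ^ p" for x y :: 'k
    by (rule freshmans_dream) (use assms in \<open>auto simp: prime_CHAR_semidom\<close>)
  interpret V: vector_space "\<lambda>(c::'k) v. c ^ p * v"
    by unfold_locales (use assms in \<open>auto simp: algebra_simps dream power_mult_distrib\<close>)
  obtain B where B: "V.independent B" "V.span B = UNIV"
    using V.basis_exists[of UNIV] by (metis top.extremum_uniqueI)
  show thesis
  proof (rule that)
    show "V.representation B (c + d) b = V.representation B c b + V.representation B d b" for b c d
      using V.representation_add[OF B(1)] B(2) by simp
    show "V.representation B (d ^ p * c) b = d * V.representation B c b" for b c d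
      using V.representation_scale[OF B(1)] B(2) by simp
    show "finite {b. V.representation B c b \<noteq> 0}" for c
      by (rule V.finite_representation)
    show "c = (\<Sum>b | V.representation B c b \<noteq> 0. V.representation B c b ^ p * b)" for c
      using V.sum_nonzero_representation_eq[OF B(1)] B(2) by simp
  qed
qed

text \<open>The coefficient of \<open>x\<^sup>a\<close> with respect to the basis of monomials \<open>x\<^sup>a\<close>, \<open>a\<^sub>i < p\<close>, after applying a
  coordinate functional \<open>h\<close> of \<open>k\<close> over its \<open>p\<close>-th powers to all coefficients.\<close>

definition frob_coeff :: "nat \<Rightarrow> ('k \<Rightarrow> 'k) \<Rightarrow> monomial \<Rightarrow> 'k::field mpoly \<Rightarrow> 'k mpoly" where
  "frob_coeff p h a r = Abs_poly_mapping (\<lambda>m. h (lookup r (monom_scale p m + a)))"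

text \<open>The p^(-1)-linear functionals on \<open>k\<close>. Applied to coefficients they give the
  operators \<open>frob_coeff\<close>, which for exponents of \<open>a\<close> below
  \<open>p\<close> are p^(-1)-linear over the polynomial ring.\<close>

locale frob_functional =
  fixes p :: nat and h :: "'k::field \<Rightarrow> 'k"
  assumes char: "CHAR('k) = p" and p_pos: "p > 0"
    and h_add: "\<And>c d. h (c + d) = h c + h d"
    and h_scale: "\<And>c d. h (d ^ p * c) = d * h c"
begin

lemma h_0 [simp]: "h 0 = 0"
proof -
  have "h 0 + h 0 = h 0 + 0"
    using h_add[of 0 0] by simp
  then show ?thesis
    by (rule add_left_imp_eq)
qed

lemma inj_monom_scale: "inj (\<lambda>m. monom_scale p m + a)"
proof (rule injI)
  fix m m' assume "monom_scale p m + a = monom_scale p m' + a"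
  then have "monom_scale p m = monom_scale p m'" by simp
  then have "p * lookup m i = p * lookup m' i" for i
    by (metis lookup_monom_scale)
  then show "m = m'" using p_pos by (intro poly_mapping_eqI) simp
qed

text \<open>\<open>Abs_poly_mapping\<close> is meaningful only for finite support. The map from m to
  p m + a is injective, so the preimage of the support of \<open>r\<close> is finite.\<close>

lemma lookup_frob_coeff: "lookup (frob_coeff p h a r) m = h (lookup r (monom_scale p m + a))"
proof -
  have "finite ((\<lambda>m. monom_scale p m + a) -` keys r)"
    by (intro finite_vimageI inj_monom_scale) auto
  moreover have "{m. h (lookup r (monom_scale p m + a)) \<noteq> 0} \<subseteq> (\<lambda>m. monom_scale p m + a) -` keys r"
    by (auto simp: in_keys_iff)
  ultimately have "finite {m. h (lookup r (monom_scale p m + a)) \<noteq> 0}"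
    by (rule rev_finite_subset)
  then show ?thesis
    unfolding frob_coeff_def by simp
qed

lemma frob_coeff_closed:
  assumes "r \<in> carrier (mpoly_ring n)"
  shows "frob_coeff p h a r \<in> carrier (mpoly_ring n)"
  unfolding mem_mpoly_ring
proof
  fix m assume "m \<in> keys (frob_coeff p h a r)"
  then have "monom_scale p m + a \<in> keys r"
    by (auto simp: in_keys_iff lookup_frob_coeff)
  with assms have "keys (monom_scale p m + a) \<subseteq> {..<n}"
    unfolding mem_mpoly_ring by blast
  then show "keys m \<subseteq> {..<n}"
    using p_pos by (simp add: keys_monomial_add keys_monom_scale)
qed

lemma frob_coeff_add: "frob_coeff p h a (r + s) = frob_coeff p h a r + frob_coeff p h a s"
  by (rule poly_mapping_eqI) (simp add: lookup_frob_coeff lookup_add h_add)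

lemma frob_coeff_0: "frob_coeff p h a 0 = 0"
  by (rule poly_mapping_eqI) (simp add: lookup_frob_coeff)

text \<open>This p^(-1)-linearity is what makes sending r tensor x to (coefficient of r) x well
  defined. Taking p-th powers is additive, so a single term \<open>f\<close> suffices.\<close>

lemma frob_coeff_mult_power:
  assumes a: "\<And>i. lookup a i < p" and f: "f \<in> carrier (mpoly_ring n)"
  shows "frob_coeff p h a (r * f ^ p) = frob_coeff p h a r * f"
  using f
proof (induction rule: mpoly_induct)
  case zero
  then show ?case using p_pos by (simp add: frob_coeff_0 power_0_left)
next
  case (single l d)
  show ?case
  proof (rule poly_mapping_eqI)
    fix m
    show "lookup (frob_coeff p h a (r * single l d ^ p)) m = lookup (frob_coeff p h a r * single l d) m"
    proof (cases "\<exists>m'. m = l + m'")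
      case True
      then obtain m' where m: "m = l + m'" by blast
      have "lookup (single (monom_scale p l) (d ^ p) * r) (monom_scale p l + (monom_scale p m' + a))
          = d ^ p * lookup r (monom_scale p m' + a)"
        by (rule lookup_single_mult_add)
      then show ?thesis
        by (simp add: m lookup_frob_coeff single_power mult.commute[of r] h_scale monom_scale_add
            add.assoc mult.commute[of _ "single l d"])
    next
      case False
      then obtain i where i: "lookup m i < lookup l i"
        unfolding monomial_dvd_iff by (auto simp: not_le)
      \<comment> \<open>As a_i < p, the exponent p m_i + a_i stays below p (m_i + 1) <= p l_i, so
        the p-th power of x^l does not divide x^(p m + a).\<close>
      have "p * lookup m i + lookup a i < p * lookup m i + p"
        using a by simp
      also have "\<dots> \<le> p * lookup l i"
        using i mult_le_mono2[of "Suc (lookup m i)" "lookup l i" p] by simp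
      finally have "\<not> (\<exists>m'. monom_scale p m + a = monom_scale p l + m')"
        unfolding monomial_dvd_iff by (auto simp: lookup_add not_le intro!: exI[of _ i])
      then have "lookup (single (monom_scale p l) (d ^ p) * r) (monom_scale p m + a) = 0"
        by (intro lookup_single_mult_eq_0) blast
      moreover have "lookup (single l d * frob_coeff p h a r) m = 0"
        using False by (intro lookup_single_mult_eq_0) blast
      ultimately show ?thesis
        by (simp add: lookup_frob_coeff single_power mult.commute[of r] mult.commute[of _ "single l d"])
    qed
  qed
next
  case (add f g)
  then show ?case
    by (simp add: mpoly_freshmans_dream[OF char p_pos] distrib_left frob_coeff_add)
qed

lemma frob_coeff_var_mult:
  "frob_coeff p h (a + single i 1) (mpoly_var i * r) = frob_coeff p h a r"
proof (rule poly_mapping_eqI)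
  fix m
  have "lookup (mpoly_var i * r) (single i 1 + (monom_scale p m + a)) = lookup r (monom_scale p m + a)"
    unfolding mpoly_var_def by (subst lookup_single_mult_add) simp
  then show "lookup (frob_coeff p h (a + single i 1) (mpoly_var i * r)) m = lookup (frob_coeff p h a r) m"
    by (simp add: lookup_frob_coeff add_ac)
qed

text \<open>The carry: residue 0 is reached from residue p - 1, and the completed factor x_i^p comes
  out as one factor x_i.\<close>

lemma frob_coeff_var_mult_top:
  assumes a: "lookup a i = 0"
  shows "frob_coeff p h a (mpoly_var i * r) = mpoly_var i * frob_coeff p h (a + single i (p - 1)) r"
proof (rule poly_mapping_eqI)
  fix m
  show "lookup (frob_coeff p h a (mpoly_var i * r)) m
    = lookup (mpoly_var i * frob_coeff p h (a + single i (p - 1)) r) m"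
  proof (cases "\<exists>m'. m = single i 1 + m'")
    case True
    then obtain m' where m: "m = single i 1 + m'" by blast
    \<comment> \<open>Of the p factors x_i gained by scaling, one is the variable itself and the
      other p - 1 move into the residue.\<close>
    have "monom_scale p m + a = single i 1 + (monom_scale p m' + (a + single i (p - 1)))"
      unfolding m using p_pos
      by (intro poly_mapping_eqI) (auto simp: lookup_add lookup_single when_def)
    then show ?thesis
      by (simp add: lookup_frob_coeff m mpoly_var_def)
  next
    case False
    then obtain j where "lookup m j < lookup (single i 1) j"
      unfolding monomial_dvd_iff by (auto simp: not_le)
    then have "lookup m i = 0"
      by (auto simp: lookup_single when_def split: if_splits)
    with a have "\<not> (\<exists>m'. monom_scale p m + a = single i 1 + m')"
      unfolding monomial_dvd_iff by (auto simp: lookup_add not_le intro!: exI[of _ i])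
    then have "lookup (mpoly_var i * r) (monom_scale p m + a) = 0"
      unfolding mpoly_var_def by (intro lookup_single_mult_eq_0) blast
    moreover have "lookup (mpoly_var i * frob_coeff p h (a + single i (p - 1)) r) m = 0"
      using False unfolding mpoly_var_def by (intro lookup_single_mult_eq_0) blast
    ultimately show ?thesis
      by (simp add: lookup_frob_coeff)
  qed
qed

lemma frob_coeff_grading:
  assumes r: "r \<in> mpoly_grading n (int (monom_degree a) + int p * d)"
  shows "frob_coeff p h a r \<in> mpoly_grading n d"
proof -
  have "int (monom_degree m) = d" if "m \<in> keys (frob_coeff p h a r)" for m
  proof -
    from that have "monom_scale p m + a \<in> keys r"
      by (auto simp: in_keys_iff lookup_frob_coeff)
    with r have "int (monom_degree (monom_scale p m + a)) = int (monom_degree a) + int p * d"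
      unfolding mpoly_grading_def by blast
    then show ?thesis using p_pos by (simp add: monom_degree_add monom_degree_scale)
  qed
  with frob_coeff_closed r show ?thesis
    by (auto simp: mpoly_grading_def)
qed

lemma frob_coeff_grading_eq_0:
  assumes r: "r \<in> mpoly_grading n i" and i: "\<And>d. i \<noteq> int (monom_degree a) + int p * d"
  shows "frob_coeff p h a r = 0"
proof -
  have "m \<notin> keys (frob_coeff p h a r)" for m
  proof
    assume "m \<in> keys (frob_coeff p h a r)"
    then have "monom_scale p m + a \<in> keys r"
      by (auto simp: in_keys_iff lookup_frob_coeff)
    with r have "int (monom_degree (monom_scale p m + a)) = i"
      unfolding mpoly_grading_def by blast
    with i[of "int (monom_degree m)"] show False
      by (simp add: monom_degree_add monom_degree_scale)
  qed
  then show ?thesis by (auto intro: poly_mapping_eqI simp: in_keys_iff)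
qed

text \<open>Division of each exponent by \<open>p\<close> with remainder recovers \<open>k\<close>
  and \<open>a'\<close> from p k + a'.\<close>

lemma frob_coeff_single:
  assumes "\<And>i. lookup a i < p" "\<And>i. lookup a' i < p"
  shows "frob_coeff p h a (single (monom_scale p k + a') c) = (if a = a' then single k (h c) else 0)"
proof (rule poly_mapping_eqI)
  fix m
  have "m = k \<and> a = a'" if eq: "monom_scale p m + a = monom_scale p k + a'"
  proof -
    have *: "p * lookup m i + lookup a i = p * lookup k i + lookup a' i" for i
      using eq by (metis lookup_add lookup_monom_scale)
    have "lookup m i = lookup k i \<and> lookup a i = lookup a' i" for i
    proof -
      have "(p * lookup m i + lookup a i) div p = lookup m i" "(p * lookup k i + lookup a' i) div p = lookup k i"
        using assms p_pos by simp_all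
      with * show ?thesis by (metis add_left_cancel)
    qed
    then show ?thesis by (simp add: poly_mapping_eqI)
  qed
  then show "lookup (frob_coeff p h a (single (monom_scale p k + a') c)) m =
      lookup (if a = a' then single k (h c) else 0) m"
    by (auto simp: lookup_frob_coeff lookup_single when_def)
qed

end

section \<open>Expansion in reduced monomials\<close>

definition reduced_monomials :: "nat \<Rightarrow> nat \<Rightarrow> monomial set" where
  "reduced_monomials n p = {a. keys a \<subseteq> {..<n} \<and> (\<forall>i. lookup a i < p)}"

lemma monomial_div_mod:
  assumes "p > 0" "keys k \<subseteq> {..<n}"
  obtains l a where "k = monom_scale p l + a" "a \<in> reduced_monomials n p" "keys l \<subseteq> {..<n}"
proof
  define l a where "l = Poly_Mapping.map (\<lambda>x. x div p) k" and "a = Poly_Mapping.map (\<lambda>x. x mod p) k"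
  have l: "lookup l i = lookup k i div p" and a: "lookup a i = lookup k i mod p" for i
    unfolding l_def a_def by (transfer; auto simp: when_def)+
  show "k = monom_scale p l + a"
    by (rule poly_mapping_eqI) (simp add: lookup_add l a)
  have "keys l \<subseteq> keys k" "keys a \<subseteq> keys k"
    unfolding subset_iff in_keys_iff l a by (metis div_0, metis mod_0)
  then show "keys l \<subseteq> {..<n}" "a \<in> reduced_monomials n p"
    using assms by (auto simp: a reduced_monomials_def)
qed

text \<open>The elements b x^a generate the ring over its p-th powers. \<open>U\<close> is some
  finite set outside of which the coefficients vanish, not their exact support, so that two
  expansions can be put over a union when polynomials are added.\<close>

lemma frob_coeff_expansion:
  fixes h :: "'k::field \<Rightarrow> 'k \<Rightarrow> 'k"
  assumes "\<And>b. frob_functional p (h b)"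
    and fin: "\<And>c. finite {b. h b c \<noteq> 0}"
    and sum: "\<And>c. c = (\<Sum>b | h b c \<noteq> 0. h b c ^ p * b)"
    and r: "r \<in> carrier (mpoly_ring n)"
  shows "\<exists>U. finite U \<and> U \<subseteq> UNIV \<times> reduced_monomials n p
    \<and> (\<forall>b. \<forall>a\<in>reduced_monomials n p. (b, a) \<notin> U \<longrightarrow> frob_coeff p (h b) a r = 0)
    \<and> r = (\<Sum>(b, a)\<in>U. single a b * frob_coeff p (h b) a r ^ p)"
  using r
proof (induction rule: mpoly_induct)
  interpret frob_functional p "h b" for b by fact
  case zero
  show ?case by (auto simp: frob_coeff_0 intro!: exI[of _ "{}"])
next
  interpret frob_functional p "h b" for b by fact
  case (single k c)
  \<comment> \<open>A single term involves one residue of exponents modulo p, so its expansion is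
    that of the scalar \<open>c\<close>.\<close>
  obtain l a where k: "k = monom_scale p l + a" and a: "a \<in> reduced_monomials n p"
    using monomial_div_mod[OF p_pos single] by metis
  define U where "U = (\<lambda>b. (b, a)) ` {b. h b c \<noteq> 0}"
  have eq: "frob_coeff p (h b) a' (single k c) = (if a' = a then single l (h b c) else 0)"
    if "a' \<in> reduced_monomials n p" for a' b
    unfolding k using that a by (intro frob_coeff_single) (auto simp: reduced_monomials_def)
  have "(\<Sum>(b, a)\<in>U. single a b * frob_coeff p (h b) a (single k c) ^ p) =
      (\<Sum>b | h b c \<noteq> 0. single a b * single l (h b c) ^ p)"
    unfolding U_def by (subst sum.reindex) (auto simp: inj_on_def eq a)
  also have "\<dots> = (\<Sum>b | h b c \<noteq> 0. single k (h b c ^ p * b))"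
    by (simp add: single_power mult_single k add_ac mult_ac)
  also have "\<dots> = single k (\<Sum>b | h b c \<noteq> 0. h b c ^ p * b)"
    by (rule poly_mapping_eqI) (auto simp: lookup_sum lookup_single when_def)
  also have "\<dots> = single k c"
    by (simp flip: sum)
  finally show ?case
    using fin[of c] a eq by (intro exI[of _ U]) (auto simp: U_def)
next
  interpret frob_functional p "h b" for b by fact
  case (add f g)
  from add.IH obtain U W where
    U: "finite U" "U \<subseteq> UNIV \<times> reduced_monomials n p"
      "\<forall>b. \<forall>a\<in>reduced_monomials n p. (b, a) \<notin> U \<longrightarrow> frob_coeff p (h b) a f = 0"
      "f = (\<Sum>(b, a)\<in>U. single a b * frob_coeff p (h b) a f ^ p)" and
    W: "finite W" "W \<subseteq> UNIV \<times> reduced_monomials n p"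
      "\<forall>b. \<forall>a\<in>reduced_monomials n p. (b, a) \<notin> W \<longrightarrow> frob_coeff p (h b) a g = 0"
      "g = (\<Sum>(b, a)\<in>W. single a b * frob_coeff p (h b) a g ^ p)"
    by (elim exE conjE) (rule that)
  \<comment> \<open>The additional indices have coefficient 0, and 0^p = 0 because p > 0.\<close>
  have "f = (\<Sum>(b, a)\<in>U \<union> W. single a b * frob_coeff p (h b) a f ^ p)"
    by (rule trans[OF U(4)], rule sum.mono_neutral_left)
      (use U(1-3) W(1-3) p_pos in \<open>auto simp: power_0_left\<close>)
  moreover have "g = (\<Sum>(b, a)\<in>U \<union> W. single a b * frob_coeff p (h b) a g ^ p)"
    by (rule trans[OF W(4)], rule sum.mono_neutral_left)
      (use U(1-3) W(1-3) p_pos in \<open>auto simp: power_0_left\<close>)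
  ultimately have "f + g = (\<Sum>(b, a)\<in>U \<union> W. single a b * frob_coeff p (h b) a f ^ p)
      + (\<Sum>(b, a)\<in>U \<union> W. single a b * frob_coeff p (h b) a g ^ p)"
    by (rule arg_cong2)
  also have "\<dots> = (\<Sum>(b, a)\<in>U \<union> W. single a b * frob_coeff p (h b) a (f + g) ^ p)"
    by (simp add: frob_coeff_add mpoly_freshmans_dream[OF char p_pos] distrib_left
        sum.distrib case_prod_unfold)
  finally have sum_eq: "f + g = (\<Sum>(b, a)\<in>U \<union> W. single a b * frob_coeff p (h b) a (f + g) ^ p)" .
  show ?case
  proof (intro exI[of _ "U \<union> W"] conjI)
    show "f + g = (\<Sum>(b, a)\<in>U \<union> W. single a b * frob_coeff p (h b) a (f + g) ^ p)"
      by (fact sum_eq)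
  qed (use U(1-3) W(1-3) in \<open>auto simp: frob_coeff_add\<close>)
qed

section \<open>Base change\<close>

locale base_change_module = module R M + S: cring S
  for R :: "('a, 'b) ring_scheme" (structure) and M :: "('a, 'm, 'c) module_scheme" (structure)
    and S :: "('s, 'd) ring_scheme" +
  fixes \<phi> :: "'a \<Rightarrow> 's"
  assumes \<phi>_closed: "a \<in> carrier R \<Longrightarrow> \<phi> a \<in> carrier S"
begin

abbreviation "T \<equiv> tensor_free S M"
abbreviation "N \<equiv> tensor_relations R S \<phi> M"
abbreviation "TM \<equiv> base_change R S \<phi> M"
abbreviation "tn \<equiv> tensor R S \<phi> M"

text \<open>The generators of \<open>N\<close> under one name, for induction over the generated
  subgroup.\<close>

definition rels :: "('s \<times> 'm \<Rightarrow>\<^sub>0 int) set" where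
  "rels = {frag_of (s \<oplus>\<^bsub>S\<^esub> t, x) - frag_of (s, x) - frag_of (t, x) | s t x.
        s \<in> carrier S \<and> t \<in> carrier S \<and> x \<in> carrier M} \<union>
     {frag_of (s, x \<oplus>\<^bsub>M\<^esub> y) - frag_of (s, x) - frag_of (s, y) | s x y.
        s \<in> carrier S \<and> x \<in> carrier M \<and> y \<in> carrier M} \<union>
     {frag_of (s \<otimes>\<^bsub>S\<^esub> \<phi> a, x) - frag_of (s, a \<odot>\<^bsub>M\<^esub> x) | s a x.
        s \<in> carrier S \<and> a \<in> carrier R \<and> x \<in> carrier M}"

lemma N_eq: "N = generate T rels"
  by (simp add: tensor_relations_def rels_def)

lemma comm_group_T: "comm_group T"
  by (simp add: tensor_free_def abelian_free_Abelian_group)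

sublocale T: comm_group T by (rule comm_group_T)

lemma T_simps [simp]:
  "x \<otimes>\<^bsub>T\<^esub> y = x + y" "\<one>\<^bsub>T\<^esub> = 0"
  "x \<in> carrier T \<longleftrightarrow> Poly_Mapping.keys x \<subseteq> carrier S \<times> carrier M"
  by (simp_all add: tensor_free_def)

lemma T_inv [simp]: "Poly_Mapping.keys x \<subseteq> carrier S \<times> carrier M \<Longrightarrow> inv\<^bsub>T\<^esub> x = - x"
  by (simp add: tensor_free_def)

lemma frag_of_T: "s \<in> carrier S \<Longrightarrow> x \<in> carrier M \<Longrightarrow> frag_of (s, x) \<in> carrier T"
  by (simp add: tensor_free_def)

lemma T_diff: "x \<in> carrier T \<Longrightarrow> y \<in> carrier T \<Longrightarrow> x - y \<in> carrier T"
  using keys_diff[of x y] by auto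

lemma T_add: "x \<in> carrier T \<Longrightarrow> y \<in> carrier T \<Longrightarrow> x + y \<in> carrier T"
  using T.m_closed[of x y] by simp

lemma rels_subset: "rels \<subseteq> carrier T"
  unfolding rels_def
  by (auto intro!: T_diff frag_of_T \<phi>_closed simp del: T_simps(3))

lemma N_subgroup: "subgroup N T"
  unfolding N_eq by (rule T.generate_is_subgroup[OF rels_subset])

lemma N_normal: "N \<lhd> T"
  by (rule T.subgroup_imp_normal[OF N_subgroup])

lemma comm_group_quot: "comm_group (T Mod N)"
  by (rule T.abelian_FactGroup[OF N_subgroup])

lemma coset_eq_iff:
  assumes "x \<in> carrier T" "y \<in> carrier T"
  shows "N #>\<^bsub>T\<^esub> x = N #>\<^bsub>T\<^esub> y \<longleftrightarrow> x - y \<in> N"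
proof -
  have "x - y = x \<otimes>\<^bsub>T\<^esub> inv\<^bsub>T\<^esub> y"
    using assms by simp
  then have mem: "x \<in> N #>\<^bsub>T\<^esub> y \<longleftrightarrow> x - y \<in> N"
    using subgroup.rcos_module[OF N_subgroup T.is_group assms(2,1)] by (simp only:)
  show ?thesis
  proof
    assume "N #>\<^bsub>T\<^esub> x = N #>\<^bsub>T\<^esub> y"
    with T.rcos_self[OF assms(1) N_subgroup] mem show "x - y \<in> N" by simp
  next
    assume "x - y \<in> N"
    with mem T.repr_independence[OF _ assms(2) N_subgroup] show "N #>\<^bsub>T\<^esub> x = N #>\<^bsub>T\<^esub> y"
      by simp
  qed
qed

lemma TM_simps:
  "carrier TM = carrier (T Mod N)" "add TM = monoid.mult (T Mod N)" "ring.zero TM = \<one>\<^bsub>T Mod N\<^esub>"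
  by (simp_all add: base_change_def)

text \<open>\<open>add_monoid TM\<close> and \<open>T Mod N\<close> agree in carrier, operation and
  unit but are different records, so the group axioms are carried over.\<close>

lemma comm_group_TM: "comm_group (add_monoid TM)"
proof -
  interpret Q: comm_group "T Mod N" by (rule comm_group_quot)
  show ?thesis
    by (rule comm_groupI) (auto simp: TM_simps Q.m_assoc Q.m_comm Q.m_lcomm intro: Q.l_inv_ex
        simp del: mult_FactGroup one_FactGroup)
qed

lemma tensor_closed: "s \<in> carrier S \<Longrightarrow> x \<in> carrier M \<Longrightarrow> tn s x \<in> carrier TM"
  unfolding TM_simps tensor_def FactGroup_def
  by (auto simp: RCOSETS_def intro!: bexI[of _ "frag_of (s, x)"] frag_of_T simp del: T_simps(3))

lemma coset_add:
  "\<lbrakk>x \<in> carrier T; y \<in> carrier T\<rbrakk> \<Longrightarrow> (N #>\<^bsub>T\<^esub> x) \<oplus>\<^bsub>TM\<^esub> (N #>\<^bsub>T\<^esub> y) = N #>\<^bsub>T\<^esub> (x + y)"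
  using normal.rcos_sum[OF N_normal, of x y] by (simp add: TM_simps del: T_simps(3))

lemma rels_N: "x \<in> rels \<Longrightarrow> x \<in> N"
  unfolding N_eq by (rule generate.incl)

lemma tensor_add_left:
  assumes "s \<in> carrier S" "t \<in> carrier S" "x \<in> carrier M"
  shows "tn (s \<oplus>\<^bsub>S\<^esub> t) x = tn s x \<oplus>\<^bsub>TM\<^esub> tn t x"
proof -
  have "frag_of (s \<oplus>\<^bsub>S\<^esub> t, x) - (frag_of (s, x) + frag_of (t, x)) \<in> N"
    using assms by (intro rels_N) (auto simp: rels_def diff_diff_eq)
  then show ?thesis
    using assms unfolding tensor_def
    by (simp add: coset_add coset_eq_iff frag_of_T T_add del: T_simps(3))
qed

lemma tensor_add_right:
  assumes "s \<in> carrier S" "x \<in> carrier M" "y \<in> carrier M"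
  shows "tn s (x \<oplus>\<^bsub>M\<^esub> y) = tn s x \<oplus>\<^bsub>TM\<^esub> tn s y"
proof -
  have "frag_of (s, x \<oplus>\<^bsub>M\<^esub> y) - (frag_of (s, x) + frag_of (s, y)) \<in> N"
    using assms by (intro rels_N) (auto simp: rels_def diff_diff_eq)
  then show ?thesis
    using assms unfolding tensor_def
    by (simp add: coset_add coset_eq_iff frag_of_T T_add del: T_simps(3))
qed

lemma tensor_balanced:
  assumes "s \<in> carrier S" "a \<in> carrier R" "x \<in> carrier M"
  shows "tn (s \<otimes>\<^bsub>S\<^esub> \<phi> a) x = tn s (a \<odot>\<^bsub>M\<^esub> x)"
proof -
  have "frag_of (s \<otimes>\<^bsub>S\<^esub> \<phi> a, x) - frag_of (s, a \<odot>\<^bsub>M\<^esub> x) \<in> N"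
    using assms by (intro rels_N) (auto simp: rels_def)
  then show ?thesis
    using assms unfolding tensor_def
    by (simp add: coset_eq_iff frag_of_T \<phi>_closed del: T_simps(3))
qed

text \<open>The additive extension of \<open>g\<close> to the free group sends every generator of
  \<open>N\<close> to the unit, so it factors through the quotient.\<close>

lemma tensor_universal:
  fixes H :: "('h, 'e) monoid_scheme"
  assumes H: "comm_group H"
    and g: "\<And>s x. \<lbrakk>s \<in> carrier S; x \<in> carrier M\<rbrakk> \<Longrightarrow> g s x \<in> carrier H"
    and g_add_left: "\<And>s t x. \<lbrakk>s \<in> carrier S; t \<in> carrier S; x \<in> carrier M\<rbrakk>
        \<Longrightarrow> g (s \<oplus>\<^bsub>S\<^esub> t) x = g s x \<otimes>\<^bsub>H\<^esub> g t x"
    and g_add_right: "\<And>s x y. \<lbrakk>s \<in> carrier S; x \<in> carrier M; y \<in> carrier M\<rbrakk>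
        \<Longrightarrow> g s (x \<oplus>\<^bsub>M\<^esub> y) = g s x \<otimes>\<^bsub>H\<^esub> g s y"
    and g_balanced: "\<And>s a x. \<lbrakk>s \<in> carrier S; a \<in> carrier R; x \<in> carrier M\<rbrakk>
        \<Longrightarrow> g (s \<otimes>\<^bsub>S\<^esub> \<phi> a) x = g s (a \<odot>\<^bsub>M\<^esub> x)"
  obtains G where "G \<in> hom (add_monoid TM) H"
    and "\<And>s x. \<lbrakk>s \<in> carrier S; x \<in> carrier M\<rbrakk> \<Longrightarrow> G (tn s x) = g s x"
proof -
  interpret H: comm_group H by fact
  obtain h where h: "h \<in> hom T H"
      "\<And>y. y \<in> carrier S \<times> carrier M \<Longrightarrow> h (frag_of y) = case_prod g y"
    using H.free_Abelian_group_universal[of "case_prod g" "carrier S \<times> carrier M"] g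
    unfolding tensor_free_def by (auto simp: image_subset_iff)
  have hf: "h (frag_of (s, x)) = g s x" if "s \<in> carrier S" "x \<in> carrier M" for s x
    using h(2)[of "(s, x)"] that by simp
  interpret h: group_hom T H h
    using h by (unfold_locales) auto
  have h_diff: "h (x - y) = h x \<otimes>\<^bsub>H\<^esub> inv\<^bsub>H\<^esub> h y" if "x \<in> carrier T" "y \<in> carrier T" for x y
    using h.hom_mult[of x "inv\<^bsub>T\<^esub> y"] h.hom_inv[of y] that by (auto simp del: h.hom_mult)
  \<comment> \<open>For a bilinear \<open>g\<close>, the image of an additivity relation takes this
    shape.\<close>
  have cancel: "a \<otimes>\<^bsub>H\<^esub> (b \<otimes>\<^bsub>H\<^esub> (inv\<^bsub>H\<^esub> a \<otimes>\<^bsub>H\<^esub> inv\<^bsub>H\<^esub> b)) = \<one>\<^bsub>H\<^esub>"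
    if "a \<in> carrier H" "b \<in> carrier H" for a b
    using H.r_inv[of "a \<otimes>\<^bsub>H\<^esub> b"] that by (simp add: H.inv_mult H.m_assoc)
  have "h c = \<one>\<^bsub>H\<^esub>" if "c \<in> rels" for c
    using that unfolding rels_def
    by (auto simp: h_diff frag_of_T T_diff hf g g_add_left g_add_right g_balanced \<phi>_closed
        H.m_assoc cancel simp del: T_simps(3))
  then have "rels \<subseteq> kernel T H h"
    using rels_subset by (auto simp: kernel_def simp del: T_simps(3))
  then have ker: "N \<subseteq> kernel T H h"
    unfolding N_eq by (rule T.generate_subgroup_incl[OF _ h.subgroup_kernel])
  have "h x = h y" if "x \<in> carrier T" "y \<in> carrier T" "N #>\<^bsub>T\<^esub> x = N #>\<^bsub>T\<^esub> y" for x y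
  proof -
    have "h (x - y) = \<one>\<^bsub>H\<^esub>"
      using that ker coset_eq_iff by (auto simp: kernel_def simp del: T_simps(3))
    then show ?thesis
      using that h_diff[of x y] h.hom_closed[of x] h.hom_closed[of y]
        H.inv_solve_right[of "\<one>\<^bsub>H\<^esub>" "h x" "h y"]
      by (simp del: T_simps)
  qed
  then obtain G where G: "G \<in> hom (T Mod N) H" "\<And>x. x \<in> carrier T \<Longrightarrow> G (N #>\<^bsub>T\<^esub> x) = h x"
    using FactGroup_universal[OF h(1) N_normal] by metis
  show thesis
  proof
    show "G \<in> hom (add_monoid TM) H"
      using G(1) by (auto simp: hom_def TM_simps)
    show "G (tn s x) = g s x" if "s \<in> carrier S" "x \<in> carrier M" for s x
      using that G(2) hf frag_of_T by (simp add: tensor_def del: T_simps(3))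
  qed
qed

text \<open>Multiplying first components by \<open>r\<close> maps \<open>N\<close> into itself, so
  the union in the definition of the action runs over one and the same coset.\<close>

lemma smult_tensor:
  assumes r: "r \<in> carrier S" and s: "s \<in> carrier S" and x: "x \<in> carrier M"
  shows "r \<odot>\<^bsub>TM\<^esub> tn s x = tn (r \<otimes>\<^bsub>S\<^esub> s) x"
proof -
  define f where "f = frag_extend (\<lambda>(s, x). frag_of (r \<otimes>\<^bsub>S\<^esub> s, x) :: 's \<times> 'm \<Rightarrow>\<^sub>0 int)"
  have f_of: "f (frag_of (s, x)) = frag_of (r \<otimes>\<^bsub>S\<^esub> s, x)" for s x
    by (simp add: f_def)
  have f_add: "f (a + b) = f a + f b" and f_diff: "f (a - b) = f a - f b"
    and f_0: "f 0 = 0" and f_minus: "f (- a) = - f a" for a b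
    by (simp_all add: f_def frag_extend_add frag_extend_diff frag_extend_minus)
  have f_closed: "f a \<in> carrier T" if "a \<in> carrier T" for a
  proof -
    have "Poly_Mapping.keys a \<subseteq> carrier S \<times> carrier M" using that by simp
    then show ?thesis
    proof (induction a rule: frag_induction)
      case (one y)
      then show ?case using r by (cases y) (auto simp: f_of intro!: frag_of_T simp del: T_simps(3))
    next
      case zero
      then show ?case by (simp add: f_0)
    qed (auto simp: f_diff intro!: T_diff simp del: T_simps(3))
  qed
  \<comment> \<open>Every relation goes to one of the same kind with \<open>s\<close> replaced by r
    s.\<close>
  have f_rels: "f c \<in> rels" if "c \<in> rels" for c
    using that unfolding rels_def
    apply (elim UnE CollectE exE conjE)
    subgoal for s t x by (rule UnI1, rule UnI1, rule CollectI, rule exI[of _ "r \<otimes>\<^bsub>S\<^esub> s"],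
          rule exI[of _ "r \<otimes>\<^bsub>S\<^esub> t"], rule exI[of _ x]) (auto simp: f_diff f_of r S.r_distr)
    subgoal for s x y by (rule UnI1, rule UnI2, rule CollectI, rule exI[of _ "r \<otimes>\<^bsub>S\<^esub> s"],
          rule exI[of _ x], rule exI[of _ y]) (auto simp: f_diff f_of r)
    subgoal for s a x by (rule UnI2, rule CollectI, rule exI[of _ "r \<otimes>\<^bsub>S\<^esub> s"], rule exI[of _ a], rule exI[of _ x])
        (auto simp: f_diff f_of r S.m_assoc \<phi>_closed)
    done
  have f_N: "f c \<in> N" if "c \<in> N" for c
    using that unfolding N_eq
  proof (induction rule: generate.induct)
    case one
    then show ?case using generate.one[of T rels] by (simp add: f_0)
  next
    case (incl h)
    then show ?case using f_rels by (auto intro: generate.incl)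
  next
    case (inv h)
    then have "f (inv\<^bsub>T\<^esub> h) = inv\<^bsub>T\<^esub> (f h)"
      using rels_subset f_closed[of h] by (auto simp: f_minus subset_iff)
    then show ?case using f_rels[OF inv] by (auto intro: generate.inv)
  next
    case (eng h1 h2)
    then show ?case using generate.eng[of "f h1" T rels "f h2"] by (simp add: f_add)
  qed
  have "N #>\<^bsub>T\<^esub> f c = tn (r \<otimes>\<^bsub>S\<^esub> s) x" if c: "c \<in> tn s x" for c
  proof -
    obtain d where d: "d \<in> N" "c = d + frag_of (s, x)"
      using c by (auto simp: tensor_def r_coset_def)
    have "d \<in> carrier T" by (rule subgroup.mem_carrier[OF N_subgroup d(1)])
    then have "f c \<in> carrier T" "f c - frag_of (r \<otimes>\<^bsub>S\<^esub> s, x) \<in> N"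
      using d assms f_N f_closed frag_of_T by (auto simp: f_add f_of intro!: T_add simp del: T_simps(3))
    then show ?thesis
      unfolding tensor_def using assms
      by (subst coset_eq_iff) (auto intro!: frag_of_T simp del: T_simps(3))
  qed
  \<comment> \<open>A coset is nonempty, so the union is the common coset rather than the empty
    set.\<close>
  moreover have "frag_of (s, x) \<in> tn s x"
    unfolding tensor_def by (rule T.rcos_self[OF frag_of_T[OF s x] N_subgroup])
  ultimately have "(\<Union>c\<in>tn s x. N #>\<^bsub>T\<^esub> f c) = tn (r \<otimes>\<^bsub>S\<^esub> s) x"
    by auto
  then show ?thesis
    by (simp add: base_change_def f_def)
qed

end

section \<open>Homogeneous components\<close>

context graded_module
begin

definition hcomp :: "int \<Rightarrow> 'm \<Rightarrow> 'm" where
  "hcomp d x = (THE c. (\<forall>i. c i \<in> Mg i) \<and> finite {i. c i \<noteq> \<zero>\<^bsub>M\<^esub>} \<and>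
             x = (\<Oplus>\<^bsub>M\<^esub>i\<in>{i. c i \<noteq> \<zero>\<^bsub>M\<^esub>}. c i)) d"

lemma Mg_closed: "x \<in> Mg i \<Longrightarrow> x \<in> carrier M"
  using subgroup.mem_carrier[OF grade_subgroup] by fastforce

lemma Mg_zero [simp]: "\<zero>\<^bsub>M\<^esub> \<in> Mg i"
  using subgroup.one_closed[OF grade_subgroup[of i]] by simp

lemma Mg_add: "x \<in> Mg i \<Longrightarrow> y \<in> Mg i \<Longrightarrow> x \<oplus>\<^bsub>M\<^esub> y \<in> Mg i"
  using subgroup.m_closed[OF grade_subgroup[of i]] by simp

lemma hcomp_props:
  assumes "x \<in> carrier M"
  shows "hcomp i x \<in> Mg i" "finite {i. hcomp i x \<noteq> \<zero>\<^bsub>M\<^esub>}"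
    "x = (\<Oplus>\<^bsub>M\<^esub>i\<in>{i. hcomp i x \<noteq> \<zero>\<^bsub>M\<^esub>}. hcomp i x)"
  using theI'[OF direct_sum[OF assms]] unfolding hcomp_def by blast+

lemma hcomp_closed: "x \<in> carrier M \<Longrightarrow> hcomp i x \<in> carrier M"
  using hcomp_props Mg_closed by blast

text \<open>Any finite set \<open>A\<close> containing the support will do, whereas
  \<open>direct_sum\<close> speaks of the exact support, which is awkward when components cancel in
  a sum.\<close>

lemma hcomp_eqI:
  assumes c: "\<And>i. c i \<in> Mg i" and A: "finite A" "\<And>i. i \<notin> A \<Longrightarrow> c i = \<zero>\<^bsub>M\<^esub>"
    and x: "x = (\<Oplus>\<^bsub>M\<^esub>i\<in>A. c i)"
  shows "hcomp i x = c i"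
proof -
  have c': "c i \<in> carrier M" for i
    using c Mg_closed by blast
  have sub: "{i. c i \<noteq> \<zero>\<^bsub>M\<^esub>} \<subseteq> A"
    using A by blast
  have "(\<Oplus>\<^bsub>M\<^esub>i\<in>{i. c i \<noteq> \<zero>\<^bsub>M\<^esub>}. c i) = (\<Oplus>\<^bsub>M\<^esub>i\<in>A. c i)"
    by (rule M.add.finprod_mono_neutral_cong_left[OF A(1) sub]) (auto simp: c')
  then have "(\<forall>i. c i \<in> Mg i) \<and> finite {i. c i \<noteq> \<zero>\<^bsub>M\<^esub>} \<and>
             x = (\<Oplus>\<^bsub>M\<^esub>i\<in>{i. c i \<noteq> \<zero>\<^bsub>M\<^esub>}. c i)"
    using c A(1) sub x by (auto intro: finite_subset)
  moreover have "x \<in> carrier M"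
    unfolding x using c' by (intro M.finsum_closed) auto
  ultimately show ?thesis
    unfolding hcomp_def by (subst the1_equality[OF direct_sum]) auto
qed

lemma hcomp_sum:
  assumes x: "x \<in> carrier M" and A: "finite A" "{i. hcomp i x \<noteq> \<zero>\<^bsub>M\<^esub>} \<subseteq> A"
  shows "x = (\<Oplus>\<^bsub>M\<^esub>i\<in>A. hcomp i x)"
  by (subst hcomp_props(3)[OF x], rule M.add.finprod_mono_neutral_cong_left[OF A])
    (auto simp: hcomp_closed x)

lemma hcomp_homogeneous:
  assumes "x \<in> Mg d"
  shows "hcomp i x = (if i = d then x else \<zero>\<^bsub>M\<^esub>)"
  by (rule hcomp_eqI[of _ "{d}"]) (use assms Mg_closed in auto)

lemma hcomp_add:
  assumes x: "x \<in> carrier M" and y: "y \<in> carrier M"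
  shows "hcomp i (x \<oplus>\<^bsub>M\<^esub> y) = hcomp i x \<oplus>\<^bsub>M\<^esub> hcomp i y"
proof (rule hcomp_eqI)
  let ?A = "{i. hcomp i x \<noteq> \<zero>\<^bsub>M\<^esub>} \<union> {i. hcomp i y \<noteq> \<zero>\<^bsub>M\<^esub>}"
  show fin: "finite ?A"
    using hcomp_props(2)[OF x] hcomp_props(2)[OF y] by blast
  show "hcomp i x \<oplus>\<^bsub>M\<^esub> hcomp i y \<in> Mg i" for i
    by (intro Mg_add hcomp_props x y)
  show "hcomp i x \<oplus>\<^bsub>M\<^esub> hcomp i y = \<zero>\<^bsub>M\<^esub>" if "i \<notin> ?A" for i
    using that by simp
  have "x \<oplus>\<^bsub>M\<^esub> y = (\<Oplus>\<^bsub>M\<^esub>i\<in>?A. hcomp i x) \<oplus>\<^bsub>M\<^esub> (\<Oplus>\<^bsub>M\<^esub>i\<in>?A. hcomp i y)"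
    using hcomp_sum[OF x fin] hcomp_sum[OF y fin] by auto
  also have "\<dots> = (\<Oplus>\<^bsub>M\<^esub>i\<in>?A. hcomp i x \<oplus>\<^bsub>M\<^esub> hcomp i y)"
    by (rule M.finsum_addf[symmetric]) (auto simp: hcomp_closed x y)
  finally show "x \<oplus>\<^bsub>M\<^esub> y = (\<Oplus>\<^bsub>M\<^esub>i\<in>?A. hcomp i x \<oplus>\<^bsub>M\<^esub> hcomp i y)" .
qed

text \<open>Multiplying the decomposition of \<open>x\<close> by \<open>r\<close> yields a
  decomposition of the product with all indices moved by \<open>j\<close>.\<close>

lemma hcomp_smult:
  assumes r: "r \<in> Rg j" "r \<in> carrier R" and x: "x \<in> carrier M"
  shows "hcomp i (r \<odot>\<^bsub>M\<^esub> x) = r \<odot>\<^bsub>M\<^esub> hcomp (i - j) x"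
proof (rule hcomp_eqI)
  let ?S = "{i. hcomp i x \<noteq> \<zero>\<^bsub>M\<^esub>}"
  let ?A = "(\<lambda>i. i + j) ` ?S"
  have fin: "finite ?S"
    by (rule hcomp_props(2)[OF x])
  then show "finite ?A" by simp
  show "r \<odot>\<^bsub>M\<^esub> hcomp (i - j) x \<in> Mg i" for i
    using smult_grade[OF r(1) hcomp_props(1)[OF x, of "i - j"]] by simp
  show "r \<odot>\<^bsub>M\<^esub> hcomp (i - j) x = \<zero>\<^bsub>M\<^esub>" if "i \<notin> ?A" for i
  proof -
    have "hcomp (i - j) x = \<zero>\<^bsub>M\<^esub>"
      using that by (rule contrapos_np) (auto intro!: image_eqI[of _ _ "i - j"])
    then show ?thesis using r by simp
  qed
  have "r \<odot>\<^bsub>M\<^esub> x = (\<Oplus>\<^bsub>M\<^esub>i\<in>?S. r \<odot>\<^bsub>M\<^esub> hcomp i x)"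
    by (subst hcomp_props(3)[OF x], rule finsum_smult_ldistr[OF fin r(2)]) (auto simp: hcomp_closed x)
  also have "\<dots> = (\<Oplus>\<^bsub>M\<^esub>i\<in>?A. r \<odot>\<^bsub>M\<^esub> hcomp (i - j) x)"
    by (subst M.add.finprod_reindex) (auto simp: hcomp_closed x r inj_on_def)
  finally show "r \<odot>\<^bsub>M\<^esub> x = (\<Oplus>\<^bsub>M\<^esub>i\<in>?A. r \<odot>\<^bsub>M\<^esub> hcomp (i - j) x)" .
qed

end

section \<open>Graded F-modules\<close>

text \<open>Here \<open>t r x\<close> stands for the preimage of \<open>r \<otimes> x\<close> under the structure morphism.\<close>

locale frob_graded_module =
  graded_module "mpoly_ring n" "mpoly_grading n" M Mg
  for n :: nat and M :: "('k::field mpoly, 'm) module" (structure) and Mg :: "int \<Rightarrow> 'm set" +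
  fixes p :: nat and t :: "'k mpoly \<Rightarrow> 'm \<Rightarrow> 'm"
  assumes char: "CHAR('k) = p" and p_pos: "p > 0"
    and t_closed: "\<lbrakk>r \<in> carrier (mpoly_ring n); x \<in> carrier M\<rbrakk> \<Longrightarrow> t r x \<in> carrier M"
    and t_add_left: "\<lbrakk>r \<in> carrier (mpoly_ring n); s \<in> carrier (mpoly_ring n); x \<in> carrier M\<rbrakk>
      \<Longrightarrow> t (r + s) x = t r x \<oplus>\<^bsub>M\<^esub> t s x"
    and t_add_right: "\<lbrakk>r \<in> carrier (mpoly_ring n); x \<in> carrier M; y \<in> carrier M\<rbrakk>
      \<Longrightarrow> t r (x \<oplus>\<^bsub>M\<^esub> y) = t r x \<oplus>\<^bsub>M\<^esub> t r y"
    and t_balanced: "\<lbrakk>r \<in> carrier (mpoly_ring n); a \<in> carrier (mpoly_ring n); x \<in> carrier M\<rbrakk>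
      \<Longrightarrow> t (r * a ^ p) x = t r (a \<odot>\<^bsub>M\<^esub> x)"
    and smult_t: "\<lbrakk>r \<in> carrier (mpoly_ring n); s \<in> carrier (mpoly_ring n); x \<in> carrier M\<rbrakk>
      \<Longrightarrow> r \<odot>\<^bsub>M\<^esub> t s x = t (r * s) x"
    and t_universal: "\<lbrakk>\<And>r x. \<lbrakk>r \<in> carrier (mpoly_ring n); x \<in> carrier M\<rbrakk> \<Longrightarrow> g r x \<in> carrier M;
      \<And>r s x. \<lbrakk>r \<in> carrier (mpoly_ring n); s \<in> carrier (mpoly_ring n); x \<in> carrier M\<rbrakk>
        \<Longrightarrow> g (r + s) x = g r x \<oplus>\<^bsub>M\<^esub> g s x;
      \<And>r x y. \<lbrakk>r \<in> carrier (mpoly_ring n); x \<in> carrier M; y \<in> carrier M\<rbrakk>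
        \<Longrightarrow> g r (x \<oplus>\<^bsub>M\<^esub> y) = g r x \<oplus>\<^bsub>M\<^esub> g r y;
      \<And>r a x. \<lbrakk>r \<in> carrier (mpoly_ring n); a \<in> carrier (mpoly_ring n); x \<in> carrier M\<rbrakk>
        \<Longrightarrow> g (r * a ^ p) x = g r (a \<odot>\<^bsub>M\<^esub> x)\<rbrakk>
      \<Longrightarrow> \<exists>G\<in>hom (add_monoid M) (add_monoid M).
        \<forall>r\<in>carrier (mpoly_ring n). \<forall>x\<in>carrier M. G (t r x) = g r x"
    and t_generates_grade: "y \<in> Mg d \<Longrightarrow>
      y \<in> generate (add_monoid M) {t r x | r x i j. r \<in> mpoly_grading n i \<and> x \<in> Mg j \<and> i + int p * j = d}"
begin

abbreviation "R \<equiv> mpoly_ring n :: 'k mpoly ring"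

lemma p_ge_2: "p \<ge> 2"
  using char p_pos prime_CHAR_semidom[where ?'a = 'k] prime_ge_2_nat by auto

lemma var_closed [simp]: "i < n \<Longrightarrow> mpoly_var i \<in> carrier R"
  by (auto simp: mpoly_var_def split: if_splits)

section \<open>Coordinates on M through the structure morphism\<close>

definition "coord = (SOME h :: 'k \<Rightarrow> 'k \<Rightarrow> 'k.
  (\<forall>b. frob_functional p (h b)) \<and> (\<forall>c. finite {b. h b c \<noteq> 0}) \<and>
  (\<forall>c. c = (\<Sum>b | h b c \<noteq> 0. h b c ^ p * b)))"

lemma coord_props:
  "frob_functional p (coord b)" "finite {b. coord b c \<noteq> 0}" "c = (\<Sum>b | coord b c \<noteq> 0. coord b c ^ p * b)"
proof -
  let ?P = "\<lambda>h. (\<forall>b. frob_functional p (h b)) \<and> (\<forall>c. finite {b. h b c \<noteq> 0}) \<and>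
    (\<forall>c. c = (\<Sum>b | h b c \<noteq> 0. h b c ^ p * b))"
  obtain h :: "'k \<Rightarrow> 'k \<Rightarrow> 'k" where h: "\<And>b c d. h b (c + d) = h b c + h b d"
    "\<And>b c d. h b (d ^ p * c) = d * h b c" "\<And>c. finite {b. h b c \<noteq> 0}"
    "\<And>c. c = (\<Sum>b | h b c \<noteq> 0. h b c ^ p * b)"
    using frobenius_basis_exists[OF char p_pos] by blast
  have "frob_functional p (h b)" for b
    by unfold_locales (use char p_pos h in auto)
  with h(3,4) have *: "?P h"
    by blast
  have "?P coord"
    unfolding coord_def by (rule someI[of ?P, OF *])
  then show "frob_functional p (coord b)" "finite {b. coord b c \<noteq> 0}"
    "c = (\<Sum>b | coord b c \<noteq> 0. coord b c ^ p * b)"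
    by blast+
qed

sublocale coord: frob_functional p "coord b" for b
  by (rule coord_props)

text \<open>The coordinate at b x^a, read through the structure morphism: r tensor x goes to
  (coefficient of r) x, an element of \<open>M\<close> again.\<close>

definition E :: "'k \<Rightarrow> monomial \<Rightarrow> 'm \<Rightarrow> 'm" where
  "E b a = (SOME G. G \<in> hom (add_monoid M) (add_monoid M) \<and>
    (\<forall>r\<in>carrier R. \<forall>x\<in>carrier M. G (t r x) = frob_coeff p (coord b) a r \<odot>\<^bsub>M\<^esub> x))"

text \<open>Existence comes from the universal property. Its balancing condition is
  \<open>frob_coeff_mult_power\<close>, which is where the exponents of \<open>a\<close> must be
  below \<open>p\<close>.\<close>

lemma E_props:
  assumes a: "a \<in> reduced_monomials n p"
  shows "E b a \<in> hom (add_monoid M) (add_monoid M)"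
    and "\<lbrakk>r \<in> carrier R; x \<in> carrier M\<rbrakk> \<Longrightarrow> E b a (t r x) = frob_coeff p (coord b) a r \<odot>\<^bsub>M\<^esub> x"
proof -
  let ?P = "\<lambda>G. G \<in> hom (add_monoid M) (add_monoid M) \<and>
    (\<forall>r\<in>carrier R. \<forall>x\<in>carrier M. G (t r x) = frob_coeff p (coord b) a r \<odot>\<^bsub>M\<^esub> x)"
  have a': "lookup a i < p" for i
    using a by (auto simp: reduced_monomials_def)
  have "\<exists>G\<in>hom (add_monoid M) (add_monoid M).
      \<forall>r\<in>carrier R. \<forall>x\<in>carrier M. G (t r x) = frob_coeff p (coord b) a r \<odot>\<^bsub>M\<^esub> x"
  proof (rule t_universal)
    show "frob_coeff p (coord b) a (r * f ^ p) \<odot>\<^bsub>M\<^esub> x = frob_coeff p (coord b) a r \<odot>\<^bsub>M\<^esub> (f \<odot>\<^bsub>M\<^esub> x)"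
      if "r \<in> carrier R" "f \<in> carrier R" "x \<in> carrier M" for r f x
      using that coord.frob_coeff_closed[OF that(1)] smult_assoc1[of "frob_coeff p (coord b) a r" f x]
      by (simp add: coord.frob_coeff_mult_power[OF a' that(2)])
    show "frob_coeff p (coord b) a (r + s) \<odot>\<^bsub>M\<^esub> x = frob_coeff p (coord b) a r \<odot>\<^bsub>M\<^esub> x \<oplus>\<^bsub>M\<^esub> frob_coeff p (coord b) a s \<odot>\<^bsub>M\<^esub> x"
      if "r \<in> carrier R" "s \<in> carrier R" "x \<in> carrier M" for r s x
      using that coord.frob_coeff_closed smult_l_distr[of "frob_coeff p (coord b) a r" "frob_coeff p (coord b) a s" x]
      by (simp add: coord.frob_coeff_add)
  qed (auto simp: coord.frob_coeff_closed smult_r_distr)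
  then obtain G where G: "?P G"
    by blast
  have "?P (E b a)"
    unfolding E_def by (rule someI[of ?P, OF G])
  then show "E b a \<in> hom (add_monoid M) (add_monoid M)"
    and "\<lbrakk>r \<in> carrier R; x \<in> carrier M\<rbrakk> \<Longrightarrow> E b a (t r x) = frob_coeff p (coord b) a r \<odot>\<^bsub>M\<^esub> x"
    by auto
qed

lemma t_zero_left: "x \<in> carrier M \<Longrightarrow> t 0 x = \<zero>\<^bsub>M\<^esub>"
  using t_add_left[of 0 0 x] t_closed[of 0 x] by (simp add: M.add.l_cancel_one' )

lemma t_zero_right: "r \<in> carrier R \<Longrightarrow> t r \<zero>\<^bsub>M\<^esub> = \<zero>\<^bsub>M\<^esub>"
  using t_add_right[of r "\<zero>\<^bsub>M\<^esub>" "\<zero>\<^bsub>M\<^esub>"] t_closed[of r "\<zero>\<^bsub>M\<^esub>"] by (simp add: M.add.l_cancel_one')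

lemma t_minus_left:
  assumes "r \<in> carrier R" "x \<in> carrier M"
  shows "\<ominus>\<^bsub>M\<^esub> t r x = t (- r) x"
proof -
  have "t (- r) x \<oplus>\<^bsub>M\<^esub> t r x = \<zero>\<^bsub>M\<^esub>"
    using t_add_left[of "- r" r x] assms by (simp add: t_zero_left)
  then show ?thesis
    using assms by (intro M.minus_equality) (auto simp: t_closed)
qed

lemma t_sum_left:
  assumes "finite A" "\<And>u. u \<in> A \<Longrightarrow> f u \<in> carrier R" "x \<in> carrier M"
  shows "t (sum f A) x = (\<Oplus>\<^bsub>M\<^esub>u\<in>A. t (f u) x) \<and> sum f A \<in> carrier R"
  using assms
proof (induction A)
  case empty
  then show ?case by (simp add: t_zero_left)
next
  case (insert u A)
  then show ?case
    by (auto simp: t_add_left t_closed M.finsum_insert)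
qed

text \<open>Every homogeneous element lies in the subgroup generated by elements
  \<open>t r x\<close>, and every element is a sum of homogeneous ones.\<close>

lemma t_induct [consumes 1, case_names zero t add]:
  assumes z: "z \<in> carrier M" and P0: "P \<zero>\<^bsub>M\<^esub>"
    and Pt: "\<And>r x. \<lbrakk>r \<in> carrier R; x \<in> carrier M\<rbrakk> \<Longrightarrow> P (t r x)"
    and Padd: "\<And>x y. \<lbrakk>x \<in> carrier M; y \<in> carrier M; P x; P y\<rbrakk> \<Longrightarrow> P (x \<oplus>\<^bsub>M\<^esub> y)"
  shows "P z"
proof -
  have gen: "\<exists>r x. r \<in> carrier R \<and> x \<in> carrier M \<and> y = t r x"
    if "y \<in> {t r x | r x i j. r \<in> mpoly_grading n i \<and> x \<in> Mg j \<and> i + int p * j = d}" for y d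
    using that by (blast dest: subsetD[OF mpoly_grading_subset] Mg_closed)
  have hom: "P y \<and> y \<in> carrier M" if "y \<in> Mg d" for y d
    using t_generates_grade[OF that]
  proof (induction rule: generate.induct)
    case one
    then show ?case using P0 by simp
  next
    case (incl y)
    then show ?case
      using gen[OF incl] Pt t_closed by auto
  next
    case (inv y)
    \<comment> \<open>The negative of \<open>t r x\<close> is \<open>t (- r) x\<close>, which is how
      the rule gets by with sums alone.\<close>
    then obtain r x where rx: "r \<in> carrier R" "x \<in> carrier M" "y = t r x"
      using gen[OF inv] by auto
    then have "inv\<^bsub>add_monoid M\<^esub> y = t (- r) x"
      using t_minus_left by (simp add: a_inv_def)
    then show ?case
      using rx Pt t_closed by simp
  next
    case (eng x y)
    then show ?case using Padd by simp
  qed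
  have "P (\<Oplus>\<^bsub>M\<^esub>i\<in>A. hcomp i z) \<and> (\<Oplus>\<^bsub>M\<^esub>i\<in>A. hcomp i z) \<in> carrier M" if "finite A" for A
    using that
  proof (induction A)
    case empty
    then show ?case using P0 by simp
  next
    case (insert i A)
    then show ?case
      using hom hcomp_props(1)[OF z] by (auto simp: M.finsum_insert hcomp_closed z intro!: Padd)
  qed
  from this[OF hcomp_props(2)[OF z]] show ?thesis
    using hcomp_props(3)[OF z] by simp
qed

text \<open>The uniqueness half of the universal property; it reduces identities for
  \<open>E\<close> to identities for \<open>frob_coeff\<close>.\<close>

lemma hom_eqI:
  assumes f: "f \<in> hom (add_monoid M) (add_monoid M)" and g: "g \<in> hom (add_monoid M) (add_monoid M)"
    and eq: "\<And>r x. \<lbrakk>r \<in> carrier R; x \<in> carrier M\<rbrakk> \<Longrightarrow> f (t r x) = g (t r x)"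
    and z: "z \<in> carrier M"
  shows "f z = g z"
  using z
proof (induction rule: t_induct)
  case zero
  have "f \<one>\<^bsub>add_monoid M\<^esub> = g \<one>\<^bsub>add_monoid M\<^esub>"
    using f g hom_one M.add.is_group by metis
  then show ?case by simp
next
  case (t r x)
  then show ?case by (rule eq)
next
  case (add x y)
  then show ?case using f g by (auto simp: hom_def)
qed

lemma E_closed: "a \<in> reduced_monomials n p \<Longrightarrow> z \<in> carrier M \<Longrightarrow> E b a z \<in> carrier M"
  using E_props(1)[of a b] by (auto simp: hom_def)

lemma E_add: "a \<in> reduced_monomials n p \<Longrightarrow> z \<in> carrier M \<Longrightarrow> w \<in> carrier M
  \<Longrightarrow> E b a (z \<oplus>\<^bsub>M\<^esub> w) = E b a z \<oplus>\<^bsub>M\<^esub> E b a w"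
  using E_props(1)[of a b] by (auto simp: hom_def)

lemma E_zero: "a \<in> reduced_monomials n p \<Longrightarrow> E b a \<zero>\<^bsub>M\<^esub> = \<zero>\<^bsub>M\<^esub>"
  using hom_one[OF E_props(1)[of a b]] M.add.is_group by auto

lemma E_minus: "a \<in> reduced_monomials n p \<Longrightarrow> z \<in> carrier M \<Longrightarrow> E b a (\<ominus>\<^bsub>M\<^esub> z) = \<ominus>\<^bsub>M\<^esub> E b a z"
  using group_hom.hom_inv[of "add_monoid M" "add_monoid M" "E b a" z] E_props(1)[of a b]
    M.add.is_group by (auto simp: group_hom_def group_hom_axioms_def a_inv_def)

lemma smult_hom: "c \<in> carrier R \<Longrightarrow> (\<lambda>z. c \<odot>\<^bsub>M\<^esub> z) \<in> hom (add_monoid M) (add_monoid M)"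
  by (auto simp: hom_def smult_r_distr)

lemma E_var:
  assumes i: "i < n" and a: "a \<in> reduced_monomials n p" "Suc (lookup a i) < p" and z: "z \<in> carrier M"
  shows "E b (a + single i 1) (mpoly_var i \<odot>\<^bsub>M\<^esub> z) = E b a z"
proof -
  have a': "a + single i 1 \<in> reduced_monomials n p"
    using a i by (auto simp: reduced_monomials_def keys_monomial_add lookup_add lookup_single when_def)
  show ?thesis
  proof (rule hom_eqI[OF _ _ _ z])
    show "(\<lambda>z. E b (a + single i 1) (mpoly_var i \<odot>\<^bsub>M\<^esub> z)) \<in> hom (add_monoid M) (add_monoid M)"
      using hom_compose[OF smult_hom[OF var_closed[OF i]] E_props(1)[OF a']] by (simp add: comp_def)
    show "E b a \<in> hom (add_monoid M) (add_monoid M)"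
      by (rule E_props(1)[OF a(1)])
    show "E b (a + single i 1) (mpoly_var i \<odot>\<^bsub>M\<^esub> t r x) = E b a (t r x)"
      if "r \<in> carrier R" "x \<in> carrier M" for r x
      using that i by (simp add: smult_t E_props(2) a a'[simplified] coord.frob_coeff_var_mult[simplified])
  qed
qed

text \<open>The product of x_i and x_i^(p-1) is a p-th power, which crosses the tensor sign as one
  factor x_i.\<close>

lemma E_var_top:
  assumes i: "i < n" and a: "a \<in> reduced_monomials n p" "lookup a i = 0" and z: "z \<in> carrier M"
  shows "E b a (mpoly_var i \<odot>\<^bsub>M\<^esub> z) = mpoly_var i \<odot>\<^bsub>M\<^esub> E b (a + single i (p - 1)) z"
proof -
  have a': "a + single i (p - 1) \<in> reduced_monomials n p"
    using a i p_pos by (auto simp: reduced_monomials_def keys_monomial_add lookup_add lookup_single when_def)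
  show ?thesis
  proof (rule hom_eqI[OF _ _ _ z])
    show "(\<lambda>z. E b a (mpoly_var i \<odot>\<^bsub>M\<^esub> z)) \<in> hom (add_monoid M) (add_monoid M)"
      using hom_compose[OF smult_hom[OF var_closed[OF i]] E_props(1)[OF a(1)]] by (simp add: comp_def)
    show "(\<lambda>z. mpoly_var i \<odot>\<^bsub>M\<^esub> E b (a + single i (p - 1)) z) \<in> hom (add_monoid M) (add_monoid M)"
      using hom_compose[OF E_props(1)[OF a'] smult_hom[OF var_closed[OF i]]] by (simp add: comp_def)
    show "E b a (mpoly_var i \<odot>\<^bsub>M\<^esub> t r x) = mpoly_var i \<odot>\<^bsub>M\<^esub> E b (a + single i (p - 1)) (t r x)"
      if "r \<in> carrier R" "x \<in> carrier M" for r x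
      using that i smult_assoc1[of "mpoly_var i" "frob_coeff p (coord b) (a + single i (p - 1)) r" x]
      by (simp add: smult_t E_props(2) a a'[simplified] coord.frob_coeff_var_mult_top coord.frob_coeff_closed)
  qed
qed

text \<open>For r tensor x, \<open>r\<close> is expanded and the p-th powers of its coefficients are
  moved across the tensor sign. Sums are handled by passing to a common index set.\<close>

lemma E_expansion:
  assumes z: "z \<in> carrier M"
  shows "\<exists>U. finite U \<and> U \<subseteq> UNIV \<times> reduced_monomials n p
    \<and> (\<forall>b. \<forall>a\<in>reduced_monomials n p. (b, a) \<notin> U \<longrightarrow> E b a z = \<zero>\<^bsub>M\<^esub>)
    \<and> z = (\<Oplus>\<^bsub>M\<^esub>u\<in>U. t (single (snd u) (fst u)) (E (fst u) (snd u) z))"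
  using z
proof (induction rule: t_induct)
  case zero
  then show ?case by (intro exI[of _ "{}"]) (simp add: E_zero)
next
  case (t r x)
  obtain U where U: "finite U" "U \<subseteq> UNIV \<times> reduced_monomials n p"
    "\<forall>b. \<forall>a\<in>reduced_monomials n p. (b, a) \<notin> U \<longrightarrow> frob_coeff p (coord b) a r = 0"
    "r = (\<Sum>(b, a)\<in>U. single a b * frob_coeff p (coord b) a r ^ p)"
    using frob_coeff_expansion[OF coord_props t(1)] by (elim exE conjE) (rule that)
  have red: "keys (snd u) \<subseteq> {..<n}" "snd u \<in> reduced_monomials n p" if "u \<in> U" for u
    using that U(2) by (fastforce simp: reduced_monomials_def)+
  have "t r x = t (\<Sum>u\<in>U. single (snd u) (fst u) * frob_coeff p (coord (fst u)) (snd u) r ^ p) x"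
    by (subst U(4)) (simp add: case_prod_unfold)
  also have "\<dots> = (\<Oplus>\<^bsub>M\<^esub>u\<in>U. t (single (snd u) (fst u) * frob_coeff p (coord (fst u)) (snd u) r ^ p) x)"
    by (intro conjunct1[OF t_sum_left]) (use U(1) red t coord.frob_coeff_closed in auto)
  also have "\<dots> = (\<Oplus>\<^bsub>M\<^esub>u\<in>U. t (single (snd u) (fst u)) (E (fst u) (snd u) (t r x)))"
    by (rule M.finsum_cong')
      (use red t in \<open>auto simp: t_balanced coord.frob_coeff_closed E_props t_closed\<close>)
  finally have eq: "t r x = (\<Oplus>\<^bsub>M\<^esub>u\<in>U. t (single (snd u) (fst u)) (E (fst u) (snd u) (t r x)))" .
  show ?case
  proof (intro exI[of _ U] conjI)
    show "\<forall>b. \<forall>a\<in>reduced_monomials n p. (b, a) \<notin> U \<longrightarrow> E b a (t r x) = \<zero>\<^bsub>M\<^esub>"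
      using U(3) t smult_l_null[of x] by (simp add: E_props)
  qed (use eq U(1,2) in auto)
next
  case (add z w)
  from add.IH obtain U W where U: "finite U" "U \<subseteq> UNIV \<times> reduced_monomials n p"
    "\<forall>b. \<forall>a\<in>reduced_monomials n p. (b, a) \<notin> U \<longrightarrow> E b a z = \<zero>\<^bsub>M\<^esub>"
    "z = (\<Oplus>\<^bsub>M\<^esub>u\<in>U. t (single (snd u) (fst u)) (E (fst u) (snd u) z))"
   and W: "finite W" "W \<subseteq> UNIV \<times> reduced_monomials n p"
    "\<forall>b. \<forall>a\<in>reduced_monomials n p. (b, a) \<notin> W \<longrightarrow> E b a w = \<zero>\<^bsub>M\<^esub>"
    "w = (\<Oplus>\<^bsub>M\<^esub>u\<in>W. t (single (snd u) (fst u)) (E (fst u) (snd u) w))"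
    by (elim exE conjE) (rule that)
  have red: "keys (snd u) \<subseteq> {..<n}" "snd u \<in> reduced_monomials n p" if "u \<in> U \<union> W" for u
    using that U(2) W(2) by (fastforce simp: reduced_monomials_def)+
  have closed: "t (single (snd u) (fst u)) (E (fst u) (snd u) y) \<in> carrier M"
    if "u \<in> U \<union> W" "y \<in> carrier M" for u y
    using red[OF that(1)] that(2) by (intro t_closed E_closed) auto
  have zero: "t (single (snd u) (fst u)) \<zero>\<^bsub>M\<^esub> = \<zero>\<^bsub>M\<^esub>" if "u \<in> U \<union> W" for u
    using red[OF that] by (intro t_zero_right) auto
  have E_zero_z: "E (fst u) (snd u) z = \<zero>\<^bsub>M\<^esub>" if "u \<in> (U \<union> W) - U" for u
    using U(3) red[of u] that by (metis DiffE prod.collapse)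
  have E_zero_w: "E (fst u) (snd u) w = \<zero>\<^bsub>M\<^esub>" if "u \<in> (U \<union> W) - W" for u
    using W(3) red[of u] that by (metis DiffE prod.collapse)
  have z: "z = (\<Oplus>\<^bsub>M\<^esub>u\<in>U \<union> W. t (single (snd u) (fst u)) (E (fst u) (snd u) z))"
    by (rule trans[OF U(4)], rule M.add.finprod_mono_neutral_cong_left)
      (use U(1) W(1) add.hyps E_zero_z zero closed in auto)
  have w: "w = (\<Oplus>\<^bsub>M\<^esub>u\<in>U \<union> W. t (single (snd u) (fst u)) (E (fst u) (snd u) w))"
    by (rule trans[OF W(4)], rule M.add.finprod_mono_neutral_cong_left)
      (use U(1) W(1) add.hyps E_zero_w zero closed in auto)
  have "z \<oplus>\<^bsub>M\<^esub> w = (\<Oplus>\<^bsub>M\<^esub>u\<in>U \<union> W. t (single (snd u) (fst u)) (E (fst u) (snd u) z))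
      \<oplus>\<^bsub>M\<^esub> (\<Oplus>\<^bsub>M\<^esub>u\<in>U \<union> W. t (single (snd u) (fst u)) (E (fst u) (snd u) w))"
    by (rule arg_cong2[OF z w])
  also have "\<dots> = (\<Oplus>\<^bsub>M\<^esub>u\<in>U \<union> W. t (single (snd u) (fst u)) (E (fst u) (snd u) z)
      \<oplus>\<^bsub>M\<^esub> t (single (snd u) (fst u)) (E (fst u) (snd u) w))"
    by (rule M.finsum_addf[symmetric]) (use closed add.hyps in auto)
  also have "\<dots> = (\<Oplus>\<^bsub>M\<^esub>u\<in>U \<union> W. t (single (snd u) (fst u)) (E (fst u) (snd u) (z \<oplus>\<^bsub>M\<^esub> w)))"
    by (rule M.finsum_cong')
      (use red closed add.hyps in \<open>auto simp: E_add E_closed t_add_right\<close>)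
  finally have eq: "z \<oplus>\<^bsub>M\<^esub> w = (\<Oplus>\<^bsub>M\<^esub>u\<in>U \<union> W. t (single (snd u) (fst u)) (E (fst u) (snd u) (z \<oplus>\<^bsub>M\<^esub> w)))" .
  show ?case
  proof (intro exI[of _ "U \<union> W"] conjI)
    show "\<forall>b. \<forall>a\<in>reduced_monomials n p. (b, a) \<notin> U \<union> W \<longrightarrow> E b a (z \<oplus>\<^bsub>M\<^esub> w) = \<zero>\<^bsub>M\<^esub>"
      using U(3) W(3) add.hyps by (simp add: E_add)
  qed (use eq U(1,2) W(1,2) in auto)
qed

end

section \<open>The socle\<close>

definition unif_monomial :: "nat \<Rightarrow> nat \<Rightarrow> monomial" where
  "unif_monomial n q = (\<Sum>i<n. single i q)"

lemma lookup_unif_monomial [simp]: "lookup (unif_monomial n q) i = (if i < n then q else 0)"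
  by (auto simp: unif_monomial_def lookup_sum lookup_single when_def)

lemma keys_unif_monomial: "keys (unif_monomial n q) \<subseteq> {..<n}"
  by (auto simp: in_keys_iff split: if_splits)

lemma monom_degree_unif_monomial [simp]: "monom_degree (unif_monomial n q) = n * q"
  by (subst monom_degree_eq_sum[OF keys_unif_monomial]) auto

context frob_graded_module
begin

text \<open>The annihilator in \<open>M\<close> of the irrelevant ideal; for n = 0 it is all of
  \<open>M\<close>.\<close>

definition socle :: "'m set" where
  "socle = {x \<in> carrier M. \<forall>i<n. mpoly_var i \<odot>\<^bsub>M\<^esub> x = \<zero>\<^bsub>M\<^esub>}"

abbreviation "top_monomial \<equiv> unif_monomial n (p - 1)"

lemma top_monomial_reduced: "top_monomial \<in> reduced_monomials n p"
  using keys_unif_monomial[of n "p - 1"] p_pos by (auto simp: reduced_monomials_def)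

lemma socle_closed: "s \<in> socle \<Longrightarrow> s \<in> carrier M"
  by (simp add: socle_def)

text \<open>Some exponent a_i is below p - 1, and then the coordinate of \<open>s\<close> at x^a is
  the coordinate of x_i s = 0 at x_i x^a.\<close>

lemma E_socle_eq_0:
  assumes s: "s \<in> socle" and a: "a \<in> reduced_monomials n p" "a \<noteq> top_monomial"
  shows "E b a s = \<zero>\<^bsub>M\<^esub>"
proof -
  obtain i where i: "lookup a i \<noteq> lookup top_monomial i"
    using a(2) by (metis poly_mapping_eqI)
  have "i < n"
  proof (rule ccontr)
    assume "\<not> i < n"
    with a(1) have "lookup a i = 0"
      unfolding reduced_monomials_def by (auto simp: in_keys_iff)
    with i \<open>\<not> i < n\<close> show False by simp
  qed
  moreover have "Suc (lookup a i) < p"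
  proof -
    have "lookup a i < p" "lookup a i \<noteq> p - 1"
      using a(1) i \<open>i < n\<close> by (auto simp: reduced_monomials_def)
    then show ?thesis by linarith
  qed
  moreover have "a + single i 1 \<in> reduced_monomials n p"
    using calculation a(1)
    by (auto simp: reduced_monomials_def keys_monomial_add lookup_add lookup_single when_def)
  ultimately show ?thesis
    using E_var[of i a s b] s a(1) by (simp add: socle_def E_zero)
qed

text \<open>Multiplication by x_i carries at the exponent p - 1, so x_i times the top coordinate of
  \<open>s\<close> is a coordinate of x_i s = 0.\<close>

lemma E_top_socle:
  assumes s: "s \<in> socle"
  shows "E b top_monomial s \<in> socle"
  unfolding socle_def
proof (intro CollectI conjI allI impI)
  show "E b top_monomial s \<in> carrier M"
    by (intro E_closed top_monomial_reduced socle_closed s)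
  fix i assume i: "i < n"
  \<comment> \<open>The top monomial with its variable x_i removed.\<close>
  define a where "a = (\<Sum>j\<in>{..<n} - {i}. single j (p - 1))"
  have a: "lookup a j = (if j < n \<and> j \<noteq> i then p - 1 else 0)" for j
    unfolding a_def lookup_sum lookup_single when_def by (subst sum.delta) auto
  have "a + single i (p - 1) = top_monomial"
    by (rule poly_mapping_eqI) (use i in \<open>auto simp: lookup_add a lookup_single when_def\<close>)
  moreover have a_red: "a \<in> reduced_monomials n p"
    using p_pos by (auto simp: reduced_monomials_def in_keys_iff a split: if_splits)
  ultimately show "mpoly_var i \<odot>\<^bsub>M\<^esub> E b top_monomial s = \<zero>\<^bsub>M\<^esub>"
    using E_var_top[OF i a_red, of s b] s i by (simp add: socle_def a E_zero)
qed

text \<open>Only coordinates at the top monomial survive on the socle, so the sum over pairs shrinks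
  to a sum over scalars \<open>b\<close>.\<close>

lemma socle_expansion:
  assumes s: "s \<in> socle"
  shows "\<exists>B. finite B \<and> s = (\<Oplus>\<^bsub>M\<^esub>b\<in>B. t (single top_monomial b) (E b top_monomial s))"
proof -
  obtain U where U: "finite U" "U \<subseteq> UNIV \<times> reduced_monomials n p"
    "\<forall>b. \<forall>a\<in>reduced_monomials n p. (b, a) \<notin> U \<longrightarrow> E b a s = \<zero>\<^bsub>M\<^esub>"
    "s = (\<Oplus>\<^bsub>M\<^esub>u\<in>U. t (single (snd u) (fst u)) (E (fst u) (snd u) s))"
    using E_expansion[OF socle_closed[OF s]] by (elim exE conjE) (rule that)
  define B where "B = {b. (b, top_monomial) \<in> U}"
  have B: "(\<lambda>b. (b, top_monomial)) ` B = {u \<in> U. snd u = top_monomial}"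
    by (auto simp: B_def image_iff)
  have closed': "t (single a b) (E b a s) \<in> carrier M" if "a \<in> reduced_monomials n p" for a b
    using that by (intro t_closed E_closed socle_closed s) (auto simp: reduced_monomials_def)
  note closed = closed'[OF top_monomial_reduced]
  have "(\<Oplus>\<^bsub>M\<^esub>u\<in>(\<lambda>b. (b, top_monomial)) ` B. t (single (snd u) (fst u)) (E (fst u) (snd u) s))
      = (\<Oplus>\<^bsub>M\<^esub>u\<in>U. t (single (snd u) (fst u)) (E (fst u) (snd u) s))"
  proof (rule M.add.finprod_mono_neutral_cong_left)
    show "t (single (snd u) (fst u)) (E (fst u) (snd u) s) = \<zero>\<^bsub>M\<^esub>"
      if "u \<in> U - (\<lambda>b. (b, top_monomial)) ` B" for u
    proof -
      have "snd u \<in> reduced_monomials n p" "snd u \<noteq> top_monomial"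
        using that U(2) unfolding B by auto
      then show ?thesis
        using E_socle_eq_0[OF s, of "snd u" "fst u"] t_zero_right[of "single (snd u) (fst u)"]
        by (auto simp: reduced_monomials_def)
    qed
  qed (use U(1,2) B in \<open>auto intro!: closed'\<close>)
  with U(4) have "s = (\<Oplus>\<^bsub>M\<^esub>u\<in>(\<lambda>b. (b, top_monomial)) ` B. t (single (snd u) (fst u)) (E (fst u) (snd u) s))"
    by simp
  also have "\<dots> = (\<Oplus>\<^bsub>M\<^esub>b\<in>B. t (single top_monomial b) (E b top_monomial s))"
    by (subst M.add.finprod_reindex) (auto simp: closed[simplified] inj_on_def)
  finally have "s = (\<Oplus>\<^bsub>M\<^esub>b\<in>B. t (single top_monomial b) (E b top_monomial s))" .
  moreover have "finite ((\<lambda>b. (b, top_monomial)) ` B)"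
    unfolding B using U(1) by simp
  then have "finite B"
    by (rule finite_imageD) (auto simp: inj_on_def)
  ultimately show ?thesis by blast
qed

section \<open>Degrees of socle elements\<close>

lemma generate_image_E:
  assumes a: "a \<in> reduced_monomials n p" and H: "subgroup H (add_monoid M)"
    and z: "z \<in> generate (add_monoid M) Z" and Z: "\<And>y. y \<in> Z \<Longrightarrow> y \<in> carrier M \<and> E b a y \<in> H"
  shows "E b a z \<in> H"
proof -
  have "E b a z \<in> H \<and> z \<in> carrier M"
    using z
  proof (induction rule: generate.induct)
    case one
    then show ?case using E_zero[OF a] subgroup.one_closed[OF H] by simp
  next
    case (incl h)
    then show ?case using Z by blast
  next
    case (inv h)
    then have "E b a (\<ominus>\<^bsub>M\<^esub> h) = \<ominus>\<^bsub>M\<^esub> E b a h" "\<ominus>\<^bsub>M\<^esub> h \<in> carrier M"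
      using Z[OF inv] E_minus[OF a] by auto
    then show ?case
      using Z[OF inv] subgroup.m_inv_closed[OF H, of "E b a h"] by (simp add: a_inv_def)
  next
    case (eng h1 h2)
    then show ?case using subgroup.m_closed[OF H, of "E b a h1" "E b a h2"] E_add[OF a] by simp
  qed
  then show ?thesis ..
qed

text \<open>If \<open>r\<close> has degree i and \<open>x\<close> degree j, the coefficient of
  \<open>r\<close> at x^a has degree (i - |a|) / p, and multiplying by \<open>x\<close> adds j.
  Homogeneous elements are known only through such generators, hence the passage through
  \<open>generate_image_E\<close>.\<close>

lemma E_grade:
  assumes a: "a \<in> reduced_monomials n p" and z: "z \<in> Mg (int (monom_degree a) + int p * d)"
  shows "E b a z \<in> Mg d"
proof (rule generate_image_E[OF a grade_subgroup t_generates_grade[OF z]])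
  fix y assume "y \<in> {t r x |r x i j. r \<in> mpoly_grading n i \<and> x \<in> Mg j \<and>
                     i + int p * j = int (monom_degree a) + int p * d}"
  then obtain r x i j where y: "y = t r x" "r \<in> mpoly_grading n i" "x \<in> Mg j"
    "i + int p * j = int (monom_degree a) + int p * d"
    by blast
  have rx: "r \<in> carrier R" "x \<in> carrier M"
    using y mpoly_grading_subset Mg_closed by auto
  have "i = int (monom_degree a) + int p * (d - j)"
    using y(4) by (simp add: algebra_simps)
  then have "frob_coeff p (coord b) a r \<in> mpoly_grading n (d - j)"
    using y(2) coord.frob_coeff_grading by blast
  from smult_grade[OF this y(3)] show "y \<in> carrier M \<and> E b a y \<in> Mg d"
    using rx by (simp add: y(1) E_props(2)[OF a] t_closed)
qed

text \<open>A degree not congruent to |a| modulo p admits no coefficient at x^a; the argument for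
  \<open>E_grade\<close> then runs with the zero subgroup.\<close>

lemma E_grade_eq_0:
  assumes a: "a \<in> reduced_monomials n p" and z: "z \<in> Mg e"
    and e: "\<And>d. e \<noteq> int (monom_degree a) + int p * d"
  shows "E b a z = \<zero>\<^bsub>M\<^esub>"
proof -
  have "E b a z \<in> {\<zero>\<^bsub>M\<^esub>}"
  proof (rule generate_image_E[OF a _ t_generates_grade[OF z]])
    show "subgroup {\<zero>\<^bsub>M\<^esub>} (add_monoid M)"
      using M.add.triv_subgroup by simp
    fix y assume "y \<in> {t r x |r x i j. r \<in> mpoly_grading n i \<and> x \<in> Mg j \<and> i + int p * j = e}"
    then obtain r x i j where y: "y = t r x" "r \<in> mpoly_grading n i" "x \<in> Mg j" "i + int p * j = e"
      by blast
    have rx: "r \<in> carrier R" "x \<in> carrier M"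
      using y mpoly_grading_subset Mg_closed by auto
    have "i \<noteq> int (monom_degree a) + int p * d" for d
      using e[of "d + j"] y(4) by (simp add: algebra_simps)
    then have "frob_coeff p (coord b) a r = 0"
      using y(2) coord.frob_coeff_grading_eq_0 by blast
    then show "y \<in> carrier M \<and> E b a y \<in> {\<zero>\<^bsub>M\<^esub>}"
      using rx smult_l_null[of x] by (simp add: y(1) E_props(2)[OF a] t_closed)
  qed
  then show ?thesis by simp
qed

text \<open>By the expansion, a nonzero socle element has a nonzero top coordinate. This is a socle
  element of degree d' with d = n (p - 1) + p d'.\<close>

lemma socle_descent:
  assumes s: "s \<in> socle" "s \<in> Mg d" "s \<noteq> \<zero>\<^bsub>M\<^esub>"
  obtains s' d' where "s' \<in> socle" "s' \<in> Mg d'" "s' \<noteq> \<zero>\<^bsub>M\<^esub>" "d + int n = int p * (d' + int n)"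
proof -
  obtain B where B: "finite B" "s = (\<Oplus>\<^bsub>M\<^esub>b\<in>B. t (single top_monomial b) (E b top_monomial s))"
    using socle_expansion[OF s(1)] by blast
  have "\<exists>b\<in>B. E b top_monomial s \<noteq> \<zero>\<^bsub>M\<^esub>"
  proof (rule ccontr)
    assume "\<not> ?thesis"
    then have "(\<Oplus>\<^bsub>M\<^esub>b\<in>B. t (single top_monomial b) (E b top_monomial s)) = (\<Oplus>\<^bsub>M\<^esub>b\<in>B. \<zero>\<^bsub>M\<^esub>)"
      using keys_unif_monomial by (intro M.finsum_cong') (auto simp: t_zero_right)
    with B s(3) show False by simp
  qed
  then obtain b where b: "E b top_monomial s \<noteq> \<zero>\<^bsub>M\<^esub>" by blast
  with E_grade_eq_0[OF top_monomial_reduced s(2)] obtain d' where d': "d = int (monom_degree top_monomial) + int p * d'"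
    by metis
  show thesis
  proof (rule that)
    show "E b top_monomial s \<in> socle" by (rule E_top_socle[OF s(1)])
    show "E b top_monomial s \<in> Mg d'" using E_grade[OF top_monomial_reduced] s(2) d' by blast
    show "E b top_monomial s \<noteq> \<zero>\<^bsub>M\<^esub>" by fact
    show "d + int n = int p * (d' + int n)"
      using d' p_pos by (simp add: of_nat_diff algebra_simps)
  qed
qed

text \<open>As p >= 2, the absolute value of d + n strictly decreases under the descent unless d + n
  = 0.\<close>

lemma socle_degree:
  assumes "s \<in> socle" "s \<in> Mg d" "s \<noteq> \<zero>\<^bsub>M\<^esub>"
  shows "d = - int n"
  using assms
proof (induction "nat \<bar>d + int n\<bar>" arbitrary: s d rule: less_induct)
  case less
  obtain s' d' where s': "s' \<in> socle" "s' \<in> Mg d'" "s' \<noteq> \<zero>\<^bsub>M\<^esub>" "d + int n = int p * (d' + int n)"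
    using socle_descent[OF less.prems] by blast
  show ?case
  proof (rule ccontr)
    assume "d \<noteq> - int n"
    then have ne: "d' + int n \<noteq> 0"
      using s'(4) by auto
    have "1 * \<bar>d' + int n\<bar> < int p * \<bar>d' + int n\<bar>"
      using p_ge_2 ne by (intro mult_strict_right_mono) auto
    also have "\<dots> = \<bar>d + int n\<bar>"
      unfolding s'(4) by (simp add: abs_mult)
    finally have "d' = - int n"
      using less.hyps[OF _ s'(1-3)] by simp
    with ne show False by simp
  qed
qed

lemma var_grading: "i < n \<Longrightarrow> mpoly_var i \<in> mpoly_grading n 1"
  using single_mem_mpoly_grading[of "single i 1" n 1] by (simp add: mpoly_var_def)

lemma hcomp_socle:
  assumes s: "s \<in> socle"
  shows "hcomp d s \<in> socle"
proof -
  have "mpoly_var i \<odot>\<^bsub>M\<^esub> hcomp d s = \<zero>\<^bsub>M\<^esub>" if "i < n" for i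
  proof -
    have "hcomp (d + 1) (mpoly_var i \<odot>\<^bsub>M\<^esub> s) = mpoly_var i \<odot>\<^bsub>M\<^esub> hcomp (d + 1 - 1) s"
      by (rule hcomp_smult) (use var_grading that s socle_closed in auto)
    then show ?thesis
      using s that hcomp_homogeneous[OF Mg_zero] by (simp add: socle_def)
  qed
  then show ?thesis
    using s by (auto simp: socle_def hcomp_closed)
qed

text \<open>Variables are homogeneous, so the components of a socle element lie in the socle, and
  all but the one of degree - n vanish.\<close>

lemma socle_homogeneous:
  assumes s: "s \<in> socle"
  shows "s \<in> Mg (- int n)"
proof -
  have "hcomp d s = \<zero>\<^bsub>M\<^esub>" if "d \<noteq> - int n" for d
    using socle_degree[OF hcomp_socle[OF s] hcomp_props(1)[OF socle_closed[OF s]]] that by blast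
  then have "{i. hcomp i s \<noteq> \<zero>\<^bsub>M\<^esub>} \<subseteq> {- int n}"
    by auto
  then have "s = (\<Oplus>\<^bsub>M\<^esub>i\<in>{- int n}. hcomp i s)"
    by (intro hcomp_sum socle_closed s) auto
  then have "s = hcomp (- int n) s"
    using s by (simp add: hcomp_closed socle_closed)
  then show ?thesis
    using hcomp_props(1)[OF socle_closed[OF s], of "- int n"] by simp
qed

text \<open>\<open>y\<close> imitates the vector dual to the monomial (x_1 ... x_n)^q in a copy of
  the injective hull with socle spanned by \<open>s\<close>: monomials with an exponent above q kill
  it.\<close>

definition divisible_socle :: "nat \<Rightarrow> bool" where
  "divisible_socle q \<longleftrightarrow> (\<forall>s\<in>socle. \<exists>y\<in>carrier M. single (unif_monomial n q) 1 \<odot>\<^bsub>M\<^esub> y = s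
    \<and> (\<forall>i<n. single (single i (Suc q)) 1 \<odot>\<^bsub>M\<^esub> y = \<zero>\<^bsub>M\<^esub>))"

lemma divisible_socle_0: "divisible_socle 0"
proof -
  have "unif_monomial n 0 = 0"
    by (rule poly_mapping_eqI) simp
  then have 1: "single (unif_monomial n 0) 1 = (1 :: 'k mpoly)"
    by simp
  show ?thesis
    unfolding divisible_socle_def 1
    using smult_one by (auto simp: socle_def mpoly_var_def)
qed

text \<open>Expand \<open>s\<close> as a sum of b x^top tensor s_b with s_b in the socle, divide
  each s_b to obtain \<open>Y b\<close>, and take the sum of b tensor \<open>Y b\<close>.\<close>

lemma divisible_socle_step:
  assumes q: "divisible_socle q"
  shows "divisible_socle (p * q + (p - 1))"
  unfolding divisible_socle_def
proof
  fix s assume s: "s \<in> socle"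
  obtain B where B: "finite B" "s = (\<Oplus>\<^bsub>M\<^esub>b\<in>B. t (single top_monomial b) (E b top_monomial s))"
    using socle_expansion[OF s] by blast
  have "\<forall>b. \<exists>y. y \<in> carrier M \<and> single (unif_monomial n q) 1 \<odot>\<^bsub>M\<^esub> y = E b top_monomial s
    \<and> (\<forall>i<n. single (single i (Suc q)) 1 \<odot>\<^bsub>M\<^esub> y = \<zero>\<^bsub>M\<^esub>)"
    using q E_top_socle[OF s] unfolding divisible_socle_def by blast
  then obtain Y where Y: "\<And>b. Y b \<in> carrier M" "\<And>b. single (unif_monomial n q) 1 \<odot>\<^bsub>M\<^esub> Y b = E b top_monomial s"
    "\<And>b i. i < n \<Longrightarrow> single (single i (Suc q)) 1 \<odot>\<^bsub>M\<^esub> Y b = \<zero>\<^bsub>M\<^esub>"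
    using choice[of "\<lambda>b y. y \<in> carrier M \<and> single (unif_monomial n q) 1 \<odot>\<^bsub>M\<^esub> y = E b top_monomial s
    \<and> (\<forall>i<n. single (single i (Suc q)) 1 \<odot>\<^bsub>M\<^esub> y = \<zero>\<^bsub>M\<^esub>)"] by blast
  define y where "y = (\<Oplus>\<^bsub>M\<^esub>b\<in>B. t (mpoly_const b) (Y b))"
  have y: "y \<in> carrier M"
    unfolding y_def using Y(1) by (intro M.finsum_closed) (auto simp: t_closed)
  have smult_y: "r \<odot>\<^bsub>M\<^esub> y = (\<Oplus>\<^bsub>M\<^esub>b\<in>B. t (r * mpoly_const b) (Y b))" if r: "r \<in> carrier R" for r
  proof -
    have "r \<odot>\<^bsub>M\<^esub> y = (\<Oplus>\<^bsub>M\<^esub>b\<in>B. r \<odot>\<^bsub>M\<^esub> t (mpoly_const b) (Y b))"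
      unfolding y_def by (rule finsum_smult_ldistr[OF B(1) r]) (use Y in \<open>auto simp: t_closed\<close>)
    also have "\<dots> = (\<Oplus>\<^bsub>M\<^esub>b\<in>B. t (r * mpoly_const b) (Y b))"
      by (rule M.finsum_cong') (use Y r in \<open>auto simp: t_closed smult_t\<close>)
    finally show ?thesis .
  qed
  have ku: "keys (unif_monomial n q') \<subseteq> {..<n}" for q'
    by (rule keys_unif_monomial)
  show "\<exists>y\<in>carrier M. single (unif_monomial n (p * q + (p - 1))) 1 \<odot>\<^bsub>M\<^esub> y = s
    \<and> (\<forall>i<n. single (single i (Suc (p * q + (p - 1)))) 1 \<odot>\<^bsub>M\<^esub> y = \<zero>\<^bsub>M\<^esub>)"
  proof (intro bexI[OF _ y] conjI allI impI)
    \<comment> \<open>The part p q of the exponent crosses the tensor sign as q and turns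
      \<open>Y b\<close> into s_b; the part p - 1 restores the top monomial.\<close>
    have "unif_monomial n (p * q + (p - 1)) = top_monomial + monom_scale p (unif_monomial n q)"
      by (rule poly_mapping_eqI) (simp add: lookup_add)
    then have "t (single (unif_monomial n (p * q + (p - 1))) 1 * mpoly_const b) (Y b) = t (single top_monomial b) (E b top_monomial s)" for b
      using t_balanced[of "single top_monomial b" "single (unif_monomial n q) 1" "Y b"] Y(1,2)[of b] ku
      by (simp add: mult_single single_power mpoly_const_def)
    then show "single (unif_monomial n (p * q + (p - 1))) 1 \<odot>\<^bsub>M\<^esub> y = s"
      by (subst smult_y) (use ku B(2) in auto)
  next
    fix i assume i: "i < n"
    \<comment> \<open>The exponent p q + (p - 1) + 1 is p (q + 1), so this power crosses as
      x_i^(q+1) and kills \<open>Y b\<close>.\<close>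
    have "single i (Suc (p * q + (p - 1))) = monom_scale p (single i (Suc q))"
      by (rule poly_mapping_eqI) (use p_pos in \<open>simp add: lookup_single when_def\<close>)
    then have "t (single (single i (Suc (p * q + (p - 1)))) 1 * mpoly_const b) (Y b) = \<zero>\<^bsub>M\<^esub>" for b
      using t_balanced[of "mpoly_const b" "single (single i (Suc q)) 1" "Y b"] Y(1)[of b] Y(3)[OF i, of b] i
      by (simp add: mult_single single_power mpoly_const_def t_zero_right)
    then show "single (single i (Suc (p * q + (p - 1)))) 1 \<odot>\<^bsub>M\<^esub> y = \<zero>\<^bsub>M\<^esub>"
      by (subst smult_y) (use i in auto)
  qed
qed

lemma divisible_socle_unbounded: "\<exists>q\<ge>k. divisible_socle q"
proof (induction k)
  case 0
  then show ?case using divisible_socle_0 by blast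
next
  case (Suc k)
  then obtain q where q: "q \<ge> k" "divisible_socle q" by blast
  have "2 * q \<le> p * q"
    using p_ge_2 by (rule mult_le_mono1)
  with p_ge_2 q(1) have "p * q + (p - 1) \<ge> Suc k"
    by linarith
  with divisible_socle_step[OF q(2)] show ?case by blast
qed

text \<open>For q >= |a| the monomial x^a divides (x_1 ... x_n)^q; multiplying the element
  \<open>y\<close> for q by the cofactor x^b leaves a vector dual to x^a. Another monomial x^c of
  the same degree exceeds x^a in some exponent, so x^c x^b has an exponent above q there and kills
  \<open>y\<close>.\<close>

lemma socle_divide:
  assumes s: "s \<in> socle" and a: "keys a \<subseteq> {..<n}"
  shows "\<exists>y. y \<in> Mg (- int n - int (monom_degree a)) \<and> single a 1 \<odot>\<^bsub>M\<^esub> y = s \<and>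
    (\<forall>c. keys c \<subseteq> {..<n} \<longrightarrow> monom_degree c = monom_degree a \<longrightarrow> c \<noteq> a \<longrightarrow> single c 1 \<odot>\<^bsub>M\<^esub> y = \<zero>\<^bsub>M\<^esub>)"
proof -
  obtain q where q: "q \<ge> monom_degree a" "divisible_socle q"
    using divisible_socle_unbounded by blast
  obtain y where y: "y \<in> carrier M" "single (unif_monomial n q) 1 \<odot>\<^bsub>M\<^esub> y = s"
      "\<And>i. i < n \<Longrightarrow> single (single i (Suc q)) 1 \<odot>\<^bsub>M\<^esub> y = \<zero>\<^bsub>M\<^esub>"
    using q(2) s unfolding divisible_socle_def by blast
  have a_le: "lookup a i \<le> (if i < n then q else 0)" for i
  proof (cases "i < n")
    case True
    have "lookup a i \<le> (\<Sum>i<n. lookup a i)"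
      using True by (intro member_le_sum) auto
    also have "\<dots> = monom_degree a"
      using a by (intro monom_degree_eq_sum[symmetric]) auto
    finally show ?thesis using q(1) True by simp
  next
    case False
    then show ?thesis using a by (auto simp: in_keys_iff)
  qed
  then have "\<exists>b. unif_monomial n q = a + b"
    unfolding monomial_dvd_iff by simp
  then obtain b where b: "unif_monomial n q = a + b" by blast
  have kb: "keys b \<subseteq> {..<n}"
    using keys_unif_monomial[of n q] unfolding b keys_monomial_add by blast
  define z where "z = single b 1 \<odot>\<^bsub>M\<^esub> y"
  have z: "z \<in> carrier M"
    unfolding z_def using y kb by simp
  have mono_z: "single c 1 \<odot>\<^bsub>M\<^esub> z = single (c + b) 1 \<odot>\<^bsub>M\<^esub> y" if "keys c \<subseteq> {..<n}" for c
    using smult_assoc1[of "single c 1" "single b 1" y] that kb y(1) by (simp add: z_def mult_single)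
  have z_a: "single a 1 \<odot>\<^bsub>M\<^esub> z = s"
    using mono_z[OF a] y(2) b by simp
  have z_c: "single c 1 \<odot>\<^bsub>M\<^esub> z = \<zero>\<^bsub>M\<^esub>"
    if c: "keys c \<subseteq> {..<n}" "monom_degree c = monom_degree a" "c \<noteq> a" for c
  proof -
    \<comment> \<open>If no exponent of c exceeded that of a, equality of degrees would force c =
      a.\<close>
    have "\<exists>i<n. lookup a i < lookup c i"
    proof (rule ccontr)
      assume "\<not> ?thesis"
      then have le: "lookup c i \<le> lookup a i" if "i < n" for i
        using that by (meson not_le)
      have sum: "(\<Sum>i<n. lookup c i) = (\<Sum>i<n. lookup a i)"
        using c(2) monom_degree_eq_sum[OF c(1)] monom_degree_eq_sum[OF a] by simp
      have eq: "lookup c i = lookup a i" if "i < n" for i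
        using sum_mono_inv[OF sum, of i] le that by auto
      have "c = a"
      proof (rule poly_mapping_eqI)
        fix i show "lookup c i = lookup a i"
        proof (cases "i < n")
          case False
          then have "i \<notin> keys c" "i \<notin> keys a"
            using c(1) a by auto
          then show ?thesis by (simp add: in_keys_iff)
        qed (rule eq)
      qed
      with c(3) show False ..
    qed
    then obtain i where i: "i < n" "lookup a i < lookup c i" by blast
    have "Suc q \<le> lookup (c + b) i"
    proof -
      have "lookup a i + lookup b i = q"
        using i(1) lookup_unif_monomial[of n q i] unfolding b lookup_add by simp
      with i(2) show ?thesis by (simp add: lookup_add)
    qed
    then have "\<exists>d. c + b = single i (Suc q) + d"
      unfolding monomial_dvd_iff by (auto simp: lookup_single when_def)
    then obtain d where d: "c + b = single i (Suc q) + d" by blast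
    have "keys (c + b) \<subseteq> {..<n}"
      using c kb by (simp add: keys_monomial_add)
    then have kd: "keys d \<subseteq> {..<n}"
      unfolding d by (simp add: keys_monomial_add)
    have "single (c + b) 1 \<odot>\<^bsub>M\<^esub> y = single d 1 \<odot>\<^bsub>M\<^esub> (single (single i (Suc q)) 1 \<odot>\<^bsub>M\<^esub> y)"
      using smult_assoc1[of "single d 1" "single (single i (Suc q)) 1" y] y(1) i kd
      by (simp add: mult_single d add.commute[of d])
    with y(3)[OF i(1)] kd show ?thesis
      using mono_z[OF c(1)] smult_r_null[of "single d 1"] by simp
  qed
  \<comment> \<open>Passing to one component preserves both identities, since monomials are
    homogeneous and \<open>s\<close> lies in degree - n.\<close>
  have sm: "single c 1 \<odot>\<^bsub>M\<^esub> hcomp e z = hcomp (e + int (monom_degree c)) (single c 1 \<odot>\<^bsub>M\<^esub> z)"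
    if "keys c \<subseteq> {..<n}" for c e
    using hcomp_smult[OF single_mem_mpoly_grading[OF that] _ z, of 1 "e + int (monom_degree c)"] that
    by simp
  let ?e = "- int n - int (monom_degree a)"
  show ?thesis
  proof (intro exI[of _ "hcomp ?e z"] conjI allI impI)
    show "hcomp ?e z \<in> Mg ?e"
      by (rule hcomp_props(1)[OF z])
    show "single a 1 \<odot>\<^bsub>M\<^esub> hcomp ?e z = s"
      using sm[OF a, of ?e] z_a hcomp_homogeneous[OF socle_homogeneous[OF s]] by simp
    show "single c 1 \<odot>\<^bsub>M\<^esub> hcomp ?e z = \<zero>\<^bsub>M\<^esub>"
      if "keys c \<subseteq> {..<n}" "monom_degree c = monom_degree a" "c \<noteq> a" for c
      using sm[OF that(1), of ?e] z_c[OF that] hcomp_homogeneous[OF Mg_zero] by simp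
  qed
qed

end

section \<open>Coordinates on a subspace\<close>

context module
begin

text \<open>Evaluation on the free vector space over the whole type, with \<open>\<kappa>\<close>
  embedding the field in \<open>R\<close>. Generators outside the carrier are sent to zero, which
  makes the map total and linear.\<close>

definition lincomb :: "('k::field \<Rightarrow> 'a) \<Rightarrow> ('c \<Rightarrow>\<^sub>0 'k) \<Rightarrow> 'c" where
  "lincomb \<kappa> v = (\<Oplus>\<^bsub>M\<^esub>x\<in>keys v \<inter> carrier M. \<kappa> (lookup v x) \<odot>\<^bsub>M\<^esub> x)"

lemma lincomb_eq:
  fixes \<kappa> :: "'k::field \<Rightarrow> 'a"
  assumes \<kappa>: "\<And>c. \<kappa> c \<in> carrier R" "\<kappa> 0 = \<zero>\<^bsub>R\<^esub>"
    and A: "finite A" "A \<subseteq> carrier M" "keys v \<inter> carrier M \<subseteq> A"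
  shows "lincomb \<kappa> v = (\<Oplus>\<^bsub>M\<^esub>x\<in>A. \<kappa> (lookup v x) \<odot>\<^bsub>M\<^esub> x)"
  unfolding lincomb_def
  by (rule M.add.finprod_mono_neutral_cong_left[OF A(1,3)])
    (use A(2) \<kappa> in \<open>auto simp: in_keys_iff\<close>)

text \<open>The carrier of \<open>M\<close> is not a type, so the bases are chosen in the free vector space on the type of
  its elements, and the kernel of the evaluation map is split off.\<close>

lemma subspace_coordinates:
  fixes \<kappa> :: "'k::field \<Rightarrow> 'a"
  assumes \<kappa>_closed: "\<And>c. \<kappa> c \<in> carrier R" and \<kappa>_0: "\<kappa> 0 = \<zero>\<^bsub>R\<^esub>" and \<kappa>_1: "\<kappa> 1 = \<one>\<^bsub>R\<^esub>"
    and \<kappa>_add: "\<And>c d. \<kappa> (c + d) = \<kappa> c \<oplus>\<^bsub>R\<^esub> \<kappa> d"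
    and \<kappa>_mult: "\<And>c d. \<kappa> (c * d) = \<kappa> c \<otimes>\<^bsub>R\<^esub> \<kappa> d"
    and S: "S \<subseteq> carrier M" "\<zero>\<^bsub>M\<^esub> \<in> S" "\<And>x y. \<lbrakk>x \<in> S; y \<in> S\<rbrakk> \<Longrightarrow> x \<oplus>\<^bsub>M\<^esub> y \<in> S"
      "\<And>c x. x \<in> S \<Longrightarrow> \<kappa> c \<odot>\<^bsub>M\<^esub> x \<in> S"
  obtains I :: "'c set" and \<pi> :: "'c \<Rightarrow> 'c \<Rightarrow> 'k"
  where "I \<subseteq> S"
    and "\<And>i x y. \<lbrakk>i \<in> I; x \<in> carrier M; y \<in> carrier M\<rbrakk> \<Longrightarrow> \<pi> i (x \<oplus>\<^bsub>M\<^esub> y) = \<pi> i x + \<pi> i y"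
    and "\<And>i c x. \<lbrakk>i \<in> I; x \<in> carrier M\<rbrakk> \<Longrightarrow> \<pi> i (\<kappa> c \<odot>\<^bsub>M\<^esub> x) = c * \<pi> i x"
    and "\<And>x. x \<in> carrier M \<Longrightarrow> finite {i \<in> I. \<pi> i x \<noteq> 0}"
    and "\<And>i j. \<lbrakk>i \<in> I; j \<in> I\<rbrakk> \<Longrightarrow> \<pi> i j = (if i = j then 1 else 0)"
    and "\<And>s. \<lbrakk>s \<in> S; \<forall>i\<in>I. \<pi> i s = 0\<rbrakk> \<Longrightarrow> s = \<zero>\<^bsub>M\<^esub>"
proof -
  define scale :: "'k \<Rightarrow> ('c \<Rightarrow>\<^sub>0 'k) \<Rightarrow> 'c \<Rightarrow>\<^sub>0 'k" where "scale c v = Poly_Mapping.map ((*) c) v" for c v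
  have lookup_scale: "lookup (scale c v) x = c * lookup v x" for c v x
    unfolding scale_def by transfer (auto simp: when_def)
  interpret V: vector_space scale
    by unfold_locales (auto intro!: poly_mapping_eqI simp: lookup_scale lookup_add algebra_simps)
  let ?ev = "lincomb \<kappa>"
  have ev_eq: "?ev v = (\<Oplus>\<^bsub>M\<^esub>x\<in>A. \<kappa> (lookup v x) \<odot>\<^bsub>M\<^esub> x)"
    if "finite A" "A \<subseteq> carrier M" "keys v \<inter> carrier M \<subseteq> A" for A v
    by (rule lincomb_eq[where \<kappa> = \<kappa>]) (use \<kappa>_closed \<kappa>_0 that in auto)
  have ev_closed: "?ev v \<in> carrier M" for v
    unfolding lincomb_def by (rule M.finsum_closed) (auto simp: \<kappa>_closed)
  have ev_add: "?ev (v + w) = ?ev v \<oplus>\<^bsub>M\<^esub> ?ev w" for v w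
  proof -
    let ?A = "(keys v \<union> keys w) \<inter> carrier M"
    have "?ev (v + w) = (\<Oplus>\<^bsub>M\<^esub>x\<in>?A. \<kappa> (lookup (v + w) x) \<odot>\<^bsub>M\<^esub> x)"
      by (rule ev_eq) (use keys_add[of v w] in auto)
    also have "\<dots> = (\<Oplus>\<^bsub>M\<^esub>x\<in>?A. \<kappa> (lookup v x) \<odot>\<^bsub>M\<^esub> x \<oplus>\<^bsub>M\<^esub> \<kappa> (lookup w x) \<odot>\<^bsub>M\<^esub> x)"
      by (rule M.finsum_cong') (auto simp: \<kappa>_closed lookup_add \<kappa>_add smult_l_distr)
    also have "\<dots> = (\<Oplus>\<^bsub>M\<^esub>x\<in>?A. \<kappa> (lookup v x) \<odot>\<^bsub>M\<^esub> x) \<oplus>\<^bsub>M\<^esub> (\<Oplus>\<^bsub>M\<^esub>x\<in>?A. \<kappa> (lookup w x) \<odot>\<^bsub>M\<^esub> x)"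
      by (rule M.finsum_addf) (auto simp: \<kappa>_closed)
    also have "\<dots> = ?ev v \<oplus>\<^bsub>M\<^esub> ?ev w"
      by (subst (1 2) ev_eq[of ?A]) auto
    finally show ?thesis .
  qed
  have ev_scale: "?ev (scale c v) = \<kappa> c \<odot>\<^bsub>M\<^esub> ?ev v" for c v
  proof -
    let ?A = "keys v \<inter> carrier M"
    have "?ev (scale c v) = (\<Oplus>\<^bsub>M\<^esub>x\<in>?A. \<kappa> (lookup (scale c v) x) \<odot>\<^bsub>M\<^esub> x)"
      by (rule ev_eq) (auto simp: in_keys_iff lookup_scale)
    also have "\<dots> = (\<Oplus>\<^bsub>M\<^esub>x\<in>?A. \<kappa> c \<odot>\<^bsub>M\<^esub> (\<kappa> (lookup v x) \<odot>\<^bsub>M\<^esub> x))"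
      by (rule M.finsum_cong') (auto simp: \<kappa>_closed lookup_scale \<kappa>_mult smult_assoc1)
    also have "\<dots> = \<kappa> c \<odot>\<^bsub>M\<^esub> ?ev v"
      unfolding lincomb_def by (rule finsum_smult_ldistr[symmetric]) (auto simp: \<kappa>_closed)
    finally show ?thesis .
  qed
  have ev_single: "?ev (single x 1) = x" if "x \<in> carrier M" for x
    using that ev_eq[of "{x}" "single x 1"] by (simp add: \<kappa>_1)
  have ev_0: "?ev 0 = \<zero>\<^bsub>M\<^esub>"
    by (simp add: lincomb_def)
  have ev_diff: "?ev (v - w) = ?ev v \<ominus>\<^bsub>M\<^esub> ?ev w" for v w
  proof -
    have "?ev v = ?ev (v - w) \<oplus>\<^bsub>M\<^esub> ?ev w"
      using ev_add[of "v - w" w] by simp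
    then show ?thesis
      using ev_closed by (metis M.add.inv_solve_right a_minus_def)
  qed
  \<comment> \<open>\<open>B0\<close>, \<open>B1\<close> and \<open>B2\<close> will be nested bases
    of the kernel, of the preimage of \<open>S\<close> and of the whole space. Then
    \<open>B1 - B0\<close> evaluates to a basis of \<open>S\<close>, and coordinates along it, zero
    on the rest of \<open>B2\<close>, give functionals on all of \<open>M\<close>.\<close>
  define K T where "K = {v. ?ev v = \<zero>\<^bsub>M\<^esub>}" and "T = {v. ?ev v \<in> S}"
  have K: "V.subspace K"
    unfolding K_def by (rule V.subspaceI) (auto simp: ev_0 ev_add ev_scale \<kappa>_closed)
  obtain B0 where B0: "B0 \<subseteq> K" "V.independent B0" "K \<subseteq> V.span B0"
    using V.maximal_independent_subset by blast
  have "K \<subseteq> T"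
    using S(2) by (auto simp: K_def T_def)
  with B0(1) have "B0 \<subseteq> T" by (rule order_trans)
  obtain B1 where B1: "B0 \<subseteq> B1" "B1 \<subseteq> T" "V.independent B1" "T \<subseteq> V.span B1"
    by (rule V.maximal_independent_subset_extend[OF \<open>B0 \<subseteq> T\<close> B0(2)])
  obtain B2 where B2: "B1 \<subseteq> B2" "V.independent B2" "UNIV \<subseteq> V.span B2"
    by (rule V.maximal_independent_subset_extend[OF subset_UNIV B1(3)])
  have span_B2: "v \<in> V.span B2" for v
    using B2(3) by blast
  let ?rep = "V.representation B2"
  have rep_K: "?rep v b = 0" if "v \<in> K" "b \<notin> B0" for v b
  proof -
    have "?rep v = V.representation B0 v"
      using that B0(3) B1(1) B2 by (intro V.representation_extend) auto
    then show ?thesis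
      using V.representation_ne_zero[of B0 v b] that by auto
  qed
  \<comment> \<open>A coordinate outside \<open>B0\<close> does not see the kernel, so it depends
    only on the evaluated element.\<close>
  have rep_eq: "?rep v b = ?rep w b" if "?ev v = ?ev w" "b \<notin> B0" for v w b
  proof -
    have "v - w \<in> K"
      using that(1) ev_closed[of w] by (simp add: K_def ev_diff M.r_neg a_minus_def)
    then have "?rep (v - w) b = 0"
      by (rule rep_K[OF _ that(2)])
    then show ?thesis
      using V.representation_diff[OF B2(2) span_B2 span_B2, of v w] by simp
  qed
  have inj: "inj_on ?ev (B1 - B0)"
  proof (rule inj_onI)
    fix b b' assume b: "b \<in> B1 - B0" "b' \<in> B1 - B0" "?ev b = ?ev b'"
    then have "?rep b b = ?rep b' b"
      by (intro rep_eq) auto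
    moreover have "?rep b b = 1" "?rep b' b = (if b = b' then 1 else 0)"
      using b B2(1) V.representation_basis[OF B2(2)] by auto
    ultimately show "b = b'" by (auto split: if_splits)
  qed
  define I where "I = ?ev ` (B1 - B0)"
  define \<beta> where "\<beta> = inv_into (B1 - B0) ?ev"
  \<comment> \<open>\<open>single x 1\<close> is one preimage of \<open>x\<close> in the carrier; by
    \<open>rep_eq\<close> every other preimage gives the same value.\<close>
  define \<pi> where "\<pi> i x = ?rep (single x 1) (\<beta> i)" for i x
  have \<beta>: "\<beta> i \<in> B1 - B0" "?ev (\<beta> i) = i" if "i \<in> I" for i
    using that inv_into_into[of i ?ev "B1 - B0"] f_inv_into_f[of i ?ev "B1 - B0"]
    by (auto simp: I_def \<beta>_def)
  have \<beta>_ev: "\<beta> (?ev b) = b" if "b \<in> B1 - B0" for b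
    using that inj by (simp add: \<beta>_def)
  have \<pi>_ev: "\<pi> i (?ev v) = ?rep v (\<beta> i)" if "i \<in> I" for i v
    unfolding \<pi>_def using \<beta>(1)[OF that] by (intro rep_eq) (auto simp: ev_single ev_closed)
  show thesis
  proof (rule that[of I \<pi>])
    show "I \<subseteq> S"
      using B1(2) by (auto simp: I_def T_def)
    show "\<pi> i (x \<oplus>\<^bsub>M\<^esub> y) = \<pi> i x + \<pi> i y" if "i \<in> I" "x \<in> carrier M" "y \<in> carrier M" for i x y
      using \<pi>_ev[OF that(1), of "single x 1 + single y 1"] that(2,3)
        V.representation_add[OF B2(2) span_B2 span_B2, of "single x 1" "single y 1"]
      by (simp add: ev_add ev_single \<pi>_def)
    show "\<pi> i (\<kappa> c \<odot>\<^bsub>M\<^esub> x) = c * \<pi> i x" if "i \<in> I" "x \<in> carrier M" for i c x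
      using \<pi>_ev[OF that(1), of "scale c (single x 1)"] that(2)
        V.representation_scale[OF B2(2) span_B2, of c "single x 1"]
      by (simp add: ev_scale ev_single \<pi>_def)
    show "finite {i \<in> I. \<pi> i x \<noteq> 0}" if "x \<in> carrier M" for x
    proof (rule finite_subset)
      show "{i \<in> I. \<pi> i x \<noteq> 0} \<subseteq> ?ev ` {b. ?rep (single x 1) b \<noteq> 0}"
        using \<beta>(2) by (force simp: \<pi>_def image_iff)
      show "finite (?ev ` {b. ?rep (single x 1) b \<noteq> 0})"
        by (intro finite_imageI V.finite_representation)
    qed
    show "\<pi> i j = (if i = j then 1 else 0)" if "i \<in> I" "j \<in> I" for i j
    proof -
      have "\<pi> i j = ?rep (\<beta> j) (\<beta> i)"
        using \<pi>_ev[OF that(1), of "\<beta> j"] \<beta>(2)[OF that(2)] by simp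
      also have "\<dots> = (if \<beta> i = \<beta> j then 1 else 0)"
        using V.representation_basis[OF B2(2), of "\<beta> j"] \<beta>(1)[OF that(2)] B2(1) by auto
      also have "\<beta> i = \<beta> j \<longleftrightarrow> i = j"
        using \<beta>(2)[OF that(1)] \<beta>(2)[OF that(2)] by metis
      finally show ?thesis .
    qed
    show "s = \<zero>\<^bsub>M\<^esub>" if s: "s \<in> S" and zero: "\<forall>i\<in>I. \<pi> i s = 0" for s
    proof -
      let ?v = "single s 1"
      have ev_s: "?ev ?v = s"
        using s S(1) by (intro ev_single) auto
      have "?v \<in> V.span B1"
        using B1(4) s ev_s by (auto simp: T_def)
      then have "?rep ?v = V.representation B1 ?v"
        using B2 by (intro V.representation_extend) auto
      then have rep_B1: "b \<in> B1" if "?rep ?v b \<noteq> 0" for b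
        using that V.representation_ne_zero[of B1 ?v b] by simp
      \<comment> \<open>Coordinates outside \<open>B1\<close> vanish because \<open>?v\<close> lies
        in its span, and those in \<open>B1 - B0\<close> are values of \<open>\<pi>\<close>. What is
        left lies in the kernel.\<close>
      have rep_B0: "b \<in> B0" if b: "?rep ?v b \<noteq> 0" for b
      proof (rule ccontr)
        assume "b \<notin> B0"
        with rep_B1[OF b] have b': "b \<in> B1 - B0" by blast
        then have "\<pi> (?ev b) s = 0"
          by (intro bspec[OF zero]) (simp add: I_def)
        with b \<beta>_ev[OF b'] show False
          by (simp add: \<pi>_def)
      qed
      have "?v = (\<Sum>b | ?rep ?v b \<noteq> 0. scale (?rep ?v b) b)"
        using V.sum_nonzero_representation_eq[OF B2(2) span_B2] by simp
      also have "\<dots> \<in> K"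
        by (intro V.subspace_sum[OF K] V.subspace_scale[OF K]) (use rep_B0 B0(1) in auto)
      finally show ?thesis
        using ev_s by (simp add: K_def)
    qed
  qed
qed

end

section \<open>Support and torsion\<close>

text \<open>Krull's argument: an ideal maximal among those containing \<open>I\<close> and avoiding
  all powers of \<open>f\<close> is prime.\<close>

lemma (in cring) exists_prime_avoiding_powers:
  assumes I: "ideal I R" and f: "f \<in> carrier R" and pow: "\<And>q::nat. f [^] q \<notin> I"
  obtains P where "primeideal P R" "I \<subseteq> P" "f \<notin> P"
proof -
  define A where "A = {J. ideal J R \<and> I \<subseteq> J \<and> (\<forall>q::nat. f [^] q \<notin> J)}"
  have "\<exists>P\<in>A. \<forall>J\<in>A. P \<subseteq> J \<longrightarrow> J = P"
  proof (rule subset_Zorn_nonempty)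
    show "A \<noteq> {}"
      using I pow by (auto simp: A_def)
    show "\<Union>C \<in> A" if C: "C \<noteq> {}" "subset.chain A C" for C
    proof -
      have sub: "C \<subseteq> A"
        using C(2) by (auto simp: subset.chain_def)
      have "subset.chain {J. ideal J R} C"
        using C(2) by (auto simp: subset.chain_def A_def)
      from chain_Union_is_ideal[OF this] C(1) have "ideal (\<Union>C) R"
        by simp
      then show ?thesis
        using C(1) sub unfolding A_def by auto
    qed
  qed
  then obtain P where P_A: "P \<in> A" and P_max: "\<And>J. J \<in> A \<Longrightarrow> P \<subseteq> J \<Longrightarrow> J = P"
    by auto
  from P_A have P: "ideal P R" "I \<subseteq> P" "f [^] q \<notin> P" for q :: nat
    by (auto simp: A_def)
  interpret P: ideal P R by fact
  \<comment> \<open>By maximality, adjoining an element outside \<open>P\<close> captures a power of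
    \<open>f\<close>.\<close>
  have ex: "\<exists>(q::nat) u r. u \<in> P \<and> r \<in> carrier R \<and> f [^] q = u \<oplus> r \<otimes> a"
    if a: "a \<in> carrier R" "a \<notin> P" for a
  proof -
    let ?J = "P <+>\<^bsub>R\<^esub> PIdl a"
    have J: "ideal ?J R"
      by (intro add_ideals P cgenideal_ideal a)
    have mem: "x \<in> ?J \<longleftrightarrow> (\<exists>u\<in>P. \<exists>r\<in>carrier R. x = u \<oplus> r \<otimes> a)" for x
      by (auto simp: set_add_def' cgenideal_def)
    have sub: "P \<subseteq> ?J"
    proof
      fix u assume "u \<in> P"
      then show "u \<in> ?J"
        unfolding mem using a P.Icarr by (intro bexI[of _ u] bexI[of _ "\<zero>"]) auto
    qed
    have "a \<in> ?J"
      unfolding mem using a P.zero_closed by (intro bexI[of _ "\<zero>"] bexI[of _ "\<one>"]) auto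
    with a(2) have "?J \<noteq> P" by blast
    then have "\<exists>q::nat. f [^] q \<in> ?J"
      using P_max[OF _ sub] J P(2) sub by (auto simp: A_def)
    then show ?thesis
      unfolding mem by blast
  qed
  have "primeideal P R"
  proof (rule primeidealI[OF P(1) is_cring])
    show "carrier R \<noteq> P"
      using P(3)[of 0] by auto
    show "a \<in> P \<or> b \<in> P" if ab: "a \<in> carrier R" "b \<in> carrier R" "a \<otimes> b \<in> P" for a b
    proof (rule ccontr)
      assume "\<not> ?thesis"
      then obtain q q' :: nat and u v r s where
        *: "u \<in> P" "r \<in> carrier R" "f [^] q = u \<oplus> r \<otimes> a" "v \<in> P" "s \<in> carrier R" "f [^] q' = v \<oplus> s \<otimes> b"
        using ex[OF ab(1)] ex[OF ab(2)] by blast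
      have uv: "u \<in> carrier R" "v \<in> carrier R"
        using * P.Icarr by auto
      \<comment> \<open>Multiplied out, every summand has a factor in \<open>P\<close>.\<close>
      have "f [^] (q + q') = (u \<oplus> r \<otimes> a) \<otimes> (v \<oplus> s \<otimes> b)"
        using * f by (simp flip: nat_pow_mult)
      also have "\<dots> = (v \<oplus> s \<otimes> b) \<otimes> u \<oplus> (r \<otimes> a) \<otimes> v \<oplus> (r \<otimes> s) \<otimes> (a \<otimes> b)"
        using * uv ab by algebra
      also have "\<dots> \<in> P"
        using * uv ab P.I_l_closed[OF *(1), of "v \<oplus> s \<otimes> b"] P.I_l_closed[OF *(4), of "r \<otimes> a"]
          P.I_l_closed[OF ab(3), of "r \<otimes> s"]
        by (intro P.a_closed) auto
      finally show False using P(3) by blast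
    qed
  qed
  moreover have "f \<notin> P"
    using P(3)[of 1] f by simp
  ultimately show thesis
    using that P(2) by blast
qed

text \<open>A prime that contains the annihilator of \<open>x\<close> and avoids \<open>f\<close>
  exists, and x/1 is nonzero in the localization there.\<close>

lemma (in module) support_avoiding:
  assumes x: "x \<in> carrier M" and f: "f \<in> carrier R"
    and pow: "\<And>q::nat. (f [^] q) \<odot>\<^bsub>M\<^esub> x \<noteq> \<zero>\<^bsub>M\<^esub>"
  shows "\<exists>P\<in>module_support R M. f \<notin> P"
proof -
  let ?I = "{a \<in> carrier R. a \<odot>\<^bsub>M\<^esub> x = \<zero>\<^bsub>M\<^esub>}"
  have "ideal ?I R"
  proof (rule idealI[OF R.ring_axioms])
    show "subgroup ?I (add_monoid R)"
      using x by (intro R.add.subgroupI)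
        (auto simp: smult_l_distr smult_l_minus simp flip: a_inv_def intro: exI[of _ "\<zero>"])
    show "b \<otimes> a \<in> ?I" "a \<otimes> b \<in> ?I" if "a \<in> ?I" "b \<in> carrier R" for a b
      using that x by (auto simp: smult_assoc1 R.m_comm[of a b])
  qed
  then obtain P where P: "primeideal P R" "?I \<subseteq> P" "f \<notin> P"
    using R.exists_prime_avoiding_powers[of ?I f] f pow by blast
  interpret P: primeideal P R by fact
  have one: "\<one> \<in> carrier R - P"
    using P.I_notcarr P.one_imp_carrier by auto
  \<comment> \<open>Otherwise x/1 = 0/1, so some element outside \<open>P\<close> would annihilate
    \<open>x\<close>.\<close>
  have "localization R M P \<noteq> {localization_zero R M P}"
  proof
    assume loc: "localization R M P = {localization_zero R M P}"
    have "fraction_rel R M P `` {(x, \<one>)} \<in> localization R M P"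
      unfolding localization_def using x one by (auto intro!: quotientI)
    with loc have "fraction_rel R M P `` {(x, \<one>)} = fraction_rel R M P `` {(\<zero>\<^bsub>M\<^esub>, \<one>)}"
      by (simp add: localization_zero_def)
    moreover have "((x, \<one>), (x, \<one>)) \<in> fraction_rel R M P"
      using x one by (auto simp: fraction_rel_def)
    ultimately have "((\<zero>\<^bsub>M\<^esub>, \<one>), (x, \<one>)) \<in> fraction_rel R M P"
      by blast
    then obtain u where "u \<in> carrier R - P" "u \<odot>\<^bsub>M\<^esub> (\<one> \<odot>\<^bsub>M\<^esub> \<zero>\<^bsub>M\<^esub>) = u \<odot>\<^bsub>M\<^esub> (\<one> \<odot>\<^bsub>M\<^esub> x)"
      by (auto simp: fraction_rel_def)
    then show False
      using P(2) x by auto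
  qed
  with P show ?thesis
    by (auto simp: module_support_def)
qed

text \<open>If no power of a variable killed \<open>x\<close>, some prime of the support would avoid
  that variable, yet it lies in the only candidate.\<close>

lemma torsion_of_support:
  assumes "module (mpoly_ring n) (M :: ('k::field mpoly, 'm) module)"
    and supp: "module_support (mpoly_ring n) M \<subseteq> {irrelevant_ideal n}"
    and x: "x \<in> carrier M" and i: "i < n"
  shows "\<exists>q. (mpoly_var i ^ q) \<odot>\<^bsub>M\<^esub> x = \<zero>\<^bsub>M\<^esub>"
proof (rule ccontr)
  assume neg: "\<not> ?thesis"
  interpret module "mpoly_ring n" M by fact
  have vars: "mpoly_var ` {..<n} \<subseteq> carrier (mpoly_ring n :: 'k mpoly ring)"
    by (auto simp: mpoly_var_def split: if_splits)
  with i have var: "mpoly_var i \<in> carrier (mpoly_ring n :: 'k mpoly ring)"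
    by auto
  obtain P where "P \<in> module_support (mpoly_ring n) M" "mpoly_var i \<notin> P"
    using support_avoiding[OF x var] neg by auto
  with supp have "mpoly_var i \<notin> (irrelevant_ideal n :: 'k mpoly set)"
    by auto
  with R.genideal_self[OF vars] i show False
    by (auto simp: irrelevant_ideal_def)
qed

section \<open>The structure morphism\<close>

text \<open>\<open>t r x\<close> is the image of the tensor under the inverse \<open>\<eta>\<close>
  of the structure morphism. Beyond this lemma the tensor cosets no longer appear.\<close>

lemma graded_F_module_imp_frob_graded_module:
  fixes M :: "('k::field mpoly, 'm) module"
  assumes char: "CHAR('k) = p" and p: "p > 0"
    and F: "graded_F_module p (mpoly_ring n) (mpoly_grading n) M Mg \<theta>"
  shows "\<exists>t. frob_graded_module n M Mg p t"
proof -
  let ?R = "mpoly_ring n :: 'k mpoly ring"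
  let ?\<phi> = "\<lambda>r. r [^]\<^bsub>?R\<^esub> p"
  let ?T = "base_change ?R ?R ?\<phi> M"
  let ?tn = "tensor ?R ?R ?\<phi> M"
  interpret graded_module ?R "mpoly_grading n" M Mg
    using F by (simp add: graded_F_module_def)
  interpret B: base_change_module ?R M ?R ?\<phi>
    by (intro base_change_module.intro base_change_module_axioms.intro module_axioms cring_mpoly_ring)
      simp
  \<comment> \<open>Keeps the Frobenius in the form \<open>r [^] p\<close> that it has inside the
    tensor construction.\<close>
  note mpoly_ring_pow [simp del]
  interpret T: comm_group "add_monoid ?T"
    by (rule B.comm_group_TM)
  have iso: "bij_betw \<theta> (carrier M) (carrier ?T)"
      "\<And>x y. \<lbrakk>x \<in> carrier M; y \<in> carrier M\<rbrakk> \<Longrightarrow> \<theta> (x \<oplus>\<^bsub>M\<^esub> y) = \<theta> x \<oplus>\<^bsub>?T\<^esub> \<theta> y"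
      "\<And>r x. \<lbrakk>r \<in> carrier ?R; x \<in> carrier M\<rbrakk> \<Longrightarrow> \<theta> (r \<odot>\<^bsub>M\<^esub> x) = r \<odot>\<^bsub>?T\<^esub> \<theta> x"
    using F by (auto simp: graded_F_module_def F_module_def module_iso_def frobenius_def)
  define \<eta> where "\<eta> = inv_into (carrier M) \<theta>"
  have \<eta>_closed: "\<eta> A \<in> carrier M" and \<theta>_\<eta>: "\<theta> (\<eta> A) = A" if "A \<in> carrier ?T" for A
    using that iso(1) inv_into_into[of A \<theta> "carrier M"] f_inv_into_f[of A \<theta> "carrier M"]
    by (auto simp: \<eta>_def bij_betw_def)
  have \<eta>_\<theta>: "\<eta> (\<theta> x) = x" if "x \<in> carrier M" for x
    using that iso(1) by (auto simp: \<eta>_def bij_betw_def)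
  have \<theta>_closed: "\<theta> x \<in> carrier ?T" if "x \<in> carrier M" for x
    using that iso(1) by (auto simp: bij_betw_def)
  have \<eta>_add: "\<eta> (A \<oplus>\<^bsub>?T\<^esub> C) = \<eta> A \<oplus>\<^bsub>M\<^esub> \<eta> C" if "A \<in> carrier ?T" "C \<in> carrier ?T" for A C
    using \<eta>_\<theta>[of "\<eta> A \<oplus>\<^bsub>M\<^esub> \<eta> C"] iso(2)[of "\<eta> A" "\<eta> C"] that by (simp add: \<eta>_closed \<theta>_\<eta>)
  have \<eta>_hom: "\<eta> \<in> hom (add_monoid ?T) (add_monoid M)"
    by (auto simp: hom_def \<eta>_closed \<eta>_add)
  have \<theta>_hom: "\<theta> \<in> hom (add_monoid M) (add_monoid ?T)"
    by (auto simp: hom_def \<theta>_closed iso(2))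
  define t where "t r x = \<eta> (?tn r x)" for r x
  have "frob_graded_module n M Mg p t"
  proof (intro frob_graded_module.intro frob_graded_module_axioms.intro graded_module_axioms char p)
    show "t r x \<in> carrier M" if "r \<in> carrier ?R" "x \<in> carrier M" for r x
      using that by (simp add: t_def \<eta>_closed B.tensor_closed)
    show "t (r + s) x = t r x \<oplus>\<^bsub>M\<^esub> t s x"
      if "r \<in> carrier ?R" "s \<in> carrier ?R" "x \<in> carrier M" for r s x
      using B.tensor_add_left[OF that] that by (simp add: t_def \<eta>_add B.tensor_closed)
    show "t r (x \<oplus>\<^bsub>M\<^esub> y) = t r x \<oplus>\<^bsub>M\<^esub> t r y"
      if "r \<in> carrier ?R" "x \<in> carrier M" "y \<in> carrier M" for r x y
      using that by (simp add: t_def \<eta>_add B.tensor_closed B.tensor_add_right)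
    show "t (r * a ^ p) x = t r (a \<odot>\<^bsub>M\<^esub> x)"
      if "r \<in> carrier ?R" "a \<in> carrier ?R" "x \<in> carrier M" for r a x
      using B.tensor_balanced[OF that] by (simp add: t_def mpoly_ring_pow)
    show "r \<odot>\<^bsub>M\<^esub> t s x = t (r * s) x"
      if "r \<in> carrier ?R" "s \<in> carrier ?R" "x \<in> carrier M" for r s x
    proof -
      have "\<theta> (r \<odot>\<^bsub>M\<^esub> t s x) = ?tn (r * s) x"
        using that B.smult_tensor[OF that] by (simp add: t_def iso(3) \<eta>_closed \<theta>_\<eta> B.tensor_closed)
      then show ?thesis
        using that \<eta>_\<theta>[of "r \<odot>\<^bsub>M\<^esub> t s x"] by (simp add: t_def \<eta>_closed B.tensor_closed)
    qed
    show "\<exists>G\<in>hom (add_monoid M) (add_monoid M). \<forall>r\<in>carrier ?R. \<forall>x\<in>carrier M. G (t r x) = g r x"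
      if g: "\<And>r x. \<lbrakk>r \<in> carrier ?R; x \<in> carrier M\<rbrakk> \<Longrightarrow> g r x \<in> carrier M"
        "\<And>r s x. \<lbrakk>r \<in> carrier ?R; s \<in> carrier ?R; x \<in> carrier M\<rbrakk> \<Longrightarrow> g (r + s) x = g r x \<oplus>\<^bsub>M\<^esub> g s x"
        "\<And>r x y. \<lbrakk>r \<in> carrier ?R; x \<in> carrier M; y \<in> carrier M\<rbrakk> \<Longrightarrow> g r (x \<oplus>\<^bsub>M\<^esub> y) = g r x \<oplus>\<^bsub>M\<^esub> g r y"
        "\<And>r a x. \<lbrakk>r \<in> carrier ?R; a \<in> carrier ?R; x \<in> carrier M\<rbrakk> \<Longrightarrow> g (r * a ^ p) x = g r (a \<odot>\<^bsub>M\<^esub> x)"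
      for g
    proof -
      obtain G where G: "G \<in> hom (add_monoid ?T) (add_monoid M)"
        "\<And>r x. \<lbrakk>r \<in> carrier ?R; x \<in> carrier M\<rbrakk> \<Longrightarrow> G (?tn r x) = g r x"
      proof (rule B.tensor_universal[of "add_monoid M" g])
        show "comm_group (add_monoid M)" by (rule M.a_comm_group)
      qed (use g in \<open>auto simp: mpoly_ring_pow\<close>)
      show ?thesis
      \<comment> \<open>Composing with \<open>\<theta>\<close> undoes the \<open>\<eta>\<close> in
        \<open>t\<close>, so \<open>G\<close> on tensors becomes a map on \<open>M\<close>.\<close>
      proof (intro bexI ballI)
        show "G \<circ> \<theta> \<in> hom (add_monoid M) (add_monoid M)"
          by (rule hom_compose[OF \<theta>_hom G(1)])
        show "(G \<circ> \<theta>) (t r x) = g r x" if "r \<in> carrier ?R" "x \<in> carrier M" for r x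
          using that G(2) by (simp add: t_def \<theta>_\<eta> B.tensor_closed)
      qed
    qed
    show "y \<in> generate (add_monoid M) {t r x |r x i j. r \<in> mpoly_grading n i \<and> x \<in> Mg j \<and> i + int p * j = d}"
      (is "_ \<in> generate _ ?Z") if y: "y \<in> Mg d" for y d
    proof -
      \<comment> \<open>\<open>\<eta>\<close> carries a generated subgroup to the subgroup generated
        by the images, which transports the grading of F(M).\<close>
      let ?Z' = "{?tn r x |r x i j. r \<in> mpoly_grading n i \<and> x \<in> Mg j \<and> i + int p * j = d}"
      have "?Z' \<subseteq> carrier ?T"
        by (auto dest!: subsetD[OF mpoly_grading_subset] Mg_closed intro!: B.tensor_closed)
      moreover have "group_hom (add_monoid ?T) (add_monoid M) \<eta>"
        using \<eta>_hom by (intro group_hom.intro group_hom_axioms.intro T.is_group M.add.is_group)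
      ultimately have gen: "generate (add_monoid M) (\<eta> ` ?Z') = \<eta> ` generate (add_monoid ?T) ?Z'"
        using group_hom.generate_img[of "add_monoid ?T" "add_monoid M" \<eta> ?Z'] by simp
      have img: "\<eta> ` ?Z' = ?Z"
        unfolding t_def by blast
      have mem: "\<theta> y \<in> generate (add_monoid ?T) ?Z'"
        using F y by (auto simp: graded_F_module_def degree_preserving_def frobenius_grading_def frobenius_def)
      have "\<eta> (\<theta> y) \<in> generate (add_monoid M) ?Z"
        using imageI[OF mem, of \<eta>] unfolding gen[symmetric] img .
      then show ?thesis
        unfolding \<eta>_\<theta>[OF Mg_closed[OF y]] .
    qed
  qed
  then show ?thesis by (rule exI[of _ t])
qed

section \<open>Functionals\<close>

text \<open>All exponents are below \<open>N\<close>, so these monomials embed in a finite function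
  space.\<close>

lemma finite_monomials_degree_less: "finite {m. keys m \<subseteq> {..<n} \<and> monom_degree m < N}"
proof (rule finite_imageD)
  let ?f = "\<lambda>m. restrict (lookup m) {..<n}"
  have "lookup m i < N" if "keys m \<subseteq> {..<n}" "monom_degree m < N" "i < n" for m i
  proof -
    have "lookup m i \<le> (\<Sum>i<n. lookup m i)"
      using that by (intro member_le_sum) auto
    with that monom_degree_eq_sum[OF that(1)] show ?thesis by simp
  qed
  then have "?f ` {m. keys m \<subseteq> {..<n} \<and> monom_degree m < N} \<subseteq> {..<n} \<rightarrow>\<^sub>E {..<N}"
    by (auto split: if_splits)
  then show "finite (?f ` {m. keys m \<subseteq> {..<n} \<and> monom_degree m < N})"
    by (rule finite_subset) (auto intro: finite_PiE)
  show "inj_on ?f {m. keys m \<subseteq> {..<n} \<and> monom_degree m < N}"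
  proof (rule inj_onI)
    fix m m' assume m: "m \<in> {m. keys m \<subseteq> {..<n} \<and> monom_degree m < N}"
      "m' \<in> {m. keys m \<subseteq> {..<n} \<and> monom_degree m < N}" and eq: "?f m = ?f m'"
    show "m = m'"
    proof (rule poly_mapping_eqI)
      fix i show "lookup m i = lookup m' i"
      proof (cases "i < n")
        case True
        then show ?thesis using fun_cong[OF eq, of i] by simp
      next
        case False
        then have "i \<notin> keys m" "i \<notin> keys m'" using m by auto
        then show ?thesis by (simp add: in_keys_iff)
      qed
    qed
  qed
qed

lemma functional_add:
  "\<lbrakk>\<phi> \<in> functionals n; f \<in> carrier (mpoly_ring n); g \<in> carrier (mpoly_ring n)\<rbrakk> \<Longrightarrow> \<phi> (f + g) = \<phi> f + \<phi> g"
  by (simp add: functionals_def)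

lemma functional_single:
  assumes "\<phi> \<in> functionals n" "keys m \<subseteq> {..<n}"
  shows "\<phi> (single m c) = c * \<phi> (single m 1)"
proof -
  have "\<phi> (mpoly_const c * single m 1) = c * \<phi> (single m 1)"
    using assms by (auto simp: functionals_def)
  then show ?thesis by (simp add: mpoly_const_def mult_single)
qed

lemma functional_eq_0:
  assumes \<phi>: "\<phi> \<in> functionals n" and f: "f \<in> carrier (mpoly_ring n)"
    and zero: "\<And>m. m \<in> keys f \<Longrightarrow> \<phi> (single m 1) = 0"
  shows "\<phi> f = 0"
proof -
  have keys: "keys m \<subseteq> {..<n}" if "m \<in> keys f" for m
    using f that by (auto simp: mem_mpoly_ring)
  have \<phi>_0: "\<phi> 0 = 0"
    using functional_single[OF \<phi>, of 0 0] by simp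
  have "\<phi> (\<Sum>m\<in>A. single m (lookup f m)) = 0 \<and> (\<Sum>m\<in>A. single m (lookup f m)) \<in> carrier (mpoly_ring n)"
    if "finite A" "A \<subseteq> keys f" for A
    using that
  proof (induction A)
    case (insert m A)
    then show ?case
      using keys[of m] zero[of m] functional_single[OF \<phi>, of m "lookup f m"]
      by (simp add: functional_add[OF \<phi>] mpoly_ring_closed)
  qed (use \<phi>_0 in auto)
  from this[of "keys f"] have "\<phi> (\<Sum>m\<in>keys f. single m (lookup f m)) = 0"
    by simp
  moreover have "(\<Sum>m\<in>keys f. single m (lookup f m)) = f"
    by (rule poly_mapping_eqI)
      (auto simp: lookup_sum lookup_single when_def in_keys_iff)
  ultimately show ?thesis by simp
qed

lemma functionals_eqI:
  assumes \<phi>: "\<phi> \<in> functionals n" and \<psi>: "\<psi> \<in> functionals n"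
    and eq: "\<And>m. keys m \<subseteq> {..<n} \<Longrightarrow> \<phi> (single m 1) = \<psi> (single m 1)"
  shows "\<phi> = \<psi>"
proof
  fix f
  show "\<phi> f = \<psi> f"
  proof (cases "f \<in> carrier (mpoly_ring n)")
    case True
    then show ?thesis
    proof (induction rule: mpoly_induct)
      case zero
      show ?case using functional_single[OF \<phi>, of 0 0] functional_single[OF \<psi>, of 0 0] by simp
    next
      case (single k c)
      then show ?case
        using functional_single[OF \<phi> single, of c] functional_single[OF \<psi> single, of c] eq[OF single]
        by simp
    next
      case (add f g)
      then show ?case by (simp add: functional_add[OF \<phi>] functional_add[OF \<psi>])
    qed
  next
    case False
    then show ?thesis using \<phi> \<psi> by (simp add: functionals_def)
  qed
qed

section \<open>The injective hull and direct sums of its copies\<close>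

lemma star_E_simps:
  "carrier (star_E n) = {\<phi> \<in> functionals n. finite {j. \<exists>f\<in>mpoly_grading n j. \<phi> f \<noteq> 0}}"
  "\<zero>\<^bsub>star_E n\<^esub> = (\<lambda>_. 0)" "add (star_E n) = (\<lambda>\<phi> \<psi> f. \<phi> f + \<psi> f)"
  "smult (star_E n) = (\<lambda>r \<phi> f. if f \<in> carrier (mpoly_ring n) then \<phi> (r * f) else 0)"
  by (simp_all add: star_E_def)

lemma group_star_E: "group (add_monoid (star_E n :: ('k::field mpoly, 'k mpoly \<Rightarrow> 'k) module))"
proof (rule groupI)
  fix \<phi> \<psi> :: "'k mpoly \<Rightarrow> 'k"
  assume \<phi>: "\<phi> \<in> carrier (add_monoid (star_E n))" and \<psi>: "\<psi> \<in> carrier (add_monoid (star_E n))"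
  have "{j. \<exists>f\<in>mpoly_grading n j. \<phi> f + \<psi> f \<noteq> 0} \<subseteq>
      {j. \<exists>f\<in>mpoly_grading n j. \<phi> f \<noteq> 0} \<union> {j. \<exists>f\<in>mpoly_grading n j. \<psi> f \<noteq> 0}"
    by force
  moreover have "finite ({j. \<exists>f\<in>mpoly_grading n j. \<phi> f \<noteq> 0} \<union> {j. \<exists>f\<in>mpoly_grading n j. \<psi> f \<noteq> 0})"
    using \<phi> \<psi> by (simp add: star_E_simps)
  ultimately have "finite {j. \<exists>f\<in>mpoly_grading n j. \<phi> f + \<psi> f \<noteq> 0}"
    by (rule finite_subset)
  moreover have "(\<lambda>f. \<phi> f + \<psi> f) \<in> functionals n"
    using \<phi> \<psi> by (simp add: star_E_simps functionals_def algebra_simps)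
  ultimately show "\<phi> \<otimes>\<^bsub>add_monoid (star_E n)\<^esub> \<psi> \<in> carrier (add_monoid (star_E n))"
    by (simp add: star_E_simps)
next
  fix \<phi> :: "'k mpoly \<Rightarrow> 'k"
  assume \<phi>: "\<phi> \<in> carrier (add_monoid (star_E n))"
  have "(\<lambda>f. - \<phi> f) \<in> carrier (star_E n)"
    using \<phi> by (simp add: star_E_simps functionals_def)
  then show "\<exists>\<psi>\<in>carrier (add_monoid (star_E n)). \<psi> \<otimes>\<^bsub>add_monoid (star_E n)\<^esub> \<phi> = \<one>\<^bsub>add_monoid (star_E n)\<^esub>"
    by (intro bexI[of _ "\<lambda>f. - \<phi> f"]) (simp_all add: star_E_simps)
qed (auto simp: star_E_simps functionals_def add.assoc)

lemma copies_star_E_simps: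
  "carrier (copies I (star_E n)) = {x \<in> I \<rightarrow>\<^sub>E carrier (star_E n). finite {i \<in> I. x i \<noteq> (\<lambda>_. 0)}}"
  "add (copies I (star_E n)) = (\<lambda>x y. \<lambda>i\<in>I. \<lambda>f. x i f + y i f)"
  "smult (copies I (star_E n)) = (\<lambda>r x. \<lambda>i\<in>I. \<lambda>f. if f \<in> carrier (mpoly_ring n) then x i (r * f) else 0)"
  using carrier_sum_group[of I "\<lambda>_. add_monoid (star_E n)", OF group_star_E]
  by (simp_all add: copies_def star_E_simps)

section \<open>The isomorphism\<close>

context frob_graded_module
begin

text \<open>A monomial with an exponent above q_i is divisible by a killing power of x_i, so the
  exponents of a surviving monomial, and hence its degree, are bounded.\<close>

lemma monomial_torsion:
  assumes tors: "\<And>i. i < n \<Longrightarrow> \<exists>q. (mpoly_var i ^ q) \<odot>\<^bsub>M\<^esub> x = \<zero>\<^bsub>M\<^esub>" and x: "x \<in> carrier M"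
  shows "\<exists>N. \<forall>a. keys a \<subseteq> {..<n} \<longrightarrow> single a 1 \<odot>\<^bsub>M\<^esub> x \<noteq> \<zero>\<^bsub>M\<^esub> \<longrightarrow> monom_degree a < N"
proof -
  from tors obtain q where q: "\<And>i. i < n \<Longrightarrow> (mpoly_var i ^ q i) \<odot>\<^bsub>M\<^esub> x = \<zero>\<^bsub>M\<^esub>"
    by metis
  have "monom_degree a < Suc (\<Sum>i<n. q i)"
    if a: "keys a \<subseteq> {..<n}" "single a 1 \<odot>\<^bsub>M\<^esub> x \<noteq> \<zero>\<^bsub>M\<^esub>" for a
  proof -
    have "lookup a i \<le> q i" if i: "i < n" for i
    proof (rule ccontr)
      assume "\<not> lookup a i \<le> q i"
      then have "\<exists>b. a = single i (q i) + b"
        unfolding monomial_dvd_iff by (auto simp: lookup_single when_def)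
      then obtain b where b: "a = single i (q i) + b" by blast
      have kb: "keys b \<subseteq> {..<n}"
        using a(1) unfolding b keys_monomial_add by blast
      have "monom_scale (q i) (single i 1) = single i (q i)"
        by (rule poly_mapping_eqI) (simp add: lookup_single when_def)
      then have var: "mpoly_var i ^ q i = (single (single i (q i)) 1 :: 'k mpoly)"
        by (simp add: mpoly_var_def single_power)
      have "single a 1 \<odot>\<^bsub>M\<^esub> x = single b 1 \<odot>\<^bsub>M\<^esub> (single (single i (q i)) 1 \<odot>\<^bsub>M\<^esub> x)"
        using smult_assoc1[of "single b 1" "single (single i (q i)) 1" x] kb i x
        by (simp add: b mult_single add.commute[of b] split: if_splits)
      with q[OF i] a(2) kb show False
        using smult_r_null[of "single b 1"] by (simp add: var)
    qed
    then have "(\<Sum>i<n. lookup a i) \<le> (\<Sum>i<n. q i)"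
      by (intro sum_mono) auto
    then show ?thesis
      using monom_degree_eq_sum[OF a(1)] by simp
  qed
  then show ?thesis by blast
qed

lemma const_grading: "mpoly_const c \<in> mpoly_grading n 0"
  using single_mem_mpoly_grading[of 0 n c] by (simp add: mpoly_const_def)

lemma hcomp_const_smult: "x \<in> carrier M \<Longrightarrow> hcomp d (mpoly_const c \<odot>\<^bsub>M\<^esub> x) = mpoly_const c \<odot>\<^bsub>M\<^esub> hcomp d x"
  using hcomp_smult[OF const_grading, of c x d] by simp

lemma socle_const_smult:
  assumes "s \<in> socle"
  shows "mpoly_const c \<odot>\<^bsub>M\<^esub> s \<in> socle"
proof -
  have "mpoly_var i \<odot>\<^bsub>M\<^esub> (mpoly_const c \<odot>\<^bsub>M\<^esub> s) = mpoly_const c \<odot>\<^bsub>M\<^esub> (mpoly_var i \<odot>\<^bsub>M\<^esub> s)" if "i < n" for i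
    using smult_assoc1[of "mpoly_var i" "mpoly_const c" s] smult_assoc1[of "mpoly_const c" "mpoly_var i" s]
      that assms by (simp add: socle_closed mult.commute)
  then show ?thesis
    using assms by (auto simp: socle_def)
qed

text \<open>Torsion serves twice: the functionals vanish in almost all degrees, and every nonzero
  homogeneous element can be multiplied to a nonzero socle element.\<close>

theorem isomorphic_to_copies:
  assumes tors: "\<And>x i. \<lbrakk>x \<in> carrier M; i < n\<rbrakk> \<Longrightarrow> \<exists>q. (mpoly_var i ^ q) \<odot>\<^bsub>M\<^esub> x = \<zero>\<^bsub>M\<^esub>"
  shows "\<exists>(I :: 'm set) \<Phi>. module_iso R M (copies I (star_E n)) \<Phi> \<and>
    degree_preserving Mg (copies_grading I (star_E n) (shift_grading (star_E_grading n) (int n))) \<Phi>"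
proof -
  let ?d = "- int n"
  obtain I :: "'m set" and \<pi> :: "'m \<Rightarrow> 'm \<Rightarrow> 'k" where I: "I \<subseteq> socle"
    and \<pi>_add: "\<And>i x y. \<lbrakk>i \<in> I; x \<in> carrier M; y \<in> carrier M\<rbrakk> \<Longrightarrow> \<pi> i (x \<oplus>\<^bsub>M\<^esub> y) = \<pi> i x + \<pi> i y"
    and \<pi>_const: "\<And>i c x. \<lbrakk>i \<in> I; x \<in> carrier M\<rbrakk> \<Longrightarrow> \<pi> i (mpoly_const c \<odot>\<^bsub>M\<^esub> x) = c * \<pi> i x"
    and \<pi>_fin: "\<And>x. x \<in> carrier M \<Longrightarrow> finite {i \<in> I. \<pi> i x \<noteq> 0}"
    and \<pi>_delta: "\<And>i j. \<lbrakk>i \<in> I; j \<in> I\<rbrakk> \<Longrightarrow> \<pi> i j = (if i = j then 1 else 0)"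
    and \<pi>_socle: "\<And>s. \<lbrakk>s \<in> socle; \<forall>i\<in>I. \<pi> i s = 0\<rbrakk> \<Longrightarrow> s = \<zero>\<^bsub>M\<^esub>"
  proof (rule subspace_coordinates[of mpoly_const socle])
    show "x \<oplus>\<^bsub>M\<^esub> y \<in> socle" if "x \<in> socle" "y \<in> socle" for x y
      using that by (auto simp: socle_def smult_r_distr)
    show "socle \<subseteq> carrier M" "\<zero>\<^bsub>M\<^esub> \<in> socle"
      by (auto simp: socle_def)
    show "mpoly_const c \<odot>\<^bsub>M\<^esub> x \<in> socle" if "x \<in> socle" for c x
      by (rule socle_const_smult[OF that])
    show "mpoly_const c \<in> carrier R" for c
      by simp
    show "mpoly_const (c + d) = mpoly_const c \<oplus>\<^bsub>R\<^esub> mpoly_const d" for c d :: 'k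
      by (simp add: mpoly_const_def single_add)
    show "mpoly_const (c * d) = mpoly_const c \<otimes>\<^bsub>R\<^esub> mpoly_const d" for c d :: 'k
      by (simp add: mpoly_const_def mult_single)
    show "mpoly_const 0 = \<zero>\<^bsub>R\<^esub>" "mpoly_const 1 = \<one>\<^bsub>R\<^esub>"
      by (simp_all add: mpoly_const_def)
  qed (rule that)
  have \<pi>_0: "\<pi> i \<zero>\<^bsub>M\<^esub> = 0" if "i \<in> I" for i
    using \<pi>_const[OF that, of "\<zero>\<^bsub>M\<^esub>" 0] by simp
  \<comment> \<open>The coordinates \<open>\<pi>\<close> were extended to \<open>M\<close> without
    regard to the grading; the projection makes them vanish off degree - n.\<close>
  define \<psi> where "\<psi> i x = \<pi> i (hcomp ?d x)" for i x
  have \<psi>_add: "\<psi> i (x \<oplus>\<^bsub>M\<^esub> y) = \<psi> i x + \<psi> i y" if "i \<in> I" "x \<in> carrier M" "y \<in> carrier M" for i x y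
    using that by (simp add: \<psi>_def hcomp_add \<pi>_add hcomp_closed)
  have \<psi>_const: "\<psi> i (mpoly_const c \<odot>\<^bsub>M\<^esub> x) = c * \<psi> i x" if "i \<in> I" "x \<in> carrier M" for i c x
    using that by (simp add: \<psi>_def hcomp_const_smult \<pi>_const hcomp_closed)
  have \<psi>_homogeneous: "\<psi> i x = (if e = ?d then \<pi> i x else 0)" if "i \<in> I" "x \<in> Mg e" for i x e
    using that by (simp add: \<psi>_def hcomp_homogeneous \<pi>_0)
  have \<psi>_0: "\<psi> i \<zero>\<^bsub>M\<^esub> = 0" if "i \<in> I" for i
    using \<psi>_const[OF that, of "\<zero>\<^bsub>M\<^esub>" 0] by simp
  define \<Phi> where "\<Phi> x = (\<lambda>i\<in>I. \<lambda>f. if f \<in> carrier R then \<psi> i (f \<odot>\<^bsub>M\<^esub> x) else 0)" for x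

  have \<Phi>_functional: "\<Phi> x i \<in> functionals n" if x: "x \<in> carrier M" and i: "i \<in> I" for x i
    unfolding functionals_def
  proof (intro CollectI conjI ballI allI impI)
    show "\<Phi> x i (f + g) = \<Phi> x i f + \<Phi> x i g" if "f \<in> carrier R" "g \<in> carrier R" for f g
      using that x i smult_l_distr[of f g x] by (simp add: \<Phi>_def \<psi>_add)
    show "\<Phi> x i (mpoly_const c * f) = c * \<Phi> x i f" if "f \<in> carrier R" for c f
      using that x i smult_assoc1[of "mpoly_const c" f x] by (simp add: \<Phi>_def \<psi>_const)
  qed (use i in \<open>simp add: \<Phi>_def\<close>)

  have \<Phi>_monomial: "\<Phi> x i (single a 1) = \<psi> i (single a 1 \<odot>\<^bsub>M\<^esub> x)"
    if "i \<in> I" "keys a \<subseteq> {..<n}" for x i a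
    using that by (simp add: \<Phi>_def)

  have \<Phi>_closed: "\<Phi> x \<in> carrier (copies I (star_E n))" if x: "x \<in> carrier M" for x
  proof -
    obtain N where N: "\<And>a. \<lbrakk>keys a \<subseteq> {..<n}; single a 1 \<odot>\<^bsub>M\<^esub> x \<noteq> \<zero>\<^bsub>M\<^esub>\<rbrakk> \<Longrightarrow> monom_degree a < N"
      using monomial_torsion[OF tors[OF x] x] by blast
    have deg: "monom_degree a < N" if "i \<in> I" "keys a \<subseteq> {..<n}" "\<Phi> x i (single a 1) \<noteq> 0" for i a
    proof (rule N[OF that(2)])
      show "single a 1 \<odot>\<^bsub>M\<^esub> x \<noteq> \<zero>\<^bsub>M\<^esub>"
        using that(3) \<psi>_0[OF that(1)] \<Phi>_monomial[OF that(1,2), of x] by auto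
    qed
    have ex: "\<exists>a\<in>keys f. keys a \<subseteq> {..<n} \<and> \<Phi> x i (single a 1) \<noteq> 0"
      if "i \<in> I" "f \<in> carrier R" "\<Phi> x i f \<noteq> 0" for i f
      using functional_eq_0[OF \<Phi>_functional[OF x that(1)] that(2)] that(2,3) by (auto simp: mem_mpoly_ring)
    have "\<Phi> x i \<in> carrier (star_E n)" if i: "i \<in> I" for i
    proof -
      have "{j. \<exists>f\<in>mpoly_grading n j. \<Phi> x i f \<noteq> 0} \<subseteq> int ` {..<N}"
      proof
        fix j assume "j \<in> {j. \<exists>f\<in>mpoly_grading n j. \<Phi> x i f \<noteq> 0}"
        then obtain f where f: "f \<in> mpoly_grading n j" "\<Phi> x i f \<noteq> 0" by blast
        then obtain a where a: "a \<in> keys f" "keys a \<subseteq> {..<n}" "\<Phi> x i (single a 1) \<noteq> 0"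
          using ex[OF i _ f(2)] mpoly_grading_subset by blast
        have "j = int (monom_degree a)"
          using f(1) a(1) by (auto simp: mpoly_grading_def)
        then show "j \<in> int ` {..<N}"
          using deg[OF i a(2,3)] by blast
      qed
      then have "finite {j. \<exists>f\<in>mpoly_grading n j. \<Phi> x i f \<noteq> 0}"
        by (rule finite_subset) auto
      then show ?thesis
        using \<Phi>_functional[OF x i] by (simp add: star_E_simps)
    qed
    \<comment> \<open>Only the finitely many monomials of degree below \<open>N\<close> contribute,
      each with finitely many nonzero coordinates.\<close>
    moreover have "finite {i \<in> I. \<Phi> x i \<noteq> (\<lambda>_. 0)}"
    proof (rule finite_subset)
      let ?A = "{a. keys a \<subseteq> {..<n} \<and> monom_degree a < N}"
      show "{i \<in> I. \<Phi> x i \<noteq> (\<lambda>_. 0)} \<subseteq> (\<Union>a\<in>?A. {i \<in> I. \<pi> i (hcomp ?d (single a 1 \<odot>\<^bsub>M\<^esub> x)) \<noteq> 0})"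
      proof
        fix i assume "i \<in> {i \<in> I. \<Phi> x i \<noteq> (\<lambda>_. 0)}"
        then obtain f where i: "i \<in> I" and f: "\<Phi> x i f \<noteq> 0" by auto
        then have "f \<in> carrier R"
          by (auto simp: \<Phi>_def split: if_splits)
        then obtain a where a: "keys a \<subseteq> {..<n}" "\<Phi> x i (single a 1) \<noteq> 0"
          using ex[OF i _ f] by blast
        with deg[OF i a] i show "i \<in> (\<Union>a\<in>?A. {i \<in> I. \<pi> i (hcomp ?d (single a 1 \<odot>\<^bsub>M\<^esub> x)) \<noteq> 0})"
          by (auto simp: \<Phi>_monomial \<psi>_def)
      qed
      show "finite (\<Union>a\<in>?A. {i \<in> I. \<pi> i (hcomp ?d (single a 1 \<odot>\<^bsub>M\<^esub> x)) \<noteq> 0})"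
        by (intro finite_UN_I finite_monomials_degree_less \<pi>_fin hcomp_closed) (use x in auto)
    qed
    moreover have "\<Phi> x \<in> extensional I"
      by (simp add: \<Phi>_def)
    ultimately show ?thesis
      by (auto simp: copies_star_E_simps PiE_iff)
  qed

  have \<Phi>_add: "\<Phi> (x \<oplus>\<^bsub>M\<^esub> y) = \<Phi> x \<oplus>\<^bsub>copies I (star_E n)\<^esub> \<Phi> y" if "x \<in> carrier M" "y \<in> carrier M" for x y
    using that by (auto simp: \<Phi>_def copies_star_E_simps smult_r_distr \<psi>_add intro!: restrict_ext)

  have \<Phi>_smult: "\<Phi> (r \<odot>\<^bsub>M\<^esub> x) = r \<odot>\<^bsub>copies I (star_E n)\<^esub> \<Phi> x" if "r \<in> carrier R" "x \<in> carrier M" for r x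
  proof -
    have "f \<odot>\<^bsub>M\<^esub> (r \<odot>\<^bsub>M\<^esub> x) = (r * f) \<odot>\<^bsub>M\<^esub> x" if "f \<in> carrier R" for f
      using smult_assoc1[of f r x] that \<open>r \<in> carrier R\<close> \<open>x \<in> carrier M\<close> by (simp add: mult.commute)
    then show ?thesis
      using that by (auto simp: \<Phi>_def copies_star_E_simps intro!: restrict_ext)
  qed

  \<comment> \<open>A nonzero component of \<open>z\<close> is multiplied by a monomial of the
    largest degree that does not kill it. The result is a nonzero socle element, so some coordinate
    detects it.\<close>
  have kernel: "z = \<zero>\<^bsub>M\<^esub>"
    if z: "z \<in> carrier M" and zero: "\<And>i a. \<lbrakk>i \<in> I; keys a \<subseteq> {..<n}\<rbrakk> \<Longrightarrow> \<psi> i (single a 1 \<odot>\<^bsub>M\<^esub> z) = 0" for z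
  proof (rule ccontr)
    assume "z \<noteq> \<zero>\<^bsub>M\<^esub>"
    have "\<exists>d. hcomp d z \<noteq> \<zero>\<^bsub>M\<^esub>"
    proof (rule ccontr)
      assume "\<not> ?thesis"
      then have "z = \<zero>\<^bsub>M\<^esub>"
        using hcomp_sum[OF z, of "{}"] by simp
      with \<open>z \<noteq> \<zero>\<^bsub>M\<^esub>\<close> show False ..
    qed
    then obtain d where d: "hcomp d z \<noteq> \<zero>\<^bsub>M\<^esub>" by blast
    define w where "w = hcomp d z"
    have w: "w \<in> carrier M" "w \<in> Mg d"
      using z by (auto simp: w_def hcomp_closed hcomp_props)
    obtain N where N: "\<And>a. \<lbrakk>keys a \<subseteq> {..<n}; single a 1 \<odot>\<^bsub>M\<^esub> w \<noteq> \<zero>\<^bsub>M\<^esub>\<rbrakk> \<Longrightarrow> monom_degree a < N"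
      using monomial_torsion[OF tors[OF w(1)] w(1)] by blast
    let ?P = "\<lambda>a. keys a \<subseteq> {..<n} \<and> single a 1 \<odot>\<^bsub>M\<^esub> w \<noteq> \<zero>\<^bsub>M\<^esub>"
    have "?P 0"
      using d smult_one[OF w(1)] by (simp add: w_def)
    moreover have "\<forall>a. ?P a \<longrightarrow> monom_degree a < N"
      using N by auto
    ultimately have "\<exists>a. ?P a \<and> (\<forall>b. ?P b \<longrightarrow> monom_degree b \<le> monom_degree a)"
      by (rule ex_has_greatest_nat[where P = ?P])
    then obtain a where a: "keys a \<subseteq> {..<n}" "single a 1 \<odot>\<^bsub>M\<^esub> w \<noteq> \<zero>\<^bsub>M\<^esub>"
      and max: "\<And>b. \<lbrakk>keys b \<subseteq> {..<n}; single b 1 \<odot>\<^bsub>M\<^esub> w \<noteq> \<zero>\<^bsub>M\<^esub>\<rbrakk> \<Longrightarrow> monom_degree b \<le> monom_degree a"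
      by blast
    define s where "s = single a 1 \<odot>\<^bsub>M\<^esub> w"
    have "mpoly_var i \<odot>\<^bsub>M\<^esub> s = \<zero>\<^bsub>M\<^esub>" if i: "i < n" for i
    proof (rule ccontr)
      assume neq: "mpoly_var i \<odot>\<^bsub>M\<^esub> s \<noteq> \<zero>\<^bsub>M\<^esub>"
      have "mpoly_var i \<odot>\<^bsub>M\<^esub> s = single (single i 1 + a) 1 \<odot>\<^bsub>M\<^esub> w"
        using smult_assoc1[of "mpoly_var i" "single a 1" w] i a w
        by (simp add: s_def mpoly_var_def mult_single)
      with neq max[of "single i 1 + a"] a(1) i show False
        by (auto simp: keys_monomial_add monom_degree_add)
    qed
    then have s: "s \<in> socle"
      using a w by (auto simp: s_def socle_def)
    have s_deg: "s \<in> Mg (int (monom_degree a) + d)"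
      unfolding s_def using a by (intro smult_grade single_mem_mpoly_grading w)
    then have deg: "int (monom_degree a) + d = ?d"
      using socle_degree[OF s] a(2) by (simp add: s_def)
    \<comment> \<open>The socle degree forces |a| + d = - n, so \<open>s\<close> is the very
      component that \<open>\<psi>\<close> reads off from x^a z.\<close>
    have "hcomp ?d (single a 1 \<odot>\<^bsub>M\<^esub> z) = s"
      using hcomp_smult[OF single_mem_mpoly_grading[OF a(1)] _ z, of 1 ?d] a(1) deg
      by (simp add: s_def w_def algebra_simps flip: deg)
    then have "\<pi> i s = 0" if "i \<in> I" for i
      using zero[OF that a(1)] by (simp add: \<psi>_def)
    then have "s = \<zero>\<^bsub>M\<^esub>"
      by (intro \<pi>_socle[OF s] ballI)
    with a(2) show False by (simp add: s_def)
  qed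

  have \<Phi>_inj: "inj_on \<Phi> (carrier M)"
  proof (rule inj_onI)
    fix x y assume xy: "x \<in> carrier M" "y \<in> carrier M" and eq: "\<Phi> x = \<Phi> y"
    define z where "z = x \<ominus>\<^bsub>M\<^esub> y"
    have z: "z \<in> carrier M" and x: "x = z \<oplus>\<^bsub>M\<^esub> y"
      using xy by (auto simp: z_def a_minus_def M.a_assoc M.l_neg)
    have "\<psi> i (single a 1 \<odot>\<^bsub>M\<^esub> z) = 0" if i: "i \<in> I" and a: "keys a \<subseteq> {..<n}" for i a
    proof -
      have "\<psi> i (single a 1 \<odot>\<^bsub>M\<^esub> x) = \<psi> i (single a 1 \<odot>\<^bsub>M\<^esub> y)"
        using \<Phi>_monomial[OF that] eq by metis
      then show ?thesis
        using that z xy(2) by (simp add: x smult_r_distr \<psi>_add)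
    qed
    then have "z = \<zero>\<^bsub>M\<^esub>"
      by (intro kernel[OF z])
    then show "x = y" using x xy by simp
  qed

  have \<Phi>_surj: "g \<in> \<Phi> ` carrier M" if g: "g \<in> carrier (copies I (star_E n))" for g
  proof -
    have g_ext: "g \<in> extensional I" and g_fin: "finite {i \<in> I. g i \<noteq> (\<lambda>_. 0)}"
      and g_E: "\<And>i. i \<in> I \<Longrightarrow> g i \<in> carrier (star_E n)"
      using g by (auto simp: copies_star_E_simps PiE_iff)
    define J where "J = {i \<in> I. g i \<noteq> (\<lambda>_. 0)}"
    define A where "A = {a. keys a \<subseteq> {..<n} \<and> (\<exists>i\<in>J. g i (single a 1) \<noteq> 0)}"
    have "finite {a. keys a \<subseteq> {..<n} \<and> g i (single a 1) \<noteq> 0}" if i: "i \<in> I" for i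
    proof -
      let ?D = "{j. \<exists>f\<in>mpoly_grading n j. g i f \<noteq> 0}"
      have fin: "finite ?D"
        using g_E[OF i] by (simp add: star_E_simps)
      \<comment> \<open>For empty \<open>?D\<close> the value of \<open>Max\<close> is arbitrary,
        but then there is no monomial to bound.\<close>
      define N where "N = Suc (nat (Max ?D))"
      have "monom_degree a < N" if "keys a \<subseteq> {..<n}" "g i (single a 1) \<noteq> 0" for a
      proof -
        have "int (monom_degree a) \<in> ?D"
          using that single_mem_mpoly_grading by blast
        then have "int (monom_degree a) \<le> Max ?D"
          by (rule Max_ge[OF fin])
        then show ?thesis by (simp add: N_def)
      qed
      then show ?thesis
        by (intro finite_subset[OF _ finite_monomials_degree_less[of n N]]) auto
    qed
    then have "finite (\<Union>i\<in>J. {a. keys a \<subseteq> {..<n} \<and> g i (single a 1) \<noteq> 0})"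
      using g_fin by (intro finite_UN_I) (auto simp: J_def)
    moreover have "A = (\<Union>i\<in>J. {a. keys a \<subseteq> {..<n} \<and> g i (single a 1) \<noteq> 0})"
      by (auto simp: A_def)
    ultimately have fin: "finite (J \<times> A)"
      using g_fin by (auto simp: J_def)
    let ?P = "\<lambda>i a y. y \<in> Mg (?d - int (monom_degree a)) \<and> single a 1 \<odot>\<^bsub>M\<^esub> y = i \<and>
        (\<forall>c. keys c \<subseteq> {..<n} \<longrightarrow> monom_degree c = monom_degree a \<longrightarrow> c \<noteq> a \<longrightarrow> single c 1 \<odot>\<^bsub>M\<^esub> y = \<zero>\<^bsub>M\<^esub>)"
    \<comment> \<open>A preimage of the vector dual to x^a in the copy with index \<open>i\<close>,
      as \<open>\<psi>_Y\<close> shows.\<close>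
    define Y where "Y i a = (SOME y. ?P i a y)" for i a
    have "?P i a (Y i a)" if "i \<in> I" "keys a \<subseteq> {..<n}" for i a
      unfolding Y_def by (rule someI_ex[of "?P i a"], rule socle_divide) (use that I in auto)
    then have Y: "\<And>i a. \<lbrakk>i \<in> I; keys a \<subseteq> {..<n}\<rbrakk> \<Longrightarrow> Y i a \<in> Mg (?d - int (monom_degree a))"
      "\<And>i a. \<lbrakk>i \<in> I; keys a \<subseteq> {..<n}\<rbrakk> \<Longrightarrow> single a 1 \<odot>\<^bsub>M\<^esub> Y i a = i"
      "\<And>i a c. \<lbrakk>i \<in> I; keys a \<subseteq> {..<n}; keys c \<subseteq> {..<n}; monom_degree c = monom_degree a; c \<noteq> a\<rbrakk>
        \<Longrightarrow> single c 1 \<odot>\<^bsub>M\<^esub> Y i a = \<zero>\<^bsub>M\<^esub>"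
      by simp_all
    have Y_closed: "Y i a \<in> carrier M" if "i \<in> I" "keys a \<subseteq> {..<n}" for i a
      using Mg_closed[OF Y(1)[OF that]] .
    \<comment> \<open>For c = a the product is the basis element \<open>i\<close>; for another
      monomial of the same degree it is zero; in all other cases it lies outside degree - n.\<close>
    have \<psi>_Y: "\<psi> j (single c 1 \<odot>\<^bsub>M\<^esub> Y i a) = (if (i, a) = (j, c) then 1 else 0)"
      if i: "i \<in> I" and j: "j \<in> I" and a: "keys a \<subseteq> {..<n}" and c: "keys c \<subseteq> {..<n}" for i j a c
    proof (cases "c = a")
      case True
      have "i \<in> Mg ?d"
        using socle_homogeneous I i by blast
      then show ?thesis
        using True Y(2)[OF i a] \<psi>_homogeneous[OF j] \<pi>_delta[OF j i] by auto
    next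
      case False
      show ?thesis
      proof (cases "monom_degree c = monom_degree a")
        case True
        then show ?thesis
          using Y(3)[OF i a c True False] \<psi>_0[OF j] False by simp
      next
        case deg: False
        have "single c 1 \<odot>\<^bsub>M\<^esub> Y i a \<in> Mg (int (monom_degree c) + (?d - int (monom_degree a)))"
          by (intro smult_grade single_mem_mpoly_grading c Y(1) i a)
        from \<psi>_homogeneous[OF j this] show ?thesis
          using deg False by simp
      qed
    qed
    define F where "F u = mpoly_const (g (fst u) (single (snd u) 1)) \<odot>\<^bsub>M\<^esub> Y (fst u) (snd u)" for u
    have JA: "fst u \<in> I" "keys (snd u) \<subseteq> {..<n}" if "u \<in> J \<times> A" for u
      using that by (auto simp: J_def A_def)
    have F_closed: "F u \<in> carrier M" if "u \<in> J \<times> A" for u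
      unfolding F_def using JA[OF that] by (simp add: Y_closed)
    define x where "x = (\<Oplus>\<^bsub>M\<^esub>u\<in>J \<times> A. F u)"
    have x: "x \<in> carrier M"
      unfolding x_def using F_closed by (intro M.finsum_closed) auto
    have \<psi>_x: "\<psi> j (single c 1 \<odot>\<^bsub>M\<^esub> x) = g j (single c 1)" if j: "j \<in> I" and c: "keys c \<subseteq> {..<n}" for j c
    proof -
      have "\<psi> j (single c 1 \<odot>\<^bsub>M\<^esub> (\<Oplus>\<^bsub>M\<^esub>u\<in>U. F u)) = (\<Sum>u\<in>U. \<psi> j (single c 1 \<odot>\<^bsub>M\<^esub> F u))"
        if "finite U" "U \<subseteq> J \<times> A" for U
        using that
      proof (induction U)
        case empty
        then show ?case using \<psi>_0[OF j] c smult_r_null[of "single c 1"] by simp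
      next
        case (insert u U)
        then have "F u \<in> carrier M" "F \<in> U \<rightarrow> carrier M"
          using F_closed by auto
        with insert show ?case
          using c by (simp add: M.finsum_insert smult_r_distr \<psi>_add[OF j])
      qed
      from this[OF fin order_refl]
      have "\<psi> j (single c 1 \<odot>\<^bsub>M\<^esub> x) = (\<Sum>u\<in>J \<times> A. \<psi> j (single c 1 \<odot>\<^bsub>M\<^esub> F u))"
        by (simp add: x_def)
      also have "\<dots> = (\<Sum>u\<in>J \<times> A. if u = (j, c) then g j (single c 1) else 0)"
      proof (rule sum.cong[OF refl])
        fix u assume u: "u \<in> J \<times> A"
        let ?g = "g (fst u) (single (snd u) 1)"
        have "single c 1 \<odot>\<^bsub>M\<^esub> F u = mpoly_const ?g \<odot>\<^bsub>M\<^esub> (single c 1 \<odot>\<^bsub>M\<^esub> Y (fst u) (snd u))"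
          using smult_assoc1[of "single c 1" "mpoly_const ?g" "Y (fst u) (snd u)"]
            smult_assoc1[of "mpoly_const ?g" "single c 1" "Y (fst u) (snd u)"] JA[OF u] c Y_closed
          by (simp add: F_def mult.commute)
        then have "\<psi> j (single c 1 \<odot>\<^bsub>M\<^esub> F u) = ?g * \<psi> j (single c 1 \<odot>\<^bsub>M\<^esub> Y (fst u) (snd u))"
          using \<psi>_const[OF j, of "single c 1 \<odot>\<^bsub>M\<^esub> Y (fst u) (snd u)" ?g] Y_closed[OF JA[OF u]] c by simp
        then show "\<psi> j (single c 1 \<odot>\<^bsub>M\<^esub> F u) = (if u = (j, c) then g j (single c 1) else 0)"
          using \<psi>_Y[OF JA(1)[OF u] j JA(2)[OF u] c] by (cases u) auto
      qed
      also have "\<dots> = (if (j, c) \<in> J \<times> A then g j (single c 1) else 0)"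
        using fin by (simp add: sum.delta')
      \<comment> \<open>For a pair outside \<open>J \<times> A\<close> the value of \<open>g\<close>
        is zero by the choice of \<open>J\<close> and \<open>A\<close>.\<close>
      also have "\<dots> = g j (single c 1)"
        using j c by (auto simp: J_def A_def)
      finally show ?thesis .
    qed
    have "\<Phi> x = g"
    proof (rule extensionalityI[of _ I])
      show "\<Phi> x \<in> extensional I" by (simp add: \<Phi>_def)
      show "\<Phi> x i = g i" if i: "i \<in> I" for i
      proof (rule functionals_eqI[OF \<Phi>_functional[OF x i]])
        show "g i \<in> functionals n"
          using g_E[OF i] by (simp add: star_E_simps)
        show "\<Phi> x i (single a 1) = g i (single a 1)" if "keys a \<subseteq> {..<n}" for a
          using \<Phi>_monomial[OF i that] \<psi>_x[OF i that] by simp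
      qed
    qed (fact g_ext)
    with x show ?thesis by blast
  qed

  have "module_iso R M (copies I (star_E n)) \<Phi>"
    unfolding module_iso_def bij_betw_def
    using \<Phi>_inj \<Phi>_closed \<Phi>_surj \<Phi>_add \<Phi>_smult by (auto simp: image_subset_iff)
  moreover have "degree_preserving Mg (copies_grading I (star_E n) (shift_grading (star_E_grading n) (int n))) \<Phi>"
    unfolding degree_preserving_def
  proof (intro allI image_subsetI)
    fix d x assume x: "x \<in> Mg d"
    \<comment> \<open>The product of \<open>f\<close> and \<open>x\<close> has degree j + d, and
      \<open>\<psi>\<close> sees only degree - n, that is j = - (d + n).\<close>
    have "\<Phi> x i f = 0" if i: "i \<in> I" and j: "j \<noteq> - (d + int n)" and f: "f \<in> mpoly_grading n j" for i j f
    proof -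
      have "f \<odot>\<^bsub>M\<^esub> x \<in> Mg (j + d)"
        by (rule smult_grade[OF f x])
      from \<psi>_homogeneous[OF i this] show ?thesis
        using i j by (simp add: \<Phi>_def)
    qed
    then show "\<Phi> x \<in> copies_grading I (star_E n) (shift_grading (star_E_grading n) (int n)) d"
      using \<Phi>_closed[OF Mg_closed[OF x]] \<Phi>_functional[OF Mg_closed[OF x]]
      by (simp add: copies_grading_def shift_grading_def star_E_grading_def)
  qed
  ultimately show ?thesis by blast
qed

end

theorem theorem3p3:
  fixes n p :: nat
    and M :: "('k::field mpoly, 'm) module"
    and Mg :: "int \<Rightarrow> 'm set"
    and \<theta> :: "'m \<Rightarrow> ('k mpoly \<times> 'm \<Rightarrow>\<^sub>0 int) set"
  assumes "CHAR('k) = p" and "p > 0"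
    and "graded_F_module p (mpoly_ring n) (mpoly_grading n) M Mg \<theta>"
    and "module_support (mpoly_ring n) M \<subseteq> {irrelevant_ideal n}"
  shows "\<exists>(I :: 'm set) \<Phi>.
    module_iso (mpoly_ring n) M (copies I (star_E n)) \<Phi> \<and>
    degree_preserving Mg
      (copies_grading I (star_E n) (shift_grading (star_E_grading n) (int n))) \<Phi>"
proof -
  obtain t where "frob_graded_module n M Mg p t"
    using graded_F_module_imp_frob_graded_module[OF assms(1-3)] by blast
  then interpret frob_graded_module n M Mg p t .
  show ?thesis
    by (rule isomorphic_to_copies) (rule torsion_of_support[OF module_axioms assms(4)])
qed

end
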